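(* Let $\Gamma$ be a crystallographic group generated by translations and rotations. A generic $\Gamma$-crystallographic direction network $(\tilde G,\varphi,\tilde{\mathbf d})$ has a faithful realization if and only if its associated colored graph is $\Gamma$-colored-Laman. This realization is unique up to translation and scaling.
   Context: **Groups.** $\mathrm{Euc}(2)\cong\mathbb R^2\rtimes O(2)$ with product $(v,r)(v',r')=(v+r v',rr')$. The crystallographic groups generated by translations and rotations are, up to isomorphism, $\Gamma_1=\mathbb Z^2$ and $\Gamma_k=\mathbb Z^2\rtimes\mathbb Z/k\mathbb Z$, $k=2,3,4,6$, where the generator of $\mathbb Z/k\mathbb Z$ acts on $\mathbb Z^2$ by the matrix $\begin{pmatrix}-1&0\\0&-1\end{pmatrix}$, $\begin{pmatrix}0&-1\\1&-1\end{pmatrix}$, $\begin{pmatrix}0&-1\\1&0\end{pmatrix}$, $\begin{pmatrix}0&-1\\1&1\end{pmatrix}$ for $k=2,3,4,6$ respectively. Let $\Gamma=\Gamma_k$. $\Lambda(\Gamma)=\mathbb Z^2$ is its translation subgroup; elements of $\Lambda(\Gamma)$ are called translations, all others rotations. For $\Gamma'<\Gamma$, $\Lambda(\Gamma')=\Gamma'\cap\Lambda(\Gamma)$. $\mathrm{Rep}(\Gamma)$ is the set of discrete faithful representations $\Gamma\to\mathrm{Euc}(2)$; $\mathrm{rep}_\Gamma(\Gamma')$ is the dimension of the set of homomorphisms $\Gamma'\to\mathrm{Euc}(2)$ that extend to an element of $\mathrm{Rep}(\Gamma)$. $T(\Gamma')=0$ if $\Gamma'$ contains a rotation and $2$ otherwise.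 $R_k$ is the counterclockwise rotation by $2\pi/k$ about the origin; $t_1,t_2$ are the standard generators of $\mathbb Z^2$, $r_k=((0,0),1)$. **Direction networks.** A $\Gamma$-crystallographic direction network $(\tilde G,\varphi,\tilde{\mathbf d})$ is an infinite graph $\tilde G=(\tilde V,\tilde E)$ with a free $\Gamma$-action $\varphi$ with finite quotient and an assignment of a direction $\tilde{\mathbf d}_{ij}\in\mathbb R^2\setminus\{0\}$ to each edge which is equivariant: if $\gamma=(t,r)\in\Gamma$ then $\tilde{\mathbf d}_{\gamma\cdot ij}=R_k^{\,r}\tilde{\mathbf d}_{ij}$. A realization consists of points $\mathbf p=(\mathbf p_i)_{i\in\tilde V}$ and a (possibly degenerate) representation $\Phi:\Gamma\to\mathrm{Euc}(2)$ such that $\langle\mathbf p_i-\mathbf p_j,\tilde{\mathbf d}_{ij}^\perp\rangle=0$ for all edges $ij$ and $\Phi(\gamma)\cdot\mathbf p_i=\mathbf p_{\gamma(i)}$ for all $\gamma,i$. Here the allowed representations are those of the form $\Phi(t_i)=(v_i,\mathrm{Id})$, $\Phi(r_k)=(w,R_k)$ (the latter for $k\ge2$) with $v_1,v_2,w\in\mathbb R^2$ arbitrary if $k=1,2$, and $v_1,w$ arbitrary and $v_2=R_kv_1$ if $k=3,4,6$. $\Phi$ is trivial if it maps all translations of $\Gamma$ to the zero translation. An edge $ij$ is collapsed if $\mathbf p_i=\mathbf p_j$. A realization is faithful if no edge is collapsed and $\Phi$ is not trivial. **Colored graphs.** A $\Gamma$-colored graph $(G,\boldsymbol\gamma)$ is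 a finite directed multigraph $G$ (loops allowed) with an element $\gamma_{ij}\in\Gamma$ on each edge. The associated colored graph (colored quotient) of $(\tilde G,\varphi)$ is $G=\tilde G/\Gamma$ with arbitrary edge orientations; choosing a representative $\tilde i$ of each vertex orbit, the edge from $i$ to $j$ gets the color $\gamma_{ij}$ such that the edge in the corresponding orbit with tail $\tilde i$ has head $\gamma_{ij}(\tilde j)$. For a closed path $P$ crossing edges $e_1,\dots,e_t$, $\rho(P)=\gamma_{e_1}^{\epsilon_1}\cdots\gamma_{e_t}^{\epsilon_t}$ with $\epsilon_s=\pm1$ according to whether $e_s$ is crossed forwards or backwards; this gives homomorphisms $\rho:\pi_1(G_i,b_i)\to\Gamma$ for the connected components $G_i$ with base vertices $b_i$. Let $\Lambda(G)$ be the subgroup generated by all $\Lambda(\rho(\pi_1(G_i,b_i)))$, $\mathrm{rep}_\Gamma(G)=\mathrm{rep}_\Gamma(\Lambda(G))$, $T(G_i)=T(\rho(\pi_1(G_i,b_i)))$ (independent of base vertices). For a colored graph with $n$ vertices and components $G_1,\dots,G_c$ put $h(G)=2n+\mathrm{rep}_\Gamma(G)-\sum_iT(G_i)-1$. $(G,\boldsymbol\gamma)$ with $n$ vertices and $m$ edges is $\Gamma$-colored-Laman if $m=2n+\mathrm{rep}_\Gamma(\Lambda(\Gamma))-T(\Gamma)-1$ and all subgraphs $G'$ spanning $m'$ edges satisfy $m'\le h(G')$. **Genericity.** By equivariance $\tilde{\mathbf d}$ is determined by its values on one representative per edge orbit, i.e. by a direction for each of the $m$ edges of $G$. "Generic"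 means: for all direction assignments outside a proper algebraic subset (depending on the colored graph) of $(\mathbb R^2)^m$.
   Formalization: The bare equivalence "faithful realization iff Γ-colored-Laman" fails with too few edges (Γ=Z², one vertex, one loop colored t₁), so it is stated for at least the Laman number of edges; for all networks, existence with uniqueness is proved equivalent to colored-Laman. *)

theory Defs
  imports
    "HOL-Algebra.Generated_Groups"
    "HOL-Algebra.Group_Action"
    "HOL-Analysis.Analysis"
    "Graph_Theory.Digraph_Component"
begin

section \<open>The groups Euc(2) and \<open>\<Gamma>\<^sub>k\<close>\<close>

type_synonym euc = "(real^2) \<times> (real^2^2)"

definition Euc2 :: "euc monoid" where
  "Euc2 = \<lparr>carrier = {(v, A). orthogonal_matrix A},
           monoid.mult = (\<lambda>(v, A) (w, B). (v + A *v w, A ** B)),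
           monoid.one = (0, mat 1)\<rparr>"

fun euc_apply :: "euc \<Rightarrow> real^2 \<Rightarrow> real^2" where
  "euc_apply (v, A) x = v + A *v x"

definition Rot :: "nat \<Rightarrow> real^2^2" where
  "Rot k = vector [vector [cos (2 * pi / real k), - sin (2 * pi / real k)],
                   vector [sin (2 * pi / real k),   cos (2 * pi / real k)]]"

text \<open>The integer matrix by which the generator of \<open>\<int>/k\<int>\<close> acts on \<open>\<int>\<^sup>2\<close>, applied to a column vector;
  only \<open>k \<in> {1, 2, 3, 4, 6}\<close> is meaningful.\<close>

definition lattice_rot :: "nat \<Rightarrow> int \<times> int \<Rightarrow> int \<times> int" where
  "lattice_rot k = (\<lambda>(a, b).
     if k = 2 then (- a, - b)
     else if k = 3 then (- b, a - b)
     else if k = 4 then (- b, a)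
     else if k = 6 then (- b, a + b)
     else (a, b))"

type_synonym gam = "(int \<times> int) \<times> nat"

definition Gam :: "nat \<Rightarrow> gam monoid" where
  "Gam k = \<lparr>carrier = UNIV \<times> {0..<k},
            monoid.mult = (\<lambda>((a, b), r) (t', r').
                     let (c, d) = (lattice_rot k ^^ r) t' in ((a + c, b + d), (r + r') mod k)),
            monoid.one = ((0, 0), 0)\<rparr>"

definition translation_part :: "nat \<Rightarrow> gam set" where
  "translation_part k = {x \<in> carrier (Gam k). snd x = 0}"

definition t1 :: gam where "t1 = ((1, 0), 0)"
definition t2 :: gam where "t2 = ((0, 1), 0)"
definition rgen :: gam where "rgen = ((0, 0), 1)"


section \<open>Representations, \<open>rep\<^sub>\<Gamma>\<close> and \<open>T\<close>\<close>

definition Rep :: "nat \<Rightarrow> (gam \<Rightarrow> euc) set" where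
  "Rep k = {\<Phi> \<in> hom (Gam k) Euc2. inj_on \<Phi> (carrier (Gam k)) \<and> discrete (\<Phi> ` carrier (Gam k))}"

text \<open>Dimension of a space: the largest \<open>d\<close> such that it contains a homeomorphic copy of \<open>\<real>\<^sup>d\<close>.
  For nonempty semialgebraic sets, such as the spaces of homomorphisms below, this is the usual
  dimension.\<close>

definition top_dim :: "'a topology \<Rightarrow> nat" where
  "top_dim X = (GREATEST d. \<exists>S \<subseteq> topspace X. subtopology X S homeomorphic_space Euclidean_space d)"

text \<open>Homomorphisms from a subgroup \<open>H\<close> of \<open>\<Gamma>\<^sub>k\<close> to Euc(2) are topologised by pointwise convergence.\<close>

definition extendable_homs :: "nat \<Rightarrow> gam set \<Rightarrow> (gam \<Rightarrow> euc) set" where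
  "extendable_homs k H =
     {f \<in> hom ((Gam k)\<lparr>carrier := H\<rparr>) Euc2 \<inter> extensional H. \<exists>\<Phi> \<in> Rep k. \<forall>x \<in> H. \<Phi> x = f x}"

definition rep :: "nat \<Rightarrow> gam set \<Rightarrow> nat" where
  "rep k H = top_dim (subtopology (product_topology (\<lambda>_. euclidean) H) (extendable_homs k H))"

definition T_val :: "nat \<Rightarrow> gam set \<Rightarrow> nat" where
  "T_val k H = (if \<exists>x \<in> H. x \<notin> translation_part k then 0 else 2)"


section \<open>Colored graphs\<close>

definition colored_graph :: "nat \<Rightarrow> ('a, 'b) pre_digraph \<Rightarrow> ('b \<Rightarrow> gam) \<Rightarrow> bool" where
  "colored_graph k G col \<longleftrightarrow> fin_digraph G \<and> col \<in> arcs G \<rightarrow> carrier (Gam k)"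

text \<open>A path is a list of arcs, each with a flag telling whether it is crossed forwards.\<close>

fun is_path :: "('a, 'b) pre_digraph \<Rightarrow> 'a \<Rightarrow> ('b \<times> bool) list \<Rightarrow> 'a \<Rightarrow> bool" where
  "is_path G u [] v \<longleftrightarrow> u \<in> verts G \<and> u = v"
| "is_path G u ((e, fwd) # P) v \<longleftrightarrow> e \<in> arcs G \<and>
     (if fwd then u = tail G e \<and> is_path G (head G e) P v
             else u = head G e \<and> is_path G (tail G e) P v)"

fun rho :: "nat \<Rightarrow> ('b \<Rightarrow> gam) \<Rightarrow> ('b \<times> bool) list \<Rightarrow> gam" where
  "rho k col [] = \<one>\<^bsub>Gam k\<^esub>"
| "rho k col ((e, fwd) # P) =
     (if fwd then col e else inv\<^bsub>Gam k\<^esub> (col e)) \<otimes>\<^bsub>Gam k\<^esub> rho k col P"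

text \<open>The image of \<open>\<pi>\<^sub>1(G, b)\<close> under \<open>\<rho>\<close>: every homotopy class is represented by a closed path.\<close>

definition rho_pi1 :: "nat \<Rightarrow> ('a, 'b) pre_digraph \<Rightarrow> ('b \<Rightarrow> gam) \<Rightarrow> 'a \<Rightarrow> gam set" where
  "rho_pi1 k G col b = {rho k col P | P. is_path G b P b}"

definition conn_components :: "('a, 'b) pre_digraph \<Rightarrow> 'a set set" where
  "conn_components G = {{v. \<exists>P. is_path G u P v} | u. u \<in> verts G}"

definition base_vertex :: "'a set \<Rightarrow> 'a" where
  "base_vertex C = (SOME b. b \<in> C)"

definition Lambda :: "nat \<Rightarrow> ('a, 'b) pre_digraph \<Rightarrow> ('b \<Rightarrow> gam) \<Rightarrow> gam set" where
  "Lambda k G col =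
     generate (Gam k) (\<Union>C \<in> conn_components G. rho_pi1 k G col (base_vertex C) \<inter> translation_part k)"

definition h_count :: "nat \<Rightarrow> ('a, 'b) pre_digraph \<Rightarrow> ('b \<Rightarrow> gam) \<Rightarrow> int" where
  "h_count k G col = 2 * int (card (verts G)) + int (rep k (Lambda k G col))
     - (\<Sum>C \<in> conn_components G. int (T_val k (rho_pi1 k G col (base_vertex C)))) - 1"

definition laman_count :: "nat \<Rightarrow> ('a, 'b) pre_digraph \<Rightarrow> int" where
  "laman_count k G = 2 * int (card (verts G)) + int (rep k (translation_part k))
     - int (T_val k (carrier (Gam k))) - 1"

text \<open>Subgraphs without edges are excluded: for them the right-hand side is \<open>-1\<close>.\<close>

definition colored_laman :: "nat \<Rightarrow> ('a, 'b) pre_digraph \<Rightarrow> ('b \<Rightarrow> gam) \<Rightarrow> bool" where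
  "colored_laman k G col \<longleftrightarrow>
     int (card (arcs G)) = laman_count k G \<and>
     (\<forall>G'. subgraph G' G \<and> arcs G' \<noteq> {} \<longrightarrow> int (card (arcs G')) \<le> h_count k G' col)"


section \<open>Direction networks\<close>

text \<open>Undirected graphs (parallel edges and loops allowed) with maps describing an action of \<open>\<Gamma>\<^sub>k\<close>
  on nodes and on edges; \<open>ends e\<close> is the set of the one or two end points of \<open>e\<close>.\<close>

record ('v, 'e) gam_graph =
  nodes :: "'v set"
  edges :: "'e set"
  ends :: "'e \<Rightarrow> 'v set"
  nact :: "gam \<Rightarrow> 'v \<Rightarrow> 'v"
  eact :: "gam \<Rightarrow> 'e \<Rightarrow> 'e"

definition free_gam_graph :: "nat \<Rightarrow> ('v, 'e) gam_graph \<Rightarrow> bool" where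
  "free_gam_graph k N \<longleftrightarrow>
     infinite (nodes N) \<and>
     (\<forall>e \<in> edges N. \<exists>i \<in> nodes N. \<exists>j \<in> nodes N. ends N e = {i, j}) \<and>
     group_action (Gam k) (nodes N) (nact N) \<and>
     group_action (Gam k) (edges N) (eact N) \<and>
     (\<forall>g \<in> carrier (Gam k). \<forall>e \<in> edges N. ends N (eact N g e) = nact N g ` ends N e) \<and>
     (\<forall>i \<in> nodes N. stabilizer (Gam k) (nact N) i = {\<one>\<^bsub>Gam k\<^esub>}) \<and>
     (\<forall>e \<in> edges N. stabilizer (Gam k) (eact N) e = {\<one>\<^bsub>Gam k\<^esub>}) \<and>
     finite (orbits (Gam k) (nodes N) (nact N)) \<and>
     finite (orbits (Gam k) (edges N) (eact N))"

definition direction_network :: "nat \<Rightarrow> ('v, 'e) gam_graph \<Rightarrow> ('e \<Rightarrow> real^2) \<Rightarrow> bool" where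
  "direction_network k N d \<longleftrightarrow>
     free_gam_graph k N \<and>
     (\<forall>e \<in> edges N. d e \<noteq> 0) \<and>
     (\<forall>g \<in> carrier (Gam k). \<forall>e \<in> edges N. d (eact N g e) = (((*v) (Rot k)) ^^ snd g) (d e))"

text \<open>\<open>(G, col)\<close> is a colored quotient of \<open>N\<close>: \<open>vr\<close> and \<open>er\<close> choose one representative of each node
  orbit and each edge orbit, where the representative of an edge orbit is an edge whose tail, in the
  orientation chosen in \<open>G\<close>, is a chosen node.\<close>

definition colored_quotient ::
  "nat \<Rightarrow> ('v, 'e) gam_graph \<Rightarrow> ('a, 'b) pre_digraph \<Rightarrow> ('b \<Rightarrow> gam) \<Rightarrow> ('a \<Rightarrow> 'v) \<Rightarrow> ('b \<Rightarrow> 'e) \<Rightarrow> bool"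
where
  "colored_quotient k N G col vr er \<longleftrightarrow>
     colored_graph k G col \<and>
     vr \<in> verts G \<rightarrow> nodes N \<and> er \<in> arcs G \<rightarrow> edges N \<and>
     bij_betw (\<lambda>i. orbit (Gam k) (nact N) (vr i)) (verts G) (orbits (Gam k) (nodes N) (nact N)) \<and>
     bij_betw (\<lambda>e. orbit (Gam k) (eact N) (er e)) (arcs G) (orbits (Gam k) (edges N) (eact N)) \<and>
     (\<forall>e \<in> arcs G. ends N (er e) = {vr (tail G e), nact N (col e) (vr (head G e))})"


section \<open>Realizations\<close>

definition perp :: "real^2 \<Rightarrow> real^2" where
  "perp x = vector [- x $ 2, x $ 1]"

definition allowed_rep :: "nat \<Rightarrow> (gam \<Rightarrow> euc) \<Rightarrow> bool" where
  "allowed_rep k \<Phi> \<longleftrightarrow> \<Phi> \<in> hom (Gam k) Euc2 \<and>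
     (\<exists>v1 v2 w. \<Phi> t1 = (v1, mat 1) \<and> \<Phi> t2 = (v2, mat 1) \<and>
        (k \<ge> 2 \<longrightarrow> \<Phi> rgen = (w, Rot k)) \<and>
        (k \<ge> 3 \<longrightarrow> v2 = Rot k *v v1))"

definition realization ::
  "nat \<Rightarrow> ('v, 'e) gam_graph \<Rightarrow> ('e \<Rightarrow> real^2) \<Rightarrow> ('v \<Rightarrow> real^2) \<Rightarrow> (gam \<Rightarrow> euc) \<Rightarrow> bool"
where
  "realization k N d p \<Phi> \<longleftrightarrow>
     allowed_rep k \<Phi> \<and>
     (\<forall>e \<in> edges N. \<forall>i j. ends N e = {i, j} \<longrightarrow> (p i - p j) \<bullet> perp (d e) = 0) \<and>
     (\<forall>g \<in> carrier (Gam k). \<forall>i \<in> nodes N. euc_apply (\<Phi> g) (p i) = p (nact N g i))"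

definition trivial_rep :: "nat \<Rightarrow> (gam \<Rightarrow> euc) \<Rightarrow> bool" where
  "trivial_rep k \<Phi> \<longleftrightarrow> (\<forall>x \<in> translation_part k. \<Phi> x = (0, mat 1))"

definition collapsed :: "('v, 'e) gam_graph \<Rightarrow> ('v \<Rightarrow> real^2) \<Rightarrow> 'e \<Rightarrow> bool" where
  "collapsed N p e \<longleftrightarrow> (\<exists>i j. ends N e = {i, j} \<and> p i = p j)"

definition faithful_realization ::
  "nat \<Rightarrow> ('v, 'e) gam_graph \<Rightarrow> ('e \<Rightarrow> real^2) \<Rightarrow> ('v \<Rightarrow> real^2) \<Rightarrow> (gam \<Rightarrow> euc) \<Rightarrow> bool"
where
  "faithful_realization k N d p \<Phi> \<longleftrightarrow>
     realization k N d p \<Phi> \<and> (\<forall>e \<in> edges N. \<not> collapsed N p e) \<and> \<not> trivial_rep k \<Phi>"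

text \<open>The second realization is the image of the first one, points and representation alike, under
  a map \<open>x \<mapsto> c x + s\<close> with \<open>c \<noteq> 0\<close>. Negative \<open>c\<close> must be allowed, since directions only constrain
  lines: the point reflection of a realization is again a realization.\<close>

definition same_up_to_translation_scaling ::
  "nat \<Rightarrow> ('v, 'e) gam_graph \<Rightarrow> ('v \<Rightarrow> real^2) \<Rightarrow> (gam \<Rightarrow> euc) \<Rightarrow> ('v \<Rightarrow> real^2) \<Rightarrow> (gam \<Rightarrow> euc) \<Rightarrow> bool"
where
  "same_up_to_translation_scaling k N p \<Phi> p' \<Phi>' \<longleftrightarrow>
     (\<exists>c s. c \<noteq> 0 \<and>
        (\<forall>i \<in> nodes N. p' i = c *\<^sub>R p i + s) \<and>
        (\<forall>g \<in> carrier (Gam k). \<forall>x.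
           euc_apply (\<Phi>' g) (c *\<^sub>R x + s) = c *\<^sub>R euc_apply (\<Phi> g) x + s))"

definition has_faithful_realization ::
  "nat \<Rightarrow> ('v, 'e) gam_graph \<Rightarrow> ('e \<Rightarrow> real^2) \<Rightarrow> bool" where
  "has_faithful_realization k N d \<longleftrightarrow> (\<exists>p \<Phi>. faithful_realization k N d p \<Phi>)"

definition faithful_realizations_unique ::
  "nat \<Rightarrow> ('v, 'e) gam_graph \<Rightarrow> ('e \<Rightarrow> real^2) \<Rightarrow> bool" where
  "faithful_realizations_unique k N d \<longleftrightarrow>
     (\<forall>p \<Phi> p' \<Phi>'. faithful_realization k N d p \<Phi> \<and> faithful_realization k N d p' \<Phi>' \<longrightarrow>
        same_up_to_translation_scaling k N p \<Phi> p' \<Phi>')"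


section \<open>Genericity\<close>

text \<open>\<open>(\<real>\<^sup>2)\<^sup>m\<close> is modelled as \<open>S \<rightarrow>\<^sub>E UNIV\<close> for an index set \<open>S\<close> with \<open>m\<close> elements.\<close>

inductive_set poly_functions :: "'b set \<Rightarrow> (('b \<Rightarrow> real^2) \<Rightarrow> real) set" for S where
  const: "(\<lambda>_. c) \<in> poly_functions S"
| coord: "e \<in> S \<Longrightarrow> (\<lambda>x. x e $ i) \<in> poly_functions S"
| add: "f \<in> poly_functions S \<Longrightarrow> g \<in> poly_functions S \<Longrightarrow> (\<lambda>x. f x + g x) \<in> poly_functions S"
| mult: "f \<in> poly_functions S \<Longrightarrow> g \<in> poly_functions S \<Longrightarrow> (\<lambda>x. f x * g x) \<in> poly_functions S"

definition proper_algebraic_subset :: "'b set \<Rightarrow> ('b \<Rightarrow> real^2) set \<Rightarrow> bool" where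
  "proper_algebraic_subset S Z \<longleftrightarrow>
     (\<exists>F \<subseteq> poly_functions S. Z = {x \<in> S \<rightarrow>\<^sub>E UNIV. \<forall>f \<in> F. f x = 0}) \<and> Z \<noteq> (S \<rightarrow>\<^sub>E UNIV)"

end

theory Submission
  imports Defs "HOL-Library.Function_Algebras" "HOL-Homology.Invariance_of_Domain"
begin

text \<open>
  Identify the plane with the complex numbers. After moving the centre of \<open>\<Phi> r\<^sub>k\<close> to the origin, a
  realization is a vector \<open>x\<close> consisting of the points over the vertices of the colored graph and of
  the lattice vectors of \<open>\<Phi>\<close>. Every edge has a complex linear gap \<open>X\<^sub>e(x) = p\<^sub>i - \<Phi>(\<gamma>\<^sub>i\<^sub>j) p\<^sub>j\<close>; it is
  collapsed iff \<open>X\<^sub>e(x) = 0\<close>, and its direction imposes one real linear combination of the two real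
  functionals \<open>Re X\<^sub>e\<close> and \<open>Im X\<^sub>e\<close>. For a set \<open>F\<close> of edges, let \<open>f(F)\<close> be the rank of all these functionals.

  The common kernel of the gaps of \<open>F\<close> is parametrised by the representations that kill \<open>\<Lambda>(F)\<close> and by one
  free point per component without rotations, since a rotation pins its component to its centre; hence
  \<open>f(F) = h(F) + 1\<close>. By Rado's theorem, for generic directions the equations of \<open>F\<close> are independent iff
  \<open>|F'| \<le> f(F')\<close> for all \<open>F' \<subseteq> F\<close>.

  If the graph is colored-Laman, these inequalities even survive the addition of one arbitrary nonzero
  functional. The solution space is therefore a line modulo translations, and no gap and no
  translation vector vanishes on it. Conversely, a minimal nonempty \<open>F\<close> with \<open>|F| \<ge> f(F)\<close> contains \<open>f(F)\<close>
  generically independent equations, which span all functionals of \<open>F\<close>, so \<open>F\<close> collapses.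
\<close>

section \<open>Rank and independent transversals\<close>

text \<open>Existence of a faithful realization forces only the inequalities on sets of edges. The
  number of edges comes from uniqueness, since with too few edges a solution can be perturbed, or
  from an assumed lower bound; hence the equivalence has two forms. One exceptional set must serve
  all edge sets at once. Independence of a family of equations for some directions is certified by a
  polynomial, a product of elimination pivots. Only finitely many families occur, so the product of
  their certificates cuts out one proper algebraic set; for this reason the extra functionals come
  from a finite set. The other obstacle is \<open>rep\<close>, the topological dimension of a space
  of restrictions of discrete faithful representations. These are first classified on translations;
  they may turn the lattice either way, so for \<open>k\<close> at least 3 there can be two
  families. Continuous injections to and from Euclidean spaces then give the values 0, 2 and 4 by
  invariance of domain. The 1 that separates rank and count is the freedom of scaling.\<close>

context vector_space
begin

lemma dim_mono_finite:
  assumes "V \<subseteq> span W" "finite W"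
  shows "dim V \<le> dim W"
proof -
  obtain B where B: "B \<subseteq> W" "independent B" "W \<subseteq> span B" "card B = dim W"
    using basis_exists by blast
  have "V \<subseteq> span B"
    using assms(1) B(3) span_minimal[OF B(3) subspace_span] by blast
  then show ?thesis
    using B dim_le_card[of V B] finite_subset[OF B(1) assms(2)] by simp
qed

lemma card_independent_le_dim:
  assumes "B \<subseteq> span W" "independent B" "finite W"
  shows "card B \<le> dim W"
  using dim_mono_finite[OF assms(1,3)] dim_eq_card_independent[OF assms(2)] by simp

lemma independent_card_dim_spans:
  assumes "finite W" "B \<subseteq> span W" "independent B" "card B = dim W"
  shows "W \<subseteq> span B"
proof
  fix w assume w: "w \<in> W"
  have finB: "finite B"
    using independent_span_bound[OF assms(1,3,2)] by blast
  show "w \<in> span B"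
  proof (rule ccontr)
    assume nin: "w \<notin> span B"
    then have "independent (insert w B)" "w \<notin> B"
      using independent_insertI[OF nin assms(3)] span_base by auto
    moreover have "insert w B \<subseteq> span W" using assms(2) span_base[OF w] by simp
    ultimately have "card (insert w B) \<le> dim W"
      using card_independent_le_dim assms(1) by blast
    then show False using \<open>w \<notin> B\<close> finB assms(4) by simp
  qed
qed

text \<open>A basis of \<open>C\<close> is extended to one of \<open>A\<close> and then to one of
  \<open>A \<union> B\<close>; the vectors added last lie in \<open>B\<close> and stay independent
  together with the basis of \<open>C\<close>. An arbitrary common subset \<open>C\<close> replaces
  the intersection because the union over \<open>F1 \<inter> F2\<close> below may be smaller than
  the intersection of the two unions.\<close>

lemma dim_submodular:
  assumes "finite A" "finite B" "C \<subseteq> A" "C \<subseteq> B"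
  shows "dim (A \<union> B) + dim C \<le> dim A + dim B"
proof -
  obtain K where K: "K \<subseteq> C" "independent K" "C \<subseteq> span K"
    using maximal_independent_subset by blast
  obtain M where M: "K \<subseteq> M" "M \<subseteq> A" "independent M" "A \<subseteq> span M"
    using maximal_independent_subset_extend[of K A] K assms by blast
  obtain N where N: "M \<subseteq> N" "N \<subseteq> A \<union> B" "independent N" "A \<union> B \<subseteq> span N"
    using maximal_independent_subset_extend[of M "A \<union> B"] M by blast
  have fin: "finite N" "finite M" "finite K"
    using assms N M finite_subset by (blast dest: finite_subset)+
  have NA: "N - M \<subseteq> B"
  proof
    fix x assume x: "x \<in> N - M"
    have "x \<notin> A"
    proof
      assume "x \<in> A"
      then have "x \<in> span M" using M by blast
      then have "x \<in> span (N - {x})"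
        using x N(1) span_mono[of M "N - {x}"] by blast
      then show False
        using N(3) x dependent_def by blast
    qed
    then show "x \<in> B" using x N by blast
  qed
  have "independent (K \<union> (N - M))"
    using N(3) by (rule independent_mono) (use M N in blast)
  moreover have "K \<union> (N - M) \<subseteq> B"
    using NA K assms by blast
  ultimately have "card (K \<union> (N - M)) \<le> dim B"
    using card_independent_le_dim[of "K \<union> (N - M)" B] assms span_superset by blast
  moreover have "card (K \<union> (N - M)) = card K + (card N - card M)"
    using fin M N by (subst card_Un_disjoint) (auto simp: card_Diff_subset)
  moreover have "card M \<le> card N"
    using N(1) fin card_mono by blast
  moreover have "dim (A \<union> B) = card N" "dim A = card M" "dim C = card K"
    using N M K basis_card_eq_dim by metis+
  ultimately show ?thesis by linarith
qed

text \<open>Rado's theorem for the linear matroid. If some \<open>A e\<close> has two elements, one of them can be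
  dropped without violating the hypothesis: otherwise submodularity of \<open>dim\<close> is contradicted.\<close>

lemma independent_transversal:
  assumes "finite E" "\<And>e. e \<in> E \<Longrightarrow> finite (A e)"
    and "\<And>F. F \<subseteq> E \<Longrightarrow> card F \<le> dim (\<Union>e\<in>F. A e)"
  shows "\<exists>x. (\<forall>e\<in>E. x e \<in> A e) \<and> inj_on x E \<and> independent (x ` E)"
  using assms(2,3)
proof (induction "\<Sum>e\<in>E. card (A e)" arbitrary: A rule: less_induct)
  case less
  show ?case
  proof (cases "\<exists>e\<in>E. \<exists>a\<in>A e. \<exists>b\<in>A e. a \<noteq> b")
    case False
    have ne: "A e \<noteq> {}" if "e \<in> E" for e
    proof
      assume "A e = {}"
      then show False using less(3)[of "{e}"] that dim_le_card'[of "{}"] by simp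
    qed
    define x where "x e = (SOME a. a \<in> A e)" for e
    have x: "x e \<in> A e" if "e \<in> E" for e
      using ne[OF that] unfolding x_def by (simp add: some_in_eq)
    then have sing: "A e = {x e}" if "e \<in> E" for e
      using False that by auto
    then have "card E \<le> dim (x ` E)"
      using less(3)[of E] by (simp add: UNION_singleton_eq_range)
    moreover obtain B where B: "B \<subseteq> x ` E" "independent B" "x ` E \<subseteq> span B" "card B = dim (x ` E)"
      using basis_exists by blast
    moreover have "card B \<le> card (x ` E)" "card (x ` E) \<le> card E"
      using card_mono[OF _ B(1)] card_image_le[OF assms(1)] assms(1) by simp_all
    ultimately have "card (x ` E) = card E" "card B = card (x ` E)"
      by simp_all
    then have "inj_on x E" "B = x ` E"
      using eq_card_imp_inj_on[OF assms(1)] card_subset_eq[OF finite_imageI[OF assms(1)] B(1)]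
      by blast+
    then show ?thesis using x B by blast
  next
    case True
    then obtain e a b where e: "e \<in> E" "a \<in> A e" "b \<in> A e" "a \<noteq> b" by blast
    have step: ?thesis if c: "c \<in> A e"
      and *: "\<And>F. F \<subseteq> E \<Longrightarrow> card F \<le> dim (\<Union>i\<in>F. (A(e := A e - {c})) i)" for c
    proof -
      let ?A = "A(e := A e - {c})"
      have "(\<Sum>i\<in>E. card (?A i)) < (\<Sum>i\<in>E. card (A i))"
      proof (rule sum_strict_mono_ex1[OF assms(1)])
        show "\<forall>i\<in>E. card (?A i) \<le> card (A i)"
          using less(2) by (auto intro: card_mono)
        show "\<exists>i\<in>E. card (?A i) < card (A i)"
          using card_Diff1_less[OF less(2)[OF e(1)] c] e(1) by auto
      qed
      moreover have "finite (?A i)" if "i \<in> E" for i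
        using less(2)[OF that] by auto
      ultimately obtain x where x: "\<forall>i\<in>E. x i \<in> ?A i" "inj_on x E" "independent (x ` E)"
        using less(1)[of ?A, OF _ _ *] by blast
      have "x i \<in> A i" if "i \<in> E" for i
        using bspec[OF x(1) that] by (cases "i = e") auto
      then show ?thesis
        using x by blast
    qed
    \<comment> \<open>If dropping \<open>c\<close> fails, the violating set must contain
      \<open>e\<close>. Here \<open>F\<close> is that set without \<open>e\<close>, which turns the
      strict inequality into a weak one.\<close>
    have red: "\<exists>F. F \<subseteq> E - {e} \<and> dim ((\<Union>i\<in>F. A i) \<union> (A e - {c})) \<le> card F"
      if c: "c \<in> A e" and contr: "\<not> ?thesis" for c
    proof -
      obtain F where F: "F \<subseteq> E" "\<not> card F \<le> dim (\<Union>i\<in>F. (A(e := A e - {c})) i)"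
        using step[OF c] contr by blast
      have eF: "e \<in> F"
      proof (rule ccontr)
        assume "e \<notin> F"
        then have "(\<Union>i\<in>F. (A(e := A e - {c})) i) = (\<Union>i\<in>F. A i)" by auto
        then show False using F less(3) by metis
      qed
      have "(\<Union>i\<in>F. (A(e := A e - {c})) i) = (\<Union>i\<in>F - {e}. A i) \<union> (A e - {c})"
        using eF by (auto split: if_splits)
      moreover have "card F = Suc (card (F - {e}))"
        using eF F(1) assms(1) by (metis card.remove finite_subset)
      ultimately have "dim ((\<Union>i\<in>F - {e}. A i) \<union> (A e - {c})) \<le> card (F - {e})"
        using F(2) by simp
      then show ?thesis
        using F(1) by blast
    qed
    show ?thesis
    proof (rule ccontr)
      assume contr: "\<not> ?thesis"
      obtain F1 F2 where F1: "F1 \<subseteq> E - {e}" "dim ((\<Union>i\<in>F1. A i) \<union> (A e - {a})) \<le> card F1"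
        and F2: "F2 \<subseteq> E - {e}" "dim ((\<Union>i\<in>F2. A i) \<union> (A e - {b})) \<le> card F2"
        using red[OF e(2) contr] red[OF e(3) contr] by blast
      let ?P = "(\<Union>i\<in>F1. A i) \<union> (A e - {a})" and ?Q = "(\<Union>i\<in>F2. A i) \<union> (A e - {b})"
      have finF: "finite F1" "finite F2"
        using F1 F2 assms(1) by (auto dest: finite_subset)
      have fin: "finite ?P" "finite ?Q"
        using F1 F2 finF less(2) e(1) by auto
      have "dim (?P \<union> ?Q) + dim (\<Union>i\<in>F1 \<inter> F2. A i) \<le> card F1 + card F2"
        using dim_submodular[OF fin, of "\<Union>i\<in>F1 \<inter> F2. A i"] F1(2) F2(2) by fastforce
      \<comment> \<open>As \<open>a\<close> and \<open>b\<close> differ, the two reduced sets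
        together give back all of \<open>A e\<close>; the union thus gains the element
        \<open>e\<close>.\<close>
      moreover have "dim (?P \<union> ?Q) = dim (\<Union>i\<in>insert e (F1 \<union> F2). A i)"
        using e by (intro arg_cong[of _ _ dim]) auto
      moreover have "card (insert e (F1 \<union> F2)) \<le> dim (\<Union>i\<in>insert e (F1 \<union> F2). A i)"
        using F1 F2 e by (intro less(3)) auto
      moreover have "card (F1 \<inter> F2) \<le> dim (\<Union>i\<in>F1 \<inter> F2. A i)"
        using F1 by (intro less(3)) auto
      moreover have "card (insert e (F1 \<union> F2)) = Suc (card (F1 \<union> F2))"
        using F1 F2 finF by (subst card_insert_disjoint) auto
      moreover have "card (F1 \<union> F2) + card (F1 \<inter> F2) = card F1 + card F2"
        using finF by (metis card_Un_Int)
      ultimately show False by linarith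
    qed
  qed
qed

end


section \<open>Linear functionals on a coordinate space\<close>

no_notation set_add (infixl \<open><+>\<index>\<close> 60)

text \<open>Vectors are arbitrary real functions on a type; the linear forms that matter are singled
  out later as \<open>fn.span (coords I)\<close>.\<close>

interpretation fn: vector_space "\<lambda>(c::real) (f :: 'w \<Rightarrow> real) x. c * f x"
  by unfold_locales (auto simp: fun_eq_iff algebra_simps)

lemma sum_fun_apply: "(\<Sum>s\<in>S. f s) x = (\<Sum>s\<in>S. f s (x :: 'w) :: real)"
  by (induction S rule: infinite_finite_induct) auto

text \<open>A notion for indexed families: two edges with the same functional count as dependent,
  which the image set would not detect.\<close>

definition indep_fam :: "'s set \<Rightarrow> ('s \<Rightarrow> 'w \<Rightarrow> real) \<Rightarrow> bool" where
  "indep_fam S u \<longleftrightarrow> (\<forall>c. (\<forall>x. (\<Sum>s\<in>S. c s * u s x) = 0) \<longrightarrow> (\<forall>s\<in>S. c s = 0))"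

lemma indep_fam_iff:
  assumes "finite S"
  shows "indep_fam S u \<longleftrightarrow> inj_on u S \<and> fn.independent (u ` S)"
proof
  assume L: "indep_fam S u"
  have inj: "inj_on u S"
  proof (rule inj_onI, rule ccontr)
    fix s t assume st: "s \<in> S" "t \<in> S" "u s = u t" "s \<noteq> t"
    have "(\<Sum>r\<in>S. (if r = s then 1 else if r = t then -1 else 0) * u r x) = 0" for x
    proof -
      have "(\<Sum>r\<in>S. (if r = s then 1 else if r = t then -1 else 0) * u r x)
          = (\<Sum>r\<in>S. (if r = s then u r x else 0) - (if r = t then u r x else 0))"
        using st by (intro sum.cong) auto
      also have "\<dots> = 0"
        using assms st by (simp add: sum_subtractf)
      finally show ?thesis .
    qed
    then show False
      using L st(1) unfolding indep_fam_def
      by (auto dest!: spec[of _ "\<lambda>r. if r = s then 1 else if r = t then -1 else 0"] bspec[of S _ s])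
  qed
  moreover have "fn.independent (u ` S)"
  proof (rule fn.independent_if_scalars_zero)
    fix f v assume f: "(\<Sum>v\<in>u ` S. (\<lambda>x. f v * v x)) = 0" and v: "v \<in> u ` S"
    have "(\<Sum>s\<in>S. f (u s) * u s x) = 0" for x
      using fun_cong[OF f, of x] inj by (simp add: sum_fun_apply sum.reindex)
    then show "f v = 0"
      using L v unfolding indep_fam_def by (auto dest!: spec[of _ "\<lambda>s. f (u s)"])
  qed (use assms in simp)
  ultimately show "inj_on u S \<and> fn.independent (u ` S)" by blast
next
  assume R: "inj_on u S \<and> fn.independent (u ` S)"
  show "indep_fam S u"
    unfolding indep_fam_def
  proof (intro allI impI ballI)
    fix c s assume c: "\<forall>x. (\<Sum>s\<in>S. c s * u s x) = 0" and s: "s \<in> S"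
    let ?f = "\<lambda>v. c (the_inv_into S u v)"
    have "(\<Sum>v\<in>u ` S. (\<lambda>x. ?f v * v x)) = 0"
      using c R by (auto simp: fun_eq_iff sum_fun_apply sum.reindex the_inv_into_f_f)
    then have "?f (u s) = 0"
      using R s assms fn.independentD[of "u ` S" "u ` S" ?f "u s"] by simp
    then show "c s = 0"
      using R s by (simp add: the_inv_into_f_f)
  qed
qed

text \<open>Evaluating a relation at the vector dual to \<open>q\<close>, where all
  \<open>r s\<close> vanish, isolates the coefficient of \<open>q\<close>. This is how pinned
  coordinates and kernel coordinates are adjoined to an independent family.\<close>

lemma indep_fam_coords:
  assumes fin: "finite S" "finite Q" and ind: "indep_fam S r"
    and dual: "\<And>q. q \<in> Q \<Longrightarrow> \<exists>x. (\<forall>s\<in>S. r s x = 0) \<and> x q = 1 \<and> (\<forall>p\<in>Q. p \<noteq> q \<longrightarrow> x p = 0)"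
  shows "indep_fam (S <+> Q) (case_sum r (\<lambda>q x. x q))"
  unfolding indep_fam_def
proof (intro allI impI)
  fix c assume "\<forall>x. (\<Sum>s\<in>S <+> Q. c s * case_sum r (\<lambda>q x. x q) s x) = 0"
  then have c: "(\<Sum>s\<in>S. c (Inl s) * r s x) + (\<Sum>q\<in>Q. c (Inr q) * x q) = 0" for x
    using fin by (simp add: sum.Plus)
  have cQ: "c (Inr q) = 0" if q: "q \<in> Q" for q
  proof -
    obtain x where x: "\<forall>s\<in>S. r s x = 0" "x q = 1" "\<forall>p\<in>Q. p \<noteq> q \<longrightarrow> x p = 0"
      using dual[OF q] by blast
    have "(\<Sum>s\<in>S. c (Inl s) * r s x) = 0"
      using x(1) by (intro sum.neutral) simp
    then have "0 = (\<Sum>p\<in>Q. c (Inr p) * x p)" using c[of x] by simp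
    also have "\<dots> = (\<Sum>p\<in>Q. if p = q then c (Inr p) else 0)"
      using x(2,3) by (intro sum.cong) auto
    finally show ?thesis using q fin by simp
  qed
  then have "(\<Sum>s\<in>S. c (Inl s) * r s x) = 0" for x
    using c[of x] by simp
  then have "\<forall>s\<in>S. c (Inl s) = 0"
    using ind unfolding indep_fam_def by (auto dest!: spec[of _ "\<lambda>s. c (Inl s)"])
  then show "\<forall>s\<in>S <+> Q. c s = 0" using cQ by auto
qed

section \<open>Linear forms in finitely many real coordinates\<close>

definition coords :: "'i set \<Rightarrow> (('i \<Rightarrow> real) \<Rightarrow> real) set" where
  "coords I = (\<lambda>i x. x i) ` I"

lemma coord_in_span: "i \<in> I \<Longrightarrow> (\<lambda>x. x i) \<in> fn.span (coords I)"
  by (rule fn.span_base) (simp add: coords_def)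

lemma inj_coord: "inj_on (\<lambda>i (x :: 'i \<Rightarrow> real). x i) I"
proof (rule inj_onI)
  fix i j assume "(\<lambda>x :: 'i \<Rightarrow> real. x i) = (\<lambda>x. x j)"
  from fun_cong[OF this, of "\<lambda>l. if l = i then 1 else 0"] show "i = j"
    by (simp split: if_splits)
qed

lemma card_coords: "card (coords I) = card I"
  unfolding coords_def by (rule card_image[OF inj_coord])

lemma independent_coords:
  assumes "finite I"
  shows "fn.independent (coords I)"
proof -
  have "indep_fam I (\<lambda>i (x :: 'a \<Rightarrow> real). x i)"
    unfolding indep_fam_def
  proof (intro allI impI ballI)
    fix c i assume c: "\<forall>x :: 'a \<Rightarrow> real. (\<Sum>s\<in>I. c s * x s) = 0" and i: "i \<in> I"
    have "(\<Sum>s\<in>I. c s * (if s = i then 1 else 0)) = 0"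
      using c by (rule allE[of _ "\<lambda>s. if s = i then 1 else 0"])
    then show "c i = 0"
      using assms i by (simp add: if_distrib sum.delta cong: if_cong)
  qed
  then show ?thesis
    using indep_fam_iff[OF assms] unfolding coords_def by blast
qed

lemma dim_coords: "finite I \<Longrightarrow> fn.dim (coords I) = card I"
  using independent_coords fn.dim_eq_card_independent card_coords by metis

lemma span_coords_linear:
  assumes "f \<in> fn.span (coords I)"
  shows "f (\<lambda>i. a * x i + b * y i) = a * f x + b * f y"
  using assms
proof (induction rule: fn.span_induct_alt)
  case base
  show ?case by simp
next
  case (step c g h)
  then show ?case by (auto simp: coords_def algebra_simps)
qed

lemma span_coords_sum:
  assumes "f \<in> fn.span (coords I)" "finite J"
  shows "f (\<lambda>i. \<Sum>j\<in>J. a j * y j i) = (\<Sum>j\<in>J. a j * f (y j))"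
  using assms(2)
proof (induction J rule: finite_induct)
  case empty
  show ?case using span_coords_linear[OF assms(1), of 0 "\<lambda>_. 0" 0 "\<lambda>_. 0"] by simp
next
  case (insert j J)
  then show ?case
    using span_coords_linear[OF assms(1), of "a j" "y j" 1 "\<lambda>i. \<Sum>j\<in>J. a j * y j i"] by simp
qed

lemma span_vanish:
  assumes "f \<in> fn.span S" "\<forall>s\<in>S. s x = 0"
  shows "f x = 0"
  using assms(1)
proof (induction rule: fn.span_induct_alt)
  case (step c g h)
  then show ?case using assms(2) by simp
qed simp

text \<open>The values of all forms at the unit vectors are \<open>card I\<close> columns in a space
  of dimension at most \<open>card S\<close>; the coefficients of a dependency among the columns
  form the solution.\<close>

lemma homogeneous_system:
  fixes I :: "'i set"
  assumes "finite I" "finite S" "S \<subseteq> fn.span (coords I)" "card S < card I"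
  shows "\<exists>x. (\<exists>i\<in>I. x i \<noteq> 0) \<and> (\<forall>i. i \<notin> I \<longrightarrow> x i = 0) \<and> (\<forall>s\<in>S. s x = 0)"
proof -
  let ?e = "\<lambda>i l. if l = i then 1 else (0::real)"
  \<comment> \<open>Column \<open>i\<close>; the value 0 outside \<open>S\<close> places it in the
    span of the indicator functions \<open>?T\<close>.\<close>
  let ?u = "\<lambda>i (s :: ('i \<Rightarrow> real) \<Rightarrow> real). if s \<in> S then s (?e i) else 0"
  let ?T = "(\<lambda>s t. if t = s then 1 else (0::real)) ` S"
  have "\<not> indep_fam I ?u"
  proof
    assume "indep_fam I ?u"
    then have *: "inj_on ?u I" "fn.independent (?u ` I)"
      using indep_fam_iff[OF assms(1)] by auto
    have "?u ` I \<subseteq> fn.span ?T"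
    proof clarify
      fix i
      have "?u i = (\<Sum>s\<in>S. (\<lambda>t. s (?e i) * (if t = s then 1 else 0)))"
      proof (rule ext)
        fix t
        show "?u i t = (\<Sum>s\<in>S. (\<lambda>t. s (?e i) * (if t = s then 1 else 0))) t"
          using assms(2) by (simp add: sum_fun_apply if_distrib sum.delta cong: if_cong)
      qed
      also have "\<dots> \<in> fn.span ?T"
        by (intro fn.span_sum fn.span_scale fn.span_base) auto
      finally show "?u i \<in> fn.span ?T" .
    qed
    then have "card (?u ` I) \<le> card ?T"
      using fn.independent_span_bound[OF _ *(2), of ?T] assms(2) by simp
    then show False
      using * assms(2,4) card_image[OF *(1)] card_image_le[OF assms(2), of "\<lambda>s t. if t = s then 1 else (0::real)"]
      by linarith
  qed
  then obtain c i where c: "\<And>s. (\<Sum>i\<in>I. c i * ?u i s) = 0" and i: "i \<in> I" "c i \<noteq> 0"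
    unfolding indep_fam_def by blast
  define x where "x l = (\<Sum>i\<in>I. c i * ?e i l)" for l
  have xl: "x l = (if l \<in> I then c l else 0)" for l
    using assms(1) by (simp add: x_def if_distrib sum.delta cong: if_cong)
  have "s x = 0" if "s \<in> S" for s
  proof -
    have "s x = (\<Sum>i\<in>I. c i * s (?e i))"
      unfolding x_def using span_coords_sum[of s I I c ?e] assms that by blast
    also have "\<dots> = 0" using c[of s] that by simp
    finally show ?thesis .
  qed
  then show ?thesis
    using xl i by (intro exI[of _ x]) auto
qed

text \<open>A basis of \<open>S\<close> with fewer than \<open>card I\<close> forms would have a
  common zero that is nonzero on \<open>I\<close>, and this zero would kill all of
  \<open>S\<close>.\<close>

lemma dim_ge_trivial_kernel:
  assumes "finite I" "finite S" "S \<subseteq> fn.span (coords I)"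
    and "\<And>x. \<forall>s\<in>S. s x = 0 \<Longrightarrow> \<forall>i\<in>I. x i = 0"
  shows "card I \<le> fn.dim S"
proof (rule ccontr)
  assume "\<not> card I \<le> fn.dim S"
  moreover obtain B where B: "B \<subseteq> S" "fn.independent B" "S \<subseteq> fn.span B" "card B = fn.dim S"
    using fn.basis_exists by blast
  ultimately have "card B < card I" "B \<subseteq> fn.span (coords I)"
    using assms(3) by auto
  then obtain x i where x: "i \<in> I" "x i \<noteq> 0" "\<forall>s\<in>B. s x = 0"
    using homogeneous_system[OF assms(1) finite_subset[OF B(1) assms(2)]] by blast
  then have "\<forall>s\<in>S. s x = 0"
    using span_vanish[OF subsetD[OF B(3)] x(3)] by simp
  from assms(4)[OF this] show False using x by simp
qed

lemma dim_le_coords: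
  assumes "finite I" "S \<subseteq> fn.span (coords I)"
  shows "fn.dim S \<le> card I"
  using fn.dim_le_card[OF assms(2)] assms(1) card_coords[of I] by (simp add: coords_def)

text \<open>The hypotheses say that \<open>Q\<close> indexes coordinates on the common kernel of \<open>S\<close>.\<close>

lemma dim_plus_kernel:
  assumes "finite I" "finite S" "S \<subseteq> fn.span (coords I)" "Q \<subseteq> I"
    and ker: "\<And>x. \<forall>s\<in>S. s x = 0 \<Longrightarrow> \<forall>q\<in>Q. x q = 0 \<Longrightarrow> \<forall>i\<in>I. x i = 0"
    and surj: "\<And>y. \<exists>x. (\<forall>s\<in>S. s x = 0) \<and> (\<forall>q\<in>Q. x q = y q)"
  shows "fn.dim S + card Q = card I"
proof (rule antisym)
  have finQ: "finite Q" using assms finite_subset by blast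
  \<comment> \<open>First inequality: after adjoining the coordinates \<open>Q\<close> only the zero
    solution is left.\<close>
  have "card I \<le> fn.dim (S \<union> coords Q)"
  proof (rule dim_ge_trivial_kernel)
    show "finite (S \<union> coords Q)" using assms finQ by (simp add: coords_def)
    show "S \<union> coords Q \<subseteq> fn.span (coords I)"
      using assms(3,4) coord_in_span[of _ I] unfolding coords_def[of Q] by blast
    show "\<forall>i\<in>I. x i = 0" if "\<forall>s\<in>S \<union> coords Q. s x = 0" for x
      using that by (intro ker) (auto simp: coords_def)
  qed fact
  moreover have "fn.dim (S \<union> coords Q) \<le> fn.dim S + fn.dim (coords Q)"
    using fn.dim_submodular[of S "coords Q" "{}"] assms(2) finQ by (simp add: coords_def)
  ultimately show "card I \<le> fn.dim S + card Q"
    using dim_coords[OF finQ] by linarith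
  \<comment> \<open>Second inequality: a basis of \<open>S\<close> stays independent together with
    the coordinates \<open>Q\<close>, because \<open>surj\<close> supplies vectors in the common
    kernel that are dual to \<open>Q\<close>.\<close>
  obtain B where B: "B \<subseteq> S" "fn.independent B" "S \<subseteq> fn.span B" "card B = fn.dim S"
    using fn.basis_exists by blast
  have finB: "finite B" using B assms finite_subset by blast
  let ?u = "case_sum (\<lambda>b. b) (\<lambda>q x. x q)"
  have "indep_fam B (\<lambda>b. b)"
    using indep_fam_iff[OF finB, of "\<lambda>b. b"] B(2) by (simp add: inj_on_def)
  then have "indep_fam (B <+> Q) ?u"
  proof (rule indep_fam_coords[OF finB finQ])
    fix q assume "q \<in> Q"
    obtain x where "\<forall>s\<in>S. s x = 0" "\<forall>p\<in>Q. x p = (if p = q then 1 else 0)"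
      using surj[of "\<lambda>p. if p = q then 1 else 0"] by blast
    then show "\<exists>x. (\<forall>s\<in>B. s x = 0) \<and> x q = 1 \<and> (\<forall>p\<in>Q. p \<noteq> q \<longrightarrow> x p = 0)"
      using B(1) \<open>q \<in> Q\<close> by (intro exI[of _ x]) auto
  qed
  then have ind: "inj_on ?u (B <+> Q)" "fn.independent (?u ` (B <+> Q))"
    using indep_fam_iff[of "B <+> Q" ?u] finB finQ by auto
  have "?u ` (B <+> Q) \<subseteq> fn.span (coords I)"
    using B(1) assms(3,4) coord_in_span[of _ I] by auto
  then have "fn.dim (?u ` (B <+> Q)) \<le> card I"
    using assms(1) dim_le_coords by blast
  then have "card (B <+> Q) \<le> card I"
    using ind fn.dim_eq_card_independent[OF ind(2)] card_image[OF ind(1)] by simp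
  then show "fn.dim S + card Q \<le> card I"
    using B(4) card_Plus[OF finB finQ] by simp
qed

section \<open>Genericity\<close>

lemma poly_functions_prod:
  assumes "finite C" "\<And>c. c \<in> C \<Longrightarrow> P c \<in> poly_functions E"
  shows "(\<lambda>x. \<Prod>c\<in>C. P c x) \<in> poly_functions E"
  using assms
  by (induction C rule: finite_induct) (auto intro: poly_functions.const poly_functions.mult)

lemma poly_functions_cong:
  assumes "P \<in> poly_functions E" "\<And>e. e \<in> E \<Longrightarrow> x e = y e"
  shows "P x = P y"
  using assms by induction auto

lemma poly_functions_diff:
  assumes "f \<in> poly_functions E" "g \<in> poly_functions E"
  shows "(\<lambda>x. f x - g x) \<in> poly_functions E"
proof -
  have "(\<lambda>x. f x + (- 1) * g x) \<in> poly_functions E"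
    by (intro poly_functions.add poly_functions.mult poly_functions.const assms)
  then show ?thesis by simp
qed

lemma poly_functions_line:
  assumes "P \<in> poly_functions E"
  shows "\<exists>q :: real poly. \<forall>t. P (\<lambda>e. a e + t *\<^sub>R b e) = poly q t"
  using assms
proof induction
  case (const c)
  show ?case by (intro exI[of _ "[:c:]"]) simp
next
  case (coord e i)
  show ?case by (intro exI[of _ "[:a e $ i, b e $ i:]"]) simp
next
  case (add f g)
  then obtain p q where "\<forall>t. f (\<lambda>e. a e + t *\<^sub>R b e) = poly p t" "\<forall>t. g (\<lambda>e. a e + t *\<^sub>R b e) = poly q t"
    by blast
  then show ?case by (intro exI[of _ "p + q"]) simp
next
  case (mult f g)
  then obtain p q where "\<forall>t. f (\<lambda>e. a e + t *\<^sub>R b e) = poly p t" "\<forall>t. g (\<lambda>e. a e + t *\<^sub>R b e) = poly q t"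
    by blast
  then show ?case by (intro exI[of _ "p * q"]) simp
qed

text \<open>On the line from \<open>x\<close> to \<open>y\<close> both factors become nonzero
  polynomials in one variable. So does their product, which cannot vanish at every real
  parameter.\<close>

lemma poly_functions_mult_nonzero:
  assumes "P \<in> poly_functions E" "Q \<in> poly_functions E" "P x \<noteq> 0" "Q y \<noteq> 0"
  shows "\<exists>z. P z * Q z \<noteq> 0"
proof -
  obtain p q where p: "\<And>t. P (\<lambda>e. x e + t *\<^sub>R (y e - x e)) = poly p t"
    and q: "\<And>t. Q (\<lambda>e. x e + t *\<^sub>R (y e - x e)) = poly q t"
    using poly_functions_line[OF assms(1), of x "\<lambda>e. y e - x e"]
      poly_functions_line[OF assms(2), of x "\<lambda>e. y e - x e"] by blast
  have "poly p 0 \<noteq> 0" "poly q 1 \<noteq> 0"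
    using p[of 0] q[of 1] assms(3,4) by auto
  then have "p * q \<noteq> 0" by auto
  then obtain t where "poly (p * q) t \<noteq> 0"
    using poly_all_0_iff_0 by blast
  then show ?thesis using p[of t] q[of t] by (metis poly_mult)
qed

text \<open>The zero set of the product of all \<open>P c\<close> serves as
  \<open>Z\<close>.\<close>

lemma generic_nonzero:
  assumes "finite C" "\<And>c. c \<in> C \<Longrightarrow> P c \<in> poly_functions E" "\<And>c. c \<in> C \<Longrightarrow> \<exists>x. P c x \<noteq> 0"
  shows "\<exists>Z. proper_algebraic_subset E Z \<and>
    (\<forall>x \<in> E \<rightarrow>\<^sub>E UNIV. x \<notin> Z \<longrightarrow> (\<forall>c\<in>C. P c x \<noteq> 0))"
proof -
  let ?Q = "\<lambda>x. \<Prod>c\<in>C. P c x"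
  have "\<exists>x. ?Q x \<noteq> 0"
    using assms
  proof (induction C rule: finite_induct)
    case (insert c C)
    obtain x y where "P c x \<noteq> 0" "(\<Prod>c\<in>C. P c y) \<noteq> 0"
      using insert by blast
    then have "\<exists>z. P c z * (\<Prod>c\<in>C. P c z) \<noteq> 0"
      using insert(4) by (intro poly_functions_mult_nonzero[of "P c" E "\<lambda>x. \<Prod>c\<in>C. P c x" x y]
          poly_functions_prod[OF insert(1)]) auto
    then show ?case using insert(1,2) by simp
  qed simp
  then obtain x where x: "?Q x \<noteq> 0" by blast
  have Q: "?Q \<in> poly_functions E"
    by (rule poly_functions_prod[OF assms(1,2)])
  let ?Z = "{x \<in> E \<rightarrow>\<^sub>E UNIV. \<forall>f \<in> {?Q}. f x = 0}"
  \<comment> \<open>A polynomial function reads its argument only on \<open>E\<close>, so the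
    witness may be cut down to an extensional function, as membership in the ambient space
    demands.\<close>
  have "?Q (restrict x E) = ?Q x"
    by (rule poly_functions_cong[OF Q]) simp
  then have "restrict x E \<notin> ?Z" "restrict x E \<in> E \<rightarrow>\<^sub>E UNIV"
    using x by auto
  then have "proper_algebraic_subset E ?Z"
    unfolding proper_algebraic_subset_def using Q by (intro conjI exI[of _ "{?Q}"]) auto
  moreover have "\<forall>x \<in> E \<rightarrow>\<^sub>E UNIV. x \<notin> ?Z \<longrightarrow> (\<forall>c\<in>C. P c x \<noteq> 0)"
    using assms(1) by auto
  ultimately show ?thesis by blast
qed

text \<open>Gaussian elimination without divisions, so that the pivots stay polynomial.\<close>

lemma generic_indep_fam:
  assumes "finite S" "\<And>s x. s \<in> S \<Longrightarrow> (\<lambda>d. u s d x) \<in> poly_functions E"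
    and "indep_fam S (\<lambda>s. u s d0)"
  shows "\<exists>P \<in> poly_functions E. P d0 \<noteq> 0 \<and> (\<forall>d. P d \<noteq> 0 \<longrightarrow> indep_fam S (\<lambda>s. u s d))"
  using assms
proof (induction S arbitrary: u rule: finite_induct)
  case empty
  show ?case
    by (intro bexI[of _ "\<lambda>_. 1"]) (auto simp: indep_fam_def intro: poly_functions.const)
next
  case (insert s S)
  have sum_ins: "(\<Sum>t\<in>insert s S. c t * u t d x) = c s * u s d x + (\<Sum>t\<in>S. c t * u t d x)" for c d x
    using insert(1,2) by simp
  have "\<exists>x0. u s d0 x0 \<noteq> 0"
  proof (rule ccontr)
    assume "\<nexists>x0. u s d0 x0 \<noteq> 0"
    then have "(\<Sum>t\<in>insert s S. (if t = s then 1 else 0) * u t d0 x) = 0" for x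
      by (intro sum.neutral) auto
    then have "\<forall>t\<in>insert s S. (if t = s then 1 else (0::real)) = 0"
      using insert(5) unfolding indep_fam_def by (auto dest!: spec[of _ "\<lambda>t. if t = s then 1 else 0"])
    then show False by auto
  qed
  then obtain x0 where x0: "u s d0 x0 \<noteq> 0" by blast
  \<comment> \<open>Elimination of \<open>u s\<close> by means of its value at \<open>x0\<close>:
    every \<open>w t d\<close> vanishes at \<open>x0\<close>.\<close>
  define w where "w t d x = u s d x0 * u t d x - u t d x0 * u s d x" for t d x
  have w_sum: "(\<Sum>t\<in>S. c t * w t d x)
      = u s d x0 * (\<Sum>t\<in>S. c t * u t d x) - u s d x * (\<Sum>t\<in>S. c t * u t d x0)" for c d x
    unfolding w_def sum_distrib_left sum_subtractf[symmetric]
    by (rule sum.cong) (auto simp: algebra_simps)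
  have "indep_fam S (\<lambda>t. w t d0)"
    unfolding indep_fam_def
  proof (intro allI impI)
    fix c assume c: "\<forall>x. (\<Sum>t\<in>S. c t * w t d0 x) = 0"
    \<comment> \<open>A relation among the \<open>w t\<close> is one among the \<open>u t\<close>
      with coefficients scaled by the pivot; the coefficient of \<open>u s\<close> is read off from
      \<open>w_sum\<close>.\<close>
    let ?c = "\<lambda>t. if t = s then - (\<Sum>t\<in>S. c t * u t d0 x0) else c t * u s d0 x0"
    have "(\<Sum>t\<in>insert s S. ?c t * u t d0 x) = 0" for x
    proof -
      have *: "(\<Sum>t\<in>S. ?c t * u t d0 x) = u s d0 x0 * (\<Sum>t\<in>S. c t * u t d0 x)"
        unfolding sum_distrib_left using insert(2) by (intro sum.cong) auto
      have "(\<Sum>t\<in>insert s S. ?c t * u t d0 x) = (\<Sum>t\<in>S. c t * w t d0 x)"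
        unfolding sum_ins w_sum * by simp
      then show ?thesis using c by simp
    qed
    then have "\<forall>t\<in>insert s S. ?c t = 0"
      using insert(5) unfolding indep_fam_def by (auto dest!: spec[of _ ?c])
    then show "\<forall>t\<in>S. c t = 0"
      using insert(2) x0 by (auto split: if_splits)
  qed
  moreover have "(\<lambda>d. w t d x) \<in> poly_functions E" if "t \<in> S" for t x
    unfolding w_def using insert(4) that
    by (intro poly_functions_diff poly_functions.mult) auto
  ultimately obtain P where P: "P \<in> poly_functions E" "P d0 \<noteq> 0"
    and Pw: "\<And>d. P d \<noteq> 0 \<Longrightarrow> indep_fam S (\<lambda>t. w t d)"
    using insert(3)[of w] by blast
  show ?case
  proof (intro bexI[of _ "\<lambda>d. u s d x0 * P d"] conjI allI impI)
    show "u s d0 x0 * P d0 \<noteq> 0" using x0 P by simp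
    show "(\<lambda>d. u s d x0 * P d) \<in> poly_functions E"
      using insert(4) P by (intro poly_functions.mult) auto
    fix d assume d: "u s d x0 * P d \<noteq> 0"
    show "indep_fam (insert s S) (\<lambda>t. u t d)"
      unfolding indep_fam_def
    proof (intro allI impI)
      fix c assume "\<forall>x. (\<Sum>t\<in>insert s S. c t * u t d x) = 0"
      then have c: "(\<Sum>t\<in>S. c t * u t d x) = - c s * u s d x" for x
        unfolding sum_ins by (simp add: add_eq_0_iff)
      then have "\<forall>x. (\<Sum>t\<in>S. c t * w t d x) = 0"
        unfolding w_sum by simp
      then have cS: "\<forall>t\<in>S. c t = 0"
        using Pw[of d] d unfolding indep_fam_def by (auto dest!: spec[of _ c])
      then have "c s * u s d x0 = 0"
        using c[of x0] by simp
      then show "\<forall>t\<in>insert s S. c t = 0"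
        using cS d by auto
    qed
  qed
qed

section \<open>Rows of the direction equations\<close>

definition edge_row :: "('b \<Rightarrow> 'w \<Rightarrow> real) \<Rightarrow> ('b \<Rightarrow> 'w \<Rightarrow> real) \<Rightarrow> ('b \<Rightarrow> real^2) \<Rightarrow> 'b \<Rightarrow> 'w \<Rightarrow> real" where
  "edge_row u1 u2 d e = (\<lambda>x. d e $ 1 * u1 e x + d e $ 2 * u2 e x)"

text \<open>The left summand carries the equations, which vary with the directions; the right one
  carries fixed functionals, each indexed by itself.\<close>

definition row_family ::
  "('b \<Rightarrow> 'w \<Rightarrow> real) \<Rightarrow> ('b \<Rightarrow> 'w \<Rightarrow> real) \<Rightarrow> ('b \<Rightarrow> real^2) \<Rightarrow> 'b + ('w \<Rightarrow> real) \<Rightarrow> 'w \<Rightarrow> real" where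
  "row_family u1 u2 d = case_sum (edge_row u1 u2 d) (\<lambda>y. y)"

text \<open>Every pair \<open>(F, Y)\<close> that is independent for some directions contributes a
  polynomial certificate. There are finitely many pairs, so one \<open>Z\<close> serves all of
  them.\<close>

lemma generic_rows:
  assumes "finite E" "finite X"
  shows "\<exists>Z. proper_algebraic_subset E Z \<and> (\<forall>d \<in> E \<rightarrow>\<^sub>E UNIV. d \<notin> Z \<longrightarrow>
    (\<forall>F Y. F \<subseteq> E \<longrightarrow> Y \<subseteq> X \<longrightarrow> (\<exists>d0. indep_fam (F <+> Y) (row_family u1 u2 d0)) \<longrightarrow>
       indep_fam (F <+> Y) (row_family u1 u2 d)))"
proof -
  let ?C = "{(F, Y). F \<subseteq> E \<and> Y \<subseteq> X \<and> (\<exists>d0. indep_fam (F <+> Y) (row_family u1 u2 d0))}"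
  have fin: "finite ?C"
    using assms by (intro finite_subset[of ?C "Pow E \<times> Pow X"]) auto
  have "\<exists>P \<in> poly_functions E. (\<exists>d0. P d0 \<noteq> 0) \<and>
      (\<forall>d. P d \<noteq> 0 \<longrightarrow> indep_fam (fst c <+> snd c) (row_family u1 u2 d))" if c: "c \<in> ?C" for c
  proof -
    obtain d0 where d0: "indep_fam (fst c <+> snd c) (\<lambda>s. row_family u1 u2 d0 s)"
      using c by auto
    have fc: "finite (fst c <+> snd c)"
      using c assms finite_subset[of "fst c" E] finite_subset[of "snd c" X] by auto
    have poly: "(\<lambda>d. row_family u1 u2 d s x) \<in> poly_functions E" if "s \<in> fst c <+> snd c" for s x
    proof (cases s)
      case (Inl e)
      then have "e \<in> E" using that c by auto
      then show ?thesis
        unfolding Inl row_family_def edge_row_def sum.case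
        by (intro poly_functions.add poly_functions.mult poly_functions.coord poly_functions.const)
    next
      case (Inr y)
      then show ?thesis by (simp add: row_family_def poly_functions.const)
    qed
    show ?thesis
      using generic_indep_fam[OF fc poly d0] by blast
  qed
  then have "\<forall>c\<in>?C. \<exists>P. P \<in> poly_functions E \<and> (\<exists>d0. P d0 \<noteq> 0) \<and>
      (\<forall>d. P d \<noteq> 0 \<longrightarrow> indep_fam (fst c <+> snd c) (row_family u1 u2 d))"
    unfolding Bex_def by simp
  from bchoice[OF this] obtain P where P: "\<forall>c\<in>?C. P c \<in> poly_functions E \<and> (\<exists>d0. P c d0 \<noteq> 0) \<and>
      (\<forall>d. P c d \<noteq> 0 \<longrightarrow> indep_fam (fst c <+> snd c) (row_family u1 u2 d))"
    by blast
  obtain Z where Z: "proper_algebraic_subset E Z"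
    "\<forall>d \<in> E \<rightarrow>\<^sub>E UNIV. d \<notin> Z \<longrightarrow> (\<forall>c\<in>?C. P c d \<noteq> 0)"
    using generic_nonzero[OF fin, of P E] P by blast
  show ?thesis
  proof (intro exI[of _ Z] conjI ballI allI impI)
    fix d F Y assume d: "d \<in> E \<rightarrow>\<^sub>E UNIV" "d \<notin> Z"
      and "F \<subseteq> E" "Y \<subseteq> X" "\<exists>d0. indep_fam (F <+> Y) (row_family u1 u2 d0)"
    then have FY: "(F, Y) \<in> ?C" by simp
    then have "P (F, Y) d \<noteq> 0" using Z(2) d by blast
    then show "indep_fam (F <+> Y) (row_family u1 u2 d)"
      using bspec[OF P FY] by simp
  qed (rule Z(1))
qed

text \<open>For a direction along a coordinate axis the row of \<open>e\<close> is
  \<open>u1 e\<close> or \<open>u2 e\<close>, so an independent transversal of these pairs is itself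
  a choice of directions. Further functionals, one from each \<open>A t\<close>, are chosen in the
  same transversal.\<close>

lemma row_transversal:
  fixes u1 u2 :: "'b \<Rightarrow> 'w \<Rightarrow> real"
  assumes "finite F" "finite T" "\<And>t. t \<in> T \<Longrightarrow> finite (A t)"
    and dim: "\<And>F' T'. F' \<subseteq> F \<Longrightarrow> T' \<subseteq> T \<Longrightarrow>
       card F' + card T' \<le> fn.dim ((\<Union>e\<in>F'. {u1 e, u2 e}) \<union> (\<Union>t\<in>T'. A t))"
  shows "\<exists>y d0. (\<forall>t\<in>T. y t \<in> A t) \<and> indep_fam (F <+> y ` T) (row_family u1 u2 d0)"
proof -
  let ?B = "case_sum (\<lambda>e. {u1 e, u2 e}) A"
  have "card S \<le> fn.dim (\<Union>s\<in>S. ?B s)" if S: "S \<subseteq> F <+> T" for S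
  proof -
    have eq: "S = Inl -` S <+> Inr -` S"
      by (auto simp: Plus_def image_iff) (metis sum.exhaust)
    have fin: "finite (Inl -` S)" "finite (Inr -` S)"
      using S assms(1,2) by (auto intro: finite_subset[of _ F] finite_subset[of _ T])
    have "card S = card (Inl -` S) + card (Inr -` S)"
      using card_Plus[OF fin] eq by metis
    also have "\<dots> \<le> fn.dim ((\<Union>e\<in>Inl -` S. {u1 e, u2 e}) \<union> (\<Union>t\<in>Inr -` S. A t))"
      using S by (intro dim) auto
    also have "(\<Union>e\<in>Inl -` S. {u1 e, u2 e}) \<union> (\<Union>t\<in>Inr -` S. A t) = (\<Union>s\<in>S. ?B s)"
      by (subst (3) eq) (auto simp: Plus_def)
    finally show ?thesis .
  qed
  then obtain x where x: "\<forall>s\<in>F <+> T. x s \<in> ?B s" "inj_on x (F <+> T)" "fn.independent (x ` (F <+> T))"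
    using fn.independent_transversal[of "F <+> T" ?B] assms(1-3) by (force split: sum.splits)
  define d0 :: "'b \<Rightarrow> real^2" where
    "d0 e = (if x (Inl e) = u1 e then axis 1 1 else axis 2 1)" for e
  define y where "y t = x (Inr t)" for t
  have row: "row_family u1 u2 d0 (Inl e) = x (Inl e)" if "e \<in> F" for e
  proof -
    have "x (Inl e) = u1 e \<or> x (Inl e) = u2 e"
      using bspec[OF x(1) InlI[OF that]] by simp
    then show ?thesis
      by (cases "x (Inl e) = u1 e") (simp_all add: row_family_def edge_row_def d0_def axis_def)
  qed
  have img: "row_family u1 u2 d0 ` (F <+> y ` T) = x ` (F <+> T)"
    using row by (force simp: Plus_def image_Un image_image y_def row_family_def intro: image_eqI)
  \<comment> \<open>The right summand is indexed by the functionals \<open>y t\<close> and no longer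
    by \<open>t\<close>; \<open>lift\<close> returns to the indices of the transversal.\<close>
  have "inj_on (row_family u1 u2 d0) (F <+> y ` T)"
  proof (rule inj_onI)
    let ?r = "row_family u1 u2 d0"
    have lift: "\<exists>s'\<in>F <+> T. ?r s = x s' \<and> s = (case s' of Inl e \<Rightarrow> Inl e | Inr t \<Rightarrow> Inr (y t))"
      if "s \<in> F <+> y ` T" for s
      using that
    proof (rule PlusE)
      fix e assume "e \<in> F" "s = Inl e"
      then show ?thesis using row by (intro bexI[of _ "Inl e"]) auto
    next
      fix a assume "a \<in> y ` T" "s = Inr a"
      then obtain t where "t \<in> T" "s = Inr (y t)" by blast
      then show ?thesis by (intro bexI[of _ "Inr t"]) (auto simp: row_family_def y_def)
    qed
    fix s t assume st: "s \<in> F <+> y ` T" "t \<in> F <+> y ` T" "?r s = ?r t"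
    obtain s' where s': "s' \<in> F <+> T" "?r s = x s'" "s = (case s' of Inl e \<Rightarrow> Inl e | Inr t \<Rightarrow> Inr (y t))"
      using lift[OF st(1)] by blast
    obtain t' where t': "t' \<in> F <+> T" "?r t = x t'" "t = (case t' of Inl e \<Rightarrow> Inl e | Inr t \<Rightarrow> Inr (y t))"
      using lift[OF st(2)] by blast
    have "s' = t'" using x(2) s' t' st(3) by (auto dest: inj_onD)
    then show "s = t" using s' t' by simp
  qed
  then have "indep_fam (F <+> y ` T) (row_family u1 u2 d0)"
    using x(3) assms(1,2) img by (subst indep_fam_iff) auto
  moreover have "\<forall>t\<in>T. y t \<in> A t"
  proof
    fix t assume "t \<in> T"
    from bspec[OF x(1) InrI[OF this]] show "y t \<in> A t" by (simp add: y_def)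
  qed
  ultimately show ?thesis by blast
qed

lemma row_in_span:
  assumes "u1 e \<in> fn.span S" "u2 e \<in> fn.span S"
  shows "edge_row u1 u2 d e \<in> fn.span S"
proof -
  have "edge_row u1 u2 d e = (\<lambda>x. d e $ 1 * u1 e x) + (\<lambda>x. d e $ 2 * u2 e x)"
    by (simp add: edge_row_def fun_eq_iff)
  then show ?thesis
    using assms by (simp add: fn.span_add fn.span_scale)
qed

section \<open>The groups in complex coordinates\<close>

definition zeta :: "nat \<Rightarrow> complex" where
  "zeta k = cis (2 * pi / real k)"

definition lat :: "complex \<Rightarrow> complex \<Rightarrow> int \<times> int \<Rightarrow> complex" where
  "lat v1 v2 t = of_int (fst t) * v1 + of_int (snd t) * v2"

definition act :: "nat \<Rightarrow> complex \<Rightarrow> complex \<Rightarrow> gam \<Rightarrow> complex \<Rightarrow> complex" where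
  "act k v1 v2 g z = lat v1 v2 (fst g) + zeta k ^ snd g * z"

abbreviation gam_index :: "nat \<Rightarrow> bool" where
  "gam_index k \<equiv> k \<in> {1, 2, 3, 4, 6}"

text \<open>The relation between the lattice vectors under which \<open>act\<close> respects the
  product of \<open>Gam k\<close>; for \<open>k\<close> at most 2 they are free.\<close>

definition compat :: "nat \<Rightarrow> complex \<Rightarrow> complex \<Rightarrow> bool" where
  "compat k v1 v2 \<longleftrightarrow> (3 \<le> k \<longrightarrow> v2 = zeta k * v1)"

text \<open>The lattice vectors \<open>z\<close> and \<open>z * xi k\<close> are compatible and
  nondegenerate for every admissible \<open>k\<close>. For \<open>k\<close> at most 2 any nonreal
  ratio would do; for larger \<open>k\<close> it has to be \<open>zeta k\<close>.\<close>

definition xi :: "nat \<Rightarrow> complex" where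
  "xi k = (if k \<le> 2 then \<i> else zeta k)"

lemma compat_xi: "compat k z (z * xi k)"
  by (auto simp: compat_def xi_def)

lemma zeta_power: "zeta k ^ r = cis (2 * pi * real r / real k)"
  unfolding zeta_def by (simp add: Complex.DeMoivre algebra_simps)

lemma zeta_power_k: "0 < k \<Longrightarrow> zeta k ^ k = 1"
  by (simp add: zeta_power)

lemma zeta_nonzero [simp]: "zeta k \<noteq> 0"
  by (simp add: zeta_def)

lemma zeta_power_inj:
  assumes "r < k" "s < k" "zeta k ^ r = zeta k ^ s"
  shows "r = s"
proof -
  have "inj_on (\<lambda>j. cis (2 * pi * real j / real k)) {..<k}"
    using Complex.bij_betw_roots_unity[of k] assms by (auto dest: bij_betw_imp_inj_on)
  then show ?thesis
    using assms by (auto simp: zeta_power dest: inj_onD)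
qed

lemma zeta_power_mod: "0 < k \<Longrightarrow> zeta k ^ (r mod k) = zeta k ^ r"
  by (metis zeta_power_k div_mult_mod_eq mult.commute power_add power_mult power_one mult_1)

lemma zeta_simps:
  "zeta 1 = 1" "zeta 2 = -1" "zeta 3 = Complex (-1/2) (sqrt 3 / 2)" "zeta 4 = \<i>"
  "zeta 6 = Complex (1/2) (sqrt 3 / 2)"
proof -
  have "2 * pi / 3 = pi - pi / 3" by simp
  then have "cos (2 * pi / 3) = - 1 / 2" "sin (2 * pi / 3) = sqrt 3 / 2"
    by (simp_all only: cos_pi_minus sin_pi_minus cos_60 sin_60)
  then show "zeta 3 = Complex (-1/2) (sqrt 3 / 2)"
    by (simp add: zeta_def complex_eq_iff)
  have "2 * pi / 6 = pi / 3" by simp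
  then show "zeta 6 = Complex (1/2) (sqrt 3 / 2)"
    by (simp add: zeta_def complex_eq_iff cos_60 sin_60)
  have "2 * pi / 4 = pi / 2" by simp
  then show "zeta 4 = \<i>" by (simp add: zeta_def complex_eq_iff)
qed (simp_all add: zeta_def)

lemma Im_xi: "gam_index k \<Longrightarrow> Im (xi k) \<noteq> 0"
  by (auto simp: xi_def zeta_simps)

text \<open>For \<open>k\<close> at least 3 the integer matrix is the companion matrix of the
  quadratic equation \<open>sq\<close> of \<open>zeta k\<close>, so it describes multiplication by
  \<open>zeta k\<close> in the basis \<open>v1\<close>, \<open>zeta k * v1\<close>.\<close>

lemma lat_rot:
  assumes "gam_index k" "compat k v1 v2"
  shows "lat v1 v2 (lattice_rot k t) = zeta k * lat v1 v2 t"
proof (cases "k \<le> 2")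
  case True
  then have "k = 1 \<or> k = 2" using assms by auto
  then show ?thesis
    by (auto simp: lat_def lattice_rot_def zeta_simps case_prod_beta simp del: One_nat_def)
next
  case False
  then have k: "k = 3 \<or> k = 4 \<or> k = 6" and v2: "v2 = zeta k * v1"
    using assms by (auto simp: compat_def)
  have sq: "zeta 3 * zeta 3 = - zeta 3 - 1" "zeta 4 * zeta 4 = -1" "zeta 6 * zeta 6 = zeta 6 - 1"
    by (auto simp: zeta_simps complex_eq_iff)
  have "zeta k * lat v1 v2 t = of_int (fst t) * zeta k * v1 + of_int (snd t) * (zeta k * zeta k) * v1"
    by (simp add: lat_def v2 algebra_simps)
  then show ?thesis
    using k by (elim disjE; simp add: sq lat_def lattice_rot_def case_prod_beta v2; simp add: algebra_simps)
qed

lemma lat_rot_funpow: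
  assumes "gam_index k" "compat k v1 v2"
  shows "lat v1 v2 ((lattice_rot k ^^ r) t) = zeta k ^ r * lat v1 v2 t"
  by (induction r) (simp_all add: lat_rot[OF assms])

lemma lat_add: "lat v1 v2 (a + c, b + d) = lat v1 v2 (a, b) + lat v1 v2 (c, d)"
  by (simp add: lat_def algebra_simps)

lemma Gam_mult:
  "g \<otimes>\<^bsub>Gam k\<^esub> h =
    ((fst (fst g) + fst ((lattice_rot k ^^ snd g) (fst h)), snd (fst g) + snd ((lattice_rot k ^^ snd g) (fst h))),
      (snd g + snd h) mod k)"
  by (simp add: Gam_def case_prod_beta Let_def)

lemma Gam_carrier: "g \<in> carrier (Gam k) \<longleftrightarrow> snd g < k"
  by (cases g) (auto simp: Gam_def)

lemma Gam_one: "\<one>\<^bsub>Gam k\<^esub> = ((0, 0), 0)"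
  by (simp add: Gam_def)

lemma act_mult:
  assumes "gam_index k" "compat k v1 v2"
  shows "act k v1 v2 (g \<otimes>\<^bsub>Gam k\<^esub> h) z = act k v1 v2 g (act k v1 v2 h z)"
proof -
  have "0 < k" using assms by auto
  then show ?thesis
    using lat_add[of v1 v2 "fst (fst g)" "fst ((lattice_rot k ^^ snd g) (fst h))" "snd (fst g)"
        "snd ((lattice_rot k ^^ snd g) (fst h))"]
    by (simp add: act_def Gam_mult lat_rot_funpow[OF assms] zeta_power_mod power_add algebra_simps)
qed

lemma act_one [simp]: "act k v1 v2 ((0, 0), 0) z = z"
  by (simp add: act_def lat_def)

lemma lat_xi_eq_0:
  assumes "Im w \<noteq> 0" "z \<noteq> 0" "lat z (z * w) t = 0"
  shows "t = (0, 0)"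
proof -
  have "z * (of_int (fst t) + of_int (snd t) * w) = 0"
    using assms(3) by (simp add: lat_def algebra_simps)
  then have *: "of_int (fst t) + of_int (snd t) * w = 0" using assms by simp
  have "Im (of_int (fst t) + of_int (snd t) * w) = 0" unfolding * by simp
  then have "snd t = 0" using assms(1) by simp
  then show ?thesis using * by (simp add: prod_eq_iff)
qed

lemma lat_xi_inj:
  assumes "Im w \<noteq> 0" "z \<noteq> 0" "lat z (z * w) s = lat z (z * w) t"
  shows "s = t"
proof -
  have "lat z (z * w) (fst s - fst t, snd s - snd t) = 0"
    using assms(3) by (simp add: lat_def algebra_simps)
  from lat_xi_eq_0[OF assms(1,2) this] show ?thesis by (simp add: prod_eq_iff)
qed

text \<open>Associativity in \<open>Gam k\<close> is checked on its action on the plane, where it is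
  composition of maps. The points 0 and 1 separate the lattice part from the rotation.\<close>

lemma act_faithful:
  assumes "gam_index k" "snd g < k" "snd h < k" "\<And>z. act k 1 (xi k) g z = act k 1 (xi k) h z"
  shows "g = h"
proof -
  have l: "lat 1 (1 * xi k) (fst g) = lat 1 (1 * xi k) (fst h)"
    using assms(4)[of 0] by (simp add: act_def)
  have "zeta k ^ snd g = zeta k ^ snd h"
    using assms(4)[of 1] l by (simp add: act_def)
  then have "snd g = snd h" using assms by (auto intro: zeta_power_inj)
  moreover have "fst g = fst h"
    using lat_xi_inj[OF Im_xi _ l] assms by simp
  ultimately show ?thesis by (simp add: prod_eq_iff)
qed

lemma group_Gam:
  assumes k: "gam_index k"
  shows "group (Gam k)"
proof (rule groupI)
  have k0: "0 < k" using k by auto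
  have c: "compat k 1 (xi k)" using compat_xi[of k 1] by simp
  show "\<one>\<^bsub>Gam k\<^esub> \<in> carrier (Gam k)" using k0 by (simp add: Gam_one Gam_carrier)
  show mem: "g \<otimes>\<^bsub>Gam k\<^esub> h \<in> carrier (Gam k)" if "g \<in> carrier (Gam k)" "h \<in> carrier (Gam k)" for g h
    using k0 by (simp add: Gam_mult Gam_carrier)
  show "g \<otimes>\<^bsub>Gam k\<^esub> h \<otimes>\<^bsub>Gam k\<^esub> l = g \<otimes>\<^bsub>Gam k\<^esub> (h \<otimes>\<^bsub>Gam k\<^esub> l)"
    if "g \<in> carrier (Gam k)" "h \<in> carrier (Gam k)" "l \<in> carrier (Gam k)" for g h l
    using that mem
    by (intro act_faithful[OF k]) (simp_all add: act_mult[OF k c] flip: Gam_carrier)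
  show "\<one>\<^bsub>Gam k\<^esub> \<otimes>\<^bsub>Gam k\<^esub> g = g" if "g \<in> carrier (Gam k)" for g
    using that k0 by (simp add: Gam_mult Gam_one Gam_carrier)
  show "\<exists>h\<in>carrier (Gam k). h \<otimes>\<^bsub>Gam k\<^esub> g = \<one>\<^bsub>Gam k\<^esub>" if g: "g \<in> carrier (Gam k)" for g
  proof -
    \<comment> \<open>The outer \<open>mod k\<close> turns the exponent \<open>k\<close> into 0 when
      \<open>g\<close> is a translation.\<close>
    let ?r = "(k - snd g) mod k"
    let ?t = "(lattice_rot k ^^ ?r) (fst g)"
    let ?h = "((- fst ?t, - snd ?t), ?r)"
    have "(?r + snd g) mod k = 0"
      using g by (simp add: Gam_carrier mod_simps)
    then have "?h \<otimes>\<^bsub>Gam k\<^esub> g = \<one>\<^bsub>Gam k\<^esub>"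
      by (simp add: Gam_mult Gam_one)
    moreover have "?h \<in> carrier (Gam k)" using k0 by (simp add: Gam_carrier)
    ultimately show ?thesis by blast
  qed
qed

lemma act_inv:
  assumes "gam_index k" "compat k v1 v2" "g \<in> carrier (Gam k)"
  shows "act k v1 v2 (inv\<^bsub>Gam k\<^esub> g) (act k v1 v2 g z) = z"
  using act_mult[OF assms(1,2), of "inv\<^bsub>Gam k\<^esub> g" g z] group.l_inv[OF group_Gam[OF assms(1)] assms(3)]
  by (simp add: Gam_one)

lemma act_inv':
  assumes "gam_index k" "compat k v1 v2" "g \<in> carrier (Gam k)"
  shows "act k v1 v2 g (act k v1 v2 (inv\<^bsub>Gam k\<^esub> g) z) = z"
  using act_mult[OF assms(1,2), of g "inv\<^bsub>Gam k\<^esub> g" z] group.r_inv[OF group_Gam[OF assms(1)] assms(3)]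
  by (simp add: Gam_one)

section \<open>The plane as the complex numbers\<close>

definition cx :: "real^2 \<Rightarrow> complex" where
  "cx v = Complex (v $ 1) (v $ 2)"

definition cv :: "complex \<Rightarrow> real^2" where
  "cv z = vector [Re z, Im z]"

lemma cx_cv [simp]: "cx (cv z) = z" and cv_cx [simp]: "cv (cx v) = v"
  by (simp_all add: cx_def cv_def vec_eq_iff forall_2)

lemma cx_inject [simp]: "cx v = cx w \<longleftrightarrow> v = w"
  by (metis cv_cx)

lemma cx_simps [simp]: "cx (v + w) = cx v + cx w" "cx (v - w) = cx v - cx w" "cx 0 = 0"
  "cx (c *\<^sub>R v) = of_real c * cx v" "cx (- v) = - cx v"
  by (simp_all add: cx_def complex_eq_iff)

lemma cv_simps: "cv (z + w) = cv z + cv w" "cv 0 = 0"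
  by (simp_all add: cv_def vec_eq_iff forall_2)

lemma norm_cx: "norm (cx v) = norm v"
  by (simp add: cx_def cmod_def norm_vec_def L2_set_def sum_2)

lemma cx_Rot: "cx (Rot k *v v) = zeta k * cx v"
  by (simp add: cx_def Rot_def zeta_def complex_eq_iff matrix_vector_mult_def sum_2 vector_2)

lemma cx_Rot_funpow: "cx ((((*v) (Rot k)) ^^ r) v) = zeta k ^ r * cx v"
  by (induction r) (simp_all add: cx_Rot)

lemma inner_perp: "v \<bullet> perp d = Im (cnj (cx d) * cx v)"
  by (simp add: perp_def cx_def inner_vec_def sum_2 vector_2 algebra_simps)

lemma matrix_eq_cx: "(\<And>v. cx (A *v v) = cx (B *v v)) \<Longrightarrow> A = B"
  by (simp add: matrix_eq)

section \<open>Isometries of the plane\<close>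

lemma orthogonal_matrix_cx:
  assumes "orthogonal_matrix (A :: real^2^2)"
  shows "\<exists>u. norm u = 1 \<and> ((\<forall>v. cx (A *v v) = u * cx v) \<or> (\<forall>v. cx (A *v v) = u * cnj (cx v)))"
proof -
  define a b c d where "a = A $ 1 $ 1" "b = A $ 1 $ 2" "c = A $ 2 $ 1" "d = A $ 2 $ 2"
  note abcd = this
  have "transpose A ** A = mat 1" using assms by (simp add: orthogonal_matrix)
  then have "\<forall>i j. (transpose A ** A) $ i $ j = mat 1 $ i $ j" by simp
  then have cols: "a * a + c * c = 1" "a * b + c * d = 0" "b * b + d * d = 1"
    by (simp_all add: forall_2 matrix_matrix_mult_def transpose_def mat_def sum_2 abcd)
  \<comment> \<open>\<open>l\<close> is the determinant. The column relations make the second column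
    \<open>l\<close> times the first one turned by a right angle.\<close>
  define l where "l = a * d - b * c"
  have "- l * c = b * (a * a + c * c) - a * (a * b + c * d)"
    "l * a = d * (a * a + c * c) - c * (a * b + c * d)"
    "l * l = (a * a + c * c) * (b * b + d * d) - (a * b + c * d) * (a * b + c * d)"
    by (simp_all add: l_def algebra_simps)
  then have bd: "b = - l * c" "d = l * a" and "l * l = 1"
    using cols by simp_all
  then have l: "l = 1 \<or> l = -1" using square_eq_1_iff by blast
  have cxA: "cx (A *v v) = Complex (a * v $ 1 + b * v $ 2) (c * v $ 1 + d * v $ 2)" for v
    by (simp add: cx_def matrix_vector_mult_def sum_2 abcd)
  have "norm (Complex a c) = 1"
    using cols by (simp add: cmod_def power2_eq_square)
  moreover have "(\<forall>v. cx (A *v v) = Complex a c * cx v) \<or> (\<forall>v. cx (A *v v) = Complex a c * cnj (cx v))"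
    unfolding cxA using l bd by (auto simp: cx_def complex_eq_iff)
  ultimately show ?thesis by blast
qed

definition rotm :: "complex \<Rightarrow> real^2^2" where
  "rotm u = vector [vector [Re u, - Im u], vector [Im u, Re u]]"

lemma cx_rotm [simp]: "cx (rotm u *v v) = u * cx v"
  by (simp add: cx_def rotm_def complex_eq_iff matrix_vector_mult_def sum_2 vector_2)

lemma rotm_1 [simp]: "rotm 1 = mat 1"
  by (rule matrix_eq_cx) simp

lemma rotm_mult: "rotm (u * w) = rotm u ** rotm w"
  by (rule matrix_eq_cx) (simp flip: matrix_vector_mul_assoc add: mult.assoc)

lemma rotm_zeta: "rotm (zeta k) = Rot k"
  by (rule matrix_eq_cx) (simp add: cx_Rot)

lemma orthogonal_rotm:
  assumes "norm u = 1"
  shows "orthogonal_matrix (rotm u)"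
proof -
  have n: "(Re u)\<^sup>2 + (Im u)\<^sup>2 = 1" using assms cmod_power2[of u] by simp
  have "transpose (rotm u) ** rotm u = mat 1"
    using n
    by (simp add: vec_eq_iff forall_2 matrix_matrix_mult_def transpose_def mat_def sum_2 rotm_def vector_2
        power2_eq_square algebra_simps)
  then show ?thesis by (simp add: orthogonal_matrix)
qed

definition std_rep :: "nat \<Rightarrow> complex \<Rightarrow> complex \<Rightarrow> gam \<Rightarrow> euc" where
  "std_rep k v1 v2 g = (cv (lat v1 v2 (fst g)), rotm (zeta k ^ snd g))"

lemma Euc2_mult: "p \<otimes>\<^bsub>Euc2\<^esub> q = (fst p + snd p *v fst q, snd p ** snd q)"
  by (simp add: Euc2_def case_prod_beta)

lemma Euc2_carrier: "p \<in> carrier Euc2 \<longleftrightarrow> orthogonal_matrix (snd p)"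
  by (cases p) (simp add: Euc2_def)

lemma norm_zeta_power: "norm (zeta k ^ r) = 1"
  by (simp add: norm_power zeta_def)

lemma std_rep_apply: "cx (euc_apply (std_rep k v1 v2 g) x) = act k v1 v2 g (cx x)"
  by (simp add: std_rep_def act_def)

lemma std_rep_hom:
  assumes "gam_index k" "compat k v1 v2"
  shows "std_rep k v1 v2 \<in> hom (Gam k) Euc2"
proof (rule homI)
  have k0: "0 < k" using assms by auto
  fix g h assume "g \<in> carrier (Gam k)" "h \<in> carrier (Gam k)"
  show "std_rep k v1 v2 g \<in> carrier Euc2"
    by (simp add: Euc2_carrier std_rep_def orthogonal_rotm norm_zeta_power)
  have "lat v1 v2 (fst (g \<otimes>\<^bsub>Gam k\<^esub> h)) = act k v1 v2 (g \<otimes>\<^bsub>Gam k\<^esub> h) 0"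
    by (simp add: act_def)
  also have "\<dots> = lat v1 v2 (fst g) + zeta k ^ snd g * lat v1 v2 (fst h)"
    unfolding act_mult[OF assms] by (simp add: act_def)
  finally have "cx (cv (lat v1 v2 (fst (g \<otimes>\<^bsub>Gam k\<^esub> h))))
      = cx (cv (lat v1 v2 (fst g)) + rotm (zeta k ^ snd g) *v cv (lat v1 v2 (fst h)))"
    by simp
  then have lat_eq: "cv (lat v1 v2 (fst (g \<otimes>\<^bsub>Gam k\<^esub> h)))
      = cv (lat v1 v2 (fst g)) + rotm (zeta k ^ snd g) *v cv (lat v1 v2 (fst h))"
    by (simp only: cx_inject)
  have "zeta k ^ snd (g \<otimes>\<^bsub>Gam k\<^esub> h) = zeta k ^ snd g * zeta k ^ snd h"
    using k0 by (simp add: Gam_mult zeta_power_mod power_add)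
  then show "std_rep k v1 v2 (g \<otimes>\<^bsub>Gam k\<^esub> h) = std_rep k v1 v2 g \<otimes>\<^bsub>Euc2\<^esub> std_rep k v1 v2 h"
    unfolding std_rep_def Euc2_mult lat_eq by (simp add: rotm_mult)
qed

lemma rotm_inj: "rotm u = rotm w \<Longrightarrow> u = w"
  by (metis cx_rotm mult.right_neutral cx_cv)

text \<open>The imaginary part bounds the second coefficient because \<open>w\<close> is not real;
  the triangle inequality then bounds the first.\<close>

lemma finite_lat_bounded:
  assumes "Im w \<noteq> 0" "z \<noteq> 0"
  shows "finite {t. norm (lat z (z * w) t) \<le> R}"
proof -
  define S where "S = R / norm z"
  define N where "N = \<lceil>S / \<bar>Im w\<bar>\<rceil>"
  define M where "M = \<lceil>S + S / \<bar>Im w\<bar> * norm w\<rceil>"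
  have "{t. norm (lat z (z * w) t) \<le> R} \<subseteq> {-M..M} \<times> {-N..N}"
  proof
    fix t assume "t \<in> {t. norm (lat z (z * w) t) \<le> R}"
    moreover obtain a b where t: "t = (a, b)" by fastforce
    ultimately have "norm (lat z (z * w) (a, b)) \<le> R" by simp
    moreover have "lat z (z * w) (a, b) = z * (of_int a + of_int b * w)"
      by (simp add: lat_def algebra_simps)
    ultimately have "norm z * norm (of_int a + of_int b * w) \<le> R"
      by (simp only: norm_mult)
    then have *: "norm (of_int a + of_int b * w) \<le> S"
      using assms by (simp add: S_def pos_le_divide_eq mult.commute)
    have "\<bar>of_int b * Im w\<bar> \<le> S"
      using * abs_Im_le_cmod[of "of_int a + of_int b * w"] by simp
    then have b: "\<bar>of_int b\<bar> \<le> S / \<bar>Im w\<bar>"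
      using assms by (simp add: abs_mult field_simps)
    have "norm (of_int a :: complex) \<le> norm (of_int a + of_int b * w) + norm (of_int b * w)"
      using norm_triangle_ineq4[of "of_int a + of_int b * w" "of_int b * w"] by simp
    also have "\<dots> \<le> S + S / \<bar>Im w\<bar> * norm w"
      using * mult_right_mono[OF b norm_ge_zero[of w]] by (simp add: norm_mult)
    finally have "\<bar>of_int a\<bar> \<le> S + S / \<bar>Im w\<bar> * norm w" by simp
    then have "\<bar>a\<bar> \<le> M" unfolding M_def by linarith
    moreover have "\<bar>b\<bar> \<le> N" using b unfolding N_def by linarith
    ultimately show "t \<in> {-M..M} \<times> {-N..N}" unfolding t by auto
  qed
  then show ?thesis by (rule finite_subset) simp
qed

text \<open>A ball of radius 1 bounds the translation part, hence meets only finitely many images;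
  finitely many points do not accumulate.\<close>

lemma std_rep_in_Rep:
  assumes k: "gam_index k" and c: "compat k z (z * w)" and w: "Im w \<noteq> 0" "z \<noteq> 0"
  shows "std_rep k z (z * w) \<in> Rep k"
proof -
  let ?P = "std_rep k z (z * w)"
  have "inj_on ?P (carrier (Gam k))"
  proof (rule inj_onI)
    fix g h assume gh: "g \<in> carrier (Gam k)" "h \<in> carrier (Gam k)" "?P g = ?P h"
    then have e: "lat z (z * w) (fst g) = lat z (z * w) (fst h)" "zeta k ^ snd g = zeta k ^ snd h"
      by (auto simp: std_rep_def dest: rotm_inj arg_cong[of _ _ cx])
    have "fst g = fst h" by (rule lat_xi_inj[OF w e(1)])
    moreover have "snd g = snd h"
      using gh(1,2) by (intro zeta_power_inj[OF _ _ e(2)]) (simp_all add: Gam_carrier)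
    ultimately show "g = h" by (rule prod_eqI)
  qed
  moreover have "discrete (?P ` carrier (Gam k))"
  proof (rule discreteI)
    fix p assume p: "p \<in> ?P ` carrier (Gam k)"
    let ?R = "norm (fst p) + 1"
    have "?P ` carrier (Gam k) \<inter> ball p 1 \<subseteq> ?P ` ({t. norm (lat z (z * w) t) \<le> ?R} \<times> {..<k})"
    proof
      fix q assume "q \<in> ?P ` carrier (Gam k) \<inter> ball p 1"
      then obtain t r where g: "(t, r) \<in> carrier (Gam k)" "?P (t, r) \<in> ball p 1" and q: "q = ?P (t, r)"
        by auto
      have "dist (fst p) (fst (?P (t, r))) < 1"
        using g dist_fst_le[of p "?P (t, r)"] by (simp add: mem_ball)
      then have "norm (fst (?P (t, r))) \<le> ?R"
        using norm_triangle_ineq2[of "fst (?P (t, r))" "fst p"] by (simp add: dist_norm norm_minus_commute)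
      then have "norm (lat z (z * w) t) \<le> ?R"
        using norm_cx[of "cv (lat z (z * w) t)"] by (simp add: std_rep_def)
      then show "q \<in> ?P ` ({t. norm (lat z (z * w) t) \<le> ?R} \<times> {..<k})"
        unfolding q using g by (intro imageI) (simp add: Gam_carrier)
    qed
    then have "finite (?P ` carrier (Gam k) \<inter> ball p 1)"
      by (rule finite_subset) (use finite_lat_bounded[OF w] in simp)
    then have "\<not> p islimpt (?P ` carrier (Gam k))"
      unfolding islimpt_eq_infinite_ball by (auto intro!: exI[of _ 1])
    then show "p isolated_in (?P ` carrier (Gam k))"
      using p by (simp add: isolated_in_islimpt_iff)
  qed
  ultimately show ?thesis
    using std_rep_hom[OF k c] by (simp add: Rep_def)
qed

section \<open>Discreteness and bounded translation parts\<close>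

lemma tendsto_matrix_mult:
  fixes f :: "'x \<Rightarrow> real^'n^'m" and g :: "'x \<Rightarrow> real^'p^'n"
  assumes "(f \<longlongrightarrow> A) F" "(g \<longlongrightarrow> B) F"
  shows "((\<lambda>x. f x ** g x) \<longlongrightarrow> A ** B) F"
  unfolding matrix_matrix_mult_def by (intro tendsto_vec_lambda tendsto_sum tendsto_mult tendsto_vec_nth assms)

lemma tendsto_matrix_vector_mult:
  fixes f :: "'x \<Rightarrow> real^'n^'m" and g :: "'x \<Rightarrow> real^'n"
  assumes "(f \<longlongrightarrow> A) F" "(g \<longlongrightarrow> B) F"
  shows "((\<lambda>x. f x *v g x) \<longlongrightarrow> A *v B) F"
  unfolding matrix_vector_mult_def by (intro tendsto_vec_lambda tendsto_sum tendsto_mult tendsto_vec_nth assms)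

lemma tendsto_transpose:
  fixes f :: "'x \<Rightarrow> real^'n^'m"
  assumes "(f \<longlongrightarrow> A) F"
  shows "((\<lambda>x. transpose (f x)) \<longlongrightarrow> transpose A) F"
  unfolding transpose_def by (intro tendsto_vec_lambda tendsto_vec_nth assms)

lemma norm_orthogonal_matrix:
  assumes "orthogonal_matrix (A :: real^2^2)"
  shows "norm A \<le> 2"
proof -
  have "norm (A $ i) = 1" for i
    using assms unfolding orthogonal_matrix_orthonormal_rows by (simp add: row_def vec_lambda_eta)
  then have "L2_set (\<lambda>i. norm (A $ i)) UNIV \<le> (\<Sum>i\<in>(UNIV :: 2 set). 1)"
    using L2_set_le_sum[of UNIV "\<lambda>i. norm (A $ i)"] by simp
  then show ?thesis by (simp add: norm_vec_def)
qed

text \<open>The elements with bounded translation part would otherwise accumulate; quotients of two of them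
  then accumulate at the identity.\<close>

lemma Rep_bounded_finite:
  assumes k: "gam_index k" and P: "P \<in> Rep k"
  shows "finite {g \<in> carrier (Gam k). norm (fst (P g)) \<le> R}" (is "finite ?X")
proof (rule ccontr)
  interpret group "Gam k" by (rule group_Gam[OF k])
  let ?S = "P ` carrier (Gam k)"
  have hom: "P \<in> hom (Gam k) Euc2" and inj: "inj_on P (carrier (Gam k))" and disc: "discrete ?S"
    using P by (auto simp: Rep_def)
  have mult: "P (g \<otimes>\<^bsub>Gam k\<^esub> h) = (fst (P g) + snd (P g) *v fst (P h), snd (P g) ** snd (P h))"
    if "g \<in> carrier (Gam k)" "h \<in> carrier (Gam k)" for g h
    using hom_mult[OF hom that] by (simp add: Euc2_mult)
  have orth: "orthogonal_matrix (snd (P g))" if "g \<in> carrier (Gam k)" for g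
    using hom_in_carrier[OF hom that] by (simp add: Euc2_carrier)
  assume "infinite ?X"
  moreover have "inj_on P ?X" using inj by (rule inj_on_subset) auto
  ultimately have "infinite (P ` ?X)" using finite_imageD by blast
  moreover have "bounded (P ` ?X)"
  proof (rule boundedI)
    fix p assume "p \<in> P ` ?X"
    then obtain g where "g \<in> ?X" "p = P g" by blast
    then have "norm (fst p) \<le> R" "norm (snd p) \<le> 2"
      using norm_orthogonal_matrix orth by auto
    then show "norm p \<le> R + 2"
      using norm_Pair_le[of "fst p" "snd p"] by simp
  qed
  ultimately obtain x where "x islimpt (P ` ?X)"
    using bounded_infinite_imp_islimpt[of "P ` ?X" "P ` ?X"] by blast
  then obtain f where f: "\<And>n::nat. f n \<in> P ` ?X - {x}" "f \<longlonglongrightarrow> x"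
    unfolding islimpt_sequential by blast
  \<comment> \<open>\<open>Q (p, q)\<close> is \<open>p\<close> times the inverse of
    \<open>q\<close>, written with the transpose so that it is visibly continuous also at the limit
    point.\<close>
  define Q where "Q = (\<lambda>(p :: euc, q :: euc).
    (fst p - (snd p ** transpose (snd q)) *v fst q, snd p ** transpose (snd q)))"
  have Q_in: "Q (P g, P h) = P (g \<otimes>\<^bsub>Gam k\<^esub> inv\<^bsub>Gam k\<^esub> h)"
    if "g \<in> carrier (Gam k)" "h \<in> carrier (Gam k)" for g h
  proof -
    let ?r = "g \<otimes>\<^bsub>Gam k\<^esub> inv\<^bsub>Gam k\<^esub> h"
    have "P g = P (?r \<otimes>\<^bsub>Gam k\<^esub> h)" using that by (simp add: m_assoc)
    also have "\<dots> = (fst (P ?r) + snd (P ?r) *v fst (P h), snd (P ?r) ** snd (P h))"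
      using that by (intro mult) auto
    finally have e: "P g = (fst (P ?r) + snd (P ?r) *v fst (P h), snd (P ?r) ** snd (P h))" .
    have "snd (P h) ** transpose (snd (P h)) = mat 1"
      using orth[OF that(2)] by (simp add: orthogonal_matrix_def)
    then have "snd (P g) ** transpose (snd (P h)) = snd (P ?r)"
      by (simp add: e flip: matrix_mul_assoc)
    then show ?thesis by (simp add: Q_def e prod_eq_iff)
  qed
  \<comment> \<open>The limit point is not known to lie in the image. Its linear part is still
    orthogonal, which makes \<open>Q (x, x)\<close> the identity.\<close>
  have ox: "snd x ** transpose (snd x) = mat 1"
  proof (rule LIMSEQ_unique)
    have "snd (f n) ** transpose (snd (f n)) = mat 1" for n
      using f(1)[of n] orth by (auto simp: orthogonal_matrix_def)
    then show "(\<lambda>n. snd (f n) ** transpose (snd (f n))) \<longlonglongrightarrow> mat 1" by simp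
  qed (intro tendsto_matrix_mult tendsto_transpose tendsto_snd f)
  have one: "P \<one>\<^bsub>Gam k\<^esub> = (0, mat 1)"
  proof -
    have "P \<one>\<^bsub>Gam k\<^esub> = Q (P \<one>\<^bsub>Gam k\<^esub>, P \<one>\<^bsub>Gam k\<^esub>)" by (subst Q_in) auto
    moreover have "snd (P \<one>\<^bsub>Gam k\<^esub>) ** transpose (snd (P \<one>\<^bsub>Gam k\<^esub>)) = mat 1"
      using orth[of "\<one>\<^bsub>Gam k\<^esub>"] by (simp add: orthogonal_matrix_def)
    ultimately show ?thesis by (simp add: Q_def)
  qed
  have Qx: "Q (x, x) = (0, mat 1)"
    by (simp add: Q_def ox)
  have lim: "((\<lambda>mn. Q (f (fst mn), f (snd mn))) \<longlongrightarrow> Q (x, x)) (sequentially \<times>\<^sub>F sequentially)"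
  proof -
    have 1: "((\<lambda>mn. f (fst mn)) \<longlongrightarrow> x) (sequentially \<times>\<^sub>F sequentially)"
      "((\<lambda>mn. f (snd mn)) \<longlongrightarrow> x) (sequentially \<times>\<^sub>F sequentially)"
      by (rule filterlim_compose[OF f(2)], rule filterlim_fst filterlim_snd)+
    show ?thesis
      unfolding Q_def prod.case
      by (intro tendsto_Pair tendsto_diff tendsto_matrix_vector_mult tendsto_matrix_mult
          tendsto_transpose tendsto_fst tendsto_snd 1)
  qed
  \<comment> \<open>The identity is isolated in the image, so beyond some \<open>N\<close> every
    quotient of two terms is the identity and the sequence is constant. Its value would be
    \<open>x\<close>, which the sequence avoids.\<close>
  obtain T where T: "open T" "T \<inter> ?S = {P \<one>\<^bsub>Gam k\<^esub>}"
    using discreteD[OF disc, of "P \<one>\<^bsub>Gam k\<^esub>"] by (auto simp: isolated_in_def)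
  then have "Q (x, x) \<in> T" using Qx one by auto
  then have "eventually (\<lambda>mn. Q (f (fst mn), f (snd mn)) \<in> T) (sequentially \<times>\<^sub>F sequentially)"
    using topological_tendstoD[OF lim T(1)] by blast
  then obtain N where N: "\<And>m n. m \<ge> N \<Longrightarrow> n \<ge> N \<Longrightarrow> Q (f n, f m) \<in> T"
    by (auto simp: eventually_prod_sequentially)
  have "f n = f N" if n: "n \<ge> N" for n
  proof -
    obtain g h where gh: "g \<in> carrier (Gam k)" "f n = P g" "h \<in> carrier (Gam k)" "f N = P h"
      using f(1)[of n] f(1)[of N] by auto
    have "Q (f n, f N) \<in> ?S" using Q_in gh by auto
    then have "P (g \<otimes>\<^bsub>Gam k\<^esub> inv\<^bsub>Gam k\<^esub> h) = P \<one>\<^bsub>Gam k\<^esub>"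
      using T(2) N[of N n] n Q_in[of g h] gh by auto
    then have "g \<otimes>\<^bsub>Gam k\<^esub> inv\<^bsub>Gam k\<^esub> h = \<one>\<^bsub>Gam k\<^esub>"
      using inj gh by (auto dest: inj_onD)
    then have "g = h" using gh by (metis inv_equality inv_inv inv_closed)
    then show ?thesis using gh by simp
  qed
  then have "eventually (\<lambda>n. f n = f N) sequentially"
    unfolding eventually_sequentially by blast
  then have "f N = x"
    by (intro LIMSEQ_unique[OF tendsto_eventually f(2)])
  then show False using f(1)[of N] by simp
qed

section \<open>Discrete faithful representations\<close>

lemma int_pair_additive:
  fixes f :: "int \<times> int \<Rightarrow> complex"
  assumes add: "\<And>s t. f (s + t) = f s + f t"
  shows "f t = lat (f (1, 0)) (f (0, 1)) t"
proof -
  have scale: "f (a * b, a * c) = of_int a * f (b, c)" for a b c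
  proof (induction a rule: int_induct[where k = 0])
    case base
    show ?case using add[of 0 0] by (simp add: zero_prod_def)
  next
    case (step1 i)
    have *: "f ((i + 1) * b, (i + 1) * c) = f (i * b, i * c) + f (b, c)"
      unfolding add[symmetric] by (simp add: algebra_simps)
    show ?case unfolding * step1(2) by (simp add: algebra_simps)
  next
    case (step2 i)
    have "f (i * b, i * c) = f ((i - 1) * b, (i - 1) * c) + f (b, c)"
      unfolding add[symmetric] by (simp add: algebra_simps)
    then have *: "f ((i - 1) * b, (i - 1) * c) = f (i * b, i * c) - f (b, c)"
      by (simp only: eq_diff_eq)
    show ?case unfolding * step2(2) by (simp add: algebra_simps)
  qed
  have "f t = f ((fst t * 1, fst t * 0) + (snd t * 0, snd t * 1))" by simp
  then show ?thesis unfolding add scale lat_def by simp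
qed

lemma Gam_mult_translation: "(s, 0) \<otimes>\<^bsub>Gam k\<^esub> (t, 0) = (s + t, 0)"
  by (simp add: Gam_mult plus_prod_def)

text \<open>Translations act by translations: a rotation \<open>P t\<close> would make all of \<open>P \<int>\<^sup>2\<close> fix its centre,
  and a glide reflection would confine the translation vectors of all squares to a line. Both
  contradict discreteness.\<close>

lemma Rep_form:
  assumes k: "gam_index k" and P: "P \<in> Rep k"
  obtains v1 v2 where "\<And>t. P (t, 0) = (cv (lat v1 v2 t), mat 1)" "v1 \<noteq> 0"
    "3 \<le> k \<Longrightarrow> v2 = zeta k * v1 \<or> v2 = cnj (zeta k) * v1"
proof -
  interpret group "Gam k" by (rule group_Gam[OF k])
  have k0: "0 < k" using k by auto
  have hom: "P \<in> hom (Gam k) Euc2" and inj: "inj_on P (carrier (Gam k))"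
    using P by (auto simp: Rep_def)
  have tc: "(t, 0) \<in> carrier (Gam k)" for t using k0 by (simp add: Gam_carrier)
  define U where "U t = cx (fst (P (t, 0)))" for t
  define L where "L t z = cx (snd (P (t, 0)) *v cv z)" for t z
  have L_add: "L t (z + w) = L t z + L t w" for t z w
    by (simp add: L_def cv_simps matrix_vector_right_distrib)
  have mult: "P (g \<otimes>\<^bsub>Gam k\<^esub> h) = (fst (P g) + snd (P g) *v fst (P h), snd (P g) ** snd (P h))"
    if "g \<in> carrier (Gam k)" "h \<in> carrier (Gam k)" for g h
    using hom_mult[OF hom that] by (simp add: Euc2_mult)
  have U_plus: "U (s + t) = U s + L s (U t)" and L_plus: "L (s + t) z = L s (L t z)" for s t z
    using mult[OF tc[of s] tc[of t]]
    by (simp_all add: Gam_mult_translation U_def L_def matrix_vector_mul_assoc)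
  have L_form: "\<exists>u. norm u = 1 \<and> ((\<forall>z. L t z = u * z) \<or> (\<forall>z. L t z = u * cnj z))" for t
  proof -
    have "orthogonal_matrix (snd (P (t, 0)))"
      using hom_in_carrier[OF hom tc[of t]] by (simp add: Euc2_carrier)
    from orthogonal_matrix_cx[OF this] show ?thesis
      unfolding L_def by (metis cx_cv)
  qed
  have norm_L: "norm (L t z) = norm z" for t z
    using L_form[of t] by (auto simp: norm_mult)
  have unbounded: False if j: "inj j" and b: "\<And>n. norm (U (j n)) \<le> R" for j :: "int \<Rightarrow> int \<times> int" and R
  proof -
    have "(\<lambda>n. (j n, 0)) ` UNIV \<subseteq> {g \<in> carrier (Gam k). norm (fst (P g)) \<le> R}"
      using b tc norm_cx by (auto simp: U_def)
    then have "finite (range (\<lambda>n. (j n, 0 :: nat)))"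
      using Rep_bounded_finite[OF k P] finite_subset by blast
    moreover have "inj (\<lambda>n. (j n, 0 :: nat))" using j by (auto simp: inj_def)
    ultimately show False using infinite_UNIV_int finite_imageD by blast
  qed
  have no_rotation: "u = 1" if u: "\<And>z. L t z = u * z" for t u
  proof (rule ccontr)
    assume "u \<noteq> 1"
    then have u1: "1 - u \<noteq> 0" by simp
    define x where "x = U t / (1 - u)"
    have fix_iff: "U t + u * y = y \<longleftrightarrow> y = x" for y
      using u1 by (auto simp: x_def field_simps)
    \<comment> \<open>Translations commute, so the image of \<open>x\<close> under
      \<open>P s\<close> is again fixed by \<open>P t\<close> and therefore equals
      \<open>x\<close>.\<close>
    have fixed: "U s + L s x = x" for s
    proof -
      have "U t + u * (U s + L s x) = U t + L t (U s) + L t (L s x)"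
        by (simp add: u algebra_simps)
      also have "\<dots> = U (s + t) + L (s + t) x"
        by (simp add: U_plus[of t s, symmetric] L_plus[of t s, symmetric] add.commute)
      also have "\<dots> = U s + L s (U t + L t x)"
        by (simp add: U_plus L_plus L_add)
      also have "U t + L t x = x"
        using fix_iff[of x] by (simp add: u)
      finally show ?thesis using fix_iff by blast
    qed
    have "norm (U s) \<le> 2 * norm x" for s
    proof -
      have "U s = x - L s x" using fixed[of s] by (simp add: eq_diff_eq)
      then show ?thesis using norm_triangle_ineq4[of x "L s x"] by (simp add: norm_L)
    qed
    then show False using unbounded[of "\<lambda>n. (n, 0)" "2 * norm x"] by (simp add: inj_def)
  qed
  have no_reflection: False if u: "norm u = 1" "\<And>z. L t z = u * cnj z" for t u
  proof -
    \<comment> \<open>Squares are pure translations: rotations are already excluded, and a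
      reflection squares to the identity.\<close>
    have L_sq: "L (s + s) z = z" for s z
    proof -
      obtain w where w: "norm w = 1" "(\<forall>z. L s z = w * z) \<or> (\<forall>z. L s z = w * cnj z)"
        using L_form by blast
      from w(2) show ?thesis
      proof
        assume *: "\<forall>z. L s z = w * z"
        then show ?thesis using no_rotation[of s w] by (simp add: L_plus)
      next
        assume "\<forall>z. L s z = w * cnj z"
        moreover have "w * cnj w = 1" using w(1) by (simp add: complex_norm_square[symmetric])
        ultimately show ?thesis by (simp add: L_plus flip: mult.assoc)
      qed
    qed
    define c where "c s = U (s + s)" for s
    have c_add: "c (s + s') = c s + c s'" for s s'
    proof -
      have "c (s + s') = U ((s + s) + (s' + s'))" by (simp add: c_def ac_simps)
      also have "\<dots> = c s + L (s + s) (c s')" by (simp only: U_plus[of "s + s"] c_def)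
      finally show ?thesis by (simp add: L_sq)
    qed
    \<comment> \<open>Commuting with the glide reflection \<open>P t\<close> confines
      \<open>c s\<close> to the line fixed by its linear part.\<close>
    have c_line: "u * cnj (c s) = c s" for s
    proof -
      have "U t + L t (c s) = U ((s + s) + t)"
        by (simp add: c_def U_plus[of t "s + s", symmetric] add.commute)
      also have "\<dots> = c s + U t" by (simp only: U_plus[of "s + s"] L_sq c_def)
      finally show ?thesis by (simp add: u)
    qed
    define p q where "p = c (1, 0)" "q = c (0, 1)"
    have c_lat: "c s = lat p q s" for s
      unfolding p_q_def by (rule int_pair_additive) (rule c_add)
    show False
    proof (cases "q = 0")
      case True
      have "norm (U ((0, n) + (0, n))) \<le> 0" for n
        using c_lat[of "(0, n)"] True by (simp add: c_def lat_def)
      then show False using unbounded[of "\<lambda>n. (0, n) + (0, n)" 0] by (simp add: inj_def)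
    next
      case False
      define b where "b = Re (p / q)"
      have u0: "u \<noteq> 0" using u(1) by auto
      have "cnj (p / q) = (u * cnj p) / (u * cnj q)" using u0 by simp
      also have "\<dots> = p / q" using c_line by (simp add: p_q_def)
      finally have "p / q = of_real b"
        unfolding b_def by (metis Reals_cnj_iff of_real_Re)
      then have pq: "p = of_real b * q" using False by (simp add: field_simps)
      \<comment> \<open>Since \<open>p\<close> is a real multiple of \<open>q\<close>, the vector
        \<open>n\<close> times \<open>p\<close> can be cancelled by multiples of \<open>q\<close> up
        to a fractional part: infinitely many elements with bounded translation vectors.\<close>
      let ?j = "\<lambda>n. (n, - \<lfloor>of_int n * b\<rfloor>)"
      have bound: "norm (U (?j n + ?j n)) \<le> norm q" for n
      proof -
        have "U (?j n + ?j n) = of_real (of_int n * b - of_int \<lfloor>of_int n * b\<rfloor>) * q"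
          using c_lat[of "?j n"] by (simp add: c_def lat_def pq algebra_simps)
        moreover have "\<bar>of_int n * b - of_int \<lfloor>of_int n * b\<rfloor>\<bar> \<le> 1" by linarith
        ultimately show ?thesis
          by (simp only: norm_mult norm_of_real) (simp add: mult_left_le_one_le)
      qed
      have "inj (\<lambda>n. ?j n + ?j n)" by (simp add: inj_def)
      from unbounded[OF this bound] show False .
    qed
  qed
  have L_id: "L t z = z" for t z
    using L_form[of t] no_rotation[of t] no_reflection[of _ t] by fastforce
  have snd_P: "snd (P (t, 0)) = mat 1" for t
  proof (rule matrix_eq_cx)
    fix v
    have "cx (snd (P (t, 0)) *v cv (cx v)) = cx v" using L_id[of t "cx v"] unfolding L_def .
    then show "cx (snd (P (t, 0)) *v v) = cx (mat 1 *v v)" by simp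
  qed
  define v1 v2 where "v1 = U (1, 0)" "v2 = U (0, 1)"
  have U_lat: "U t = lat v1 v2 t" for t
    unfolding v1_v2_def by (rule int_pair_additive) (simp add: U_plus L_id)
  have form: "P (t, 0) = (cv (lat v1 v2 t), mat 1)" for t
    using U_lat[of t] snd_P[of t] by (simp add: U_def prod_eq_iff) (metis cv_cx)
  have v1: "v1 \<noteq> 0"
  proof
    assume "v1 = 0"
    then have "P ((1, 0), 0) = P ((0, 0), 0)" by (simp add: form lat_def)
    then show False using inj_onD[OF inj _ tc tc, of "(1, 0)" "(0, 0)"] by simp
  qed
  have v2: "v2 = zeta k * v1 \<or> v2 = cnj (zeta k) * v1" if k3: "3 \<le> k"
  proof -
    have k': "k = 3 \<or> k = 4 \<or> k = 6" using k k3 by auto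
    let ?r = "((0, 0), 1) :: gam"
    have rc: "?r \<in> carrier (Gam k)" using k3 by (simp add: Gam_carrier)
    obtain u where u: "norm u = 1" "(\<forall>v. cx (snd (P ?r) *v v) = u * cx v) \<or>
        (\<forall>v. cx (snd (P ?r) *v v) = u * cnj (cx v))"
      using orthogonal_matrix_cx hom_in_carrier[OF hom rc] unfolding Euc2_carrier by blast
    have conj: "cx (snd (P ?r) *v cv (U t)) = U (lattice_rot k t)" for t
    proof -
      have "?r \<otimes>\<^bsub>Gam k\<^esub> (t, 0) = (lattice_rot k t, 0) \<otimes>\<^bsub>Gam k\<^esub> ?r"
        using k3 by (simp add: Gam_mult)
      then have "fst (P (?r \<otimes>\<^bsub>Gam k\<^esub> (t, 0))) = fst (P ((lattice_rot k t, 0) \<otimes>\<^bsub>Gam k\<^esub> ?r))"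
        by simp
      then have "cx (fst (P ?r)) + cx (snd (P ?r) *v fst (P (t, 0))) =
          U (lattice_rot k t) + cx (fst (P ?r))"
        using mult[OF rc tc[of t]] mult[OF tc[of "lattice_rot k t"] rc]
        by (simp add: U_def snd_P flip: cx_simps(1))
      then show ?thesis by (simp add: U_def)
    qed
    \<comment> \<open>The trace of the matrix of \<open>lattice_rot k\<close>, whose determinant is
      1. That its modulus is below 2 excludes a reflection further down.\<close>
    define \<tau> :: real where "\<tau> = 2 * Re (zeta k)"
    have tau: "\<bar>\<tau>\<bar> < 2" using k' by (auto simp: \<tau>_def zeta_simps)
    have e2: "cx (snd (P ?r) *v cv v1) = v2"
      using conj[of "(1, 0)"] k' by (auto simp: v1_v2_def lattice_rot_def)
    have e3: "cx (snd (P ?r) *v cv v2) = - v1 + of_real \<tau> * v2"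
    proof -
      have "cx (snd (P ?r) *v cv v2) = lat v1 v2 (lattice_rot k (0, 1))"
        using conj[of "(0, 1)"] unfolding U_lat by (simp add: lat_def)
      then show ?thesis using k' by (auto simp: lattice_rot_def lat_def \<tau>_def zeta_simps)
    qed
    from u(2) show ?thesis
    proof
      assume rot: "\<forall>v. cx (snd (P ?r) *v v) = u * cx v"
      have v2: "v2 = u * v1" and "u * v2 = - v1 + of_real \<tau> * v2"
        using e2 e3 rot by simp_all
      then have "(u * u - of_real \<tau> * u + 1) * v1 = 0"
        by (simp add: algebra_simps)
      then have "u * u - of_real \<tau> * u + 1 = 0" using \<open>v1 \<noteq> 0\<close> by simp
      moreover have "(u - zeta k) * (u - cnj (zeta k)) = u * u - of_real \<tau> * u + 1"
      proof -
        have "zeta k + cnj (zeta k) = of_real \<tau>" by (simp add: \<tau>_def complex_add_cnj)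
        moreover have "zeta k * cnj (zeta k) = 1"
          by (simp add: zeta_def complex_norm_square[symmetric])
        moreover have "(u - zeta k) * (u - cnj (zeta k)) =
            u * u - (zeta k + cnj (zeta k)) * u + zeta k * cnj (zeta k)"
          by (simp add: algebra_simps)
        ultimately show ?thesis by simp
      qed
      \<comment> \<open>Both senses of rotation survive; this produces the two families for
        \<open>k\<close> at least 3.\<close>
      ultimately have "u = zeta k \<or> u = cnj (zeta k)" by auto
      then show ?thesis using v2 by auto
    next
      \<comment> \<open>A reflection would make \<open>v1\<close> and \<open>v2\<close> equally long
        and also give \<open>2 * v1 = of_real \<tau> * v2\<close>.\<close>
      assume refl: "\<forall>v. cx (snd (P ?r) *v v) = u * cnj (cx v)"
      have v2: "v2 = u * cnj v1" and e: "u * cnj v2 = - v1 + of_real \<tau> * v2"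
        using e2 e3 refl by simp_all
      have "u * cnj u = 1" using u(1) by (simp add: complex_norm_square[symmetric])
      then have "u * cnj v2 = v1" by (simp add: v2 flip: mult.assoc)
      then have "2 * v1 = of_real \<tau> * v2" using e by (simp add: algebra_simps)
      then have "norm (2 * v1) = norm (of_real \<tau> * v2)" by simp
      then have "2 * norm v1 = \<bar>\<tau>\<bar> * norm v1" by (simp add: norm_mult v2 u(1))
      then show ?thesis using tau \<open>v1 \<noteq> 0\<close> by simp
    qed
  qed
  show ?thesis by (rule that[OF form v1 v2])
qed

section \<open>Dimensions of the representation spaces\<close>

text \<open>Continuous injections in both directions suffice. By invariance of domain
  \<open>f \<circ> g\<close> is open, which makes \<open>g\<close> an embedding; a copy of a larger
  Euclidean space would be mapped by \<open>f\<close> onto an open set inside a proper coordinate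
  subspace, which is impossible.\<close>

lemma top_dim_eqI:
  assumes f: "continuous_map X (Euclidean_space d) f" "inj_on f (topspace X)"
    and g: "continuous_map (Euclidean_space d) X g" "inj_on g (topspace (Euclidean_space d))"
  shows "top_dim X = d"
  unfolding top_dim_def
proof (rule Greatest_equality)
  let ?E = "Euclidean_space d"
  let ?S = "g ` topspace ?E"
  have S: "?S \<subseteq> topspace X" using continuous_map_image_subset_topspace[OF g(1)] .
  have "homeomorphic_map ?E (subtopology X ?S) g"
  proof (rule bijective_open_imp_homeomorphic_map)
    show "continuous_map ?E (subtopology X ?S) g"
      using g(1) by (simp add: continuous_map_in_subtopology)
    show "g ` topspace ?E = topspace (subtopology X ?S)"
      using S by auto
    show "open_map ?E (subtopology X ?S) g"
      unfolding open_map_def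
    proof (intro allI impI)
      fix W assume W: "openin ?E W"
      then have WE: "W \<subseteq> topspace ?E" by (rule openin_subset)
      have cont: "continuous_map ?E ?E (f \<circ> g)" by (rule continuous_map_compose[OF g(1) f(1)])
      have inj: "inj_on (f \<circ> g) (topspace ?E)"
        by (rule comp_inj_on[OF g(2) inj_on_subset[OF f(2) S]])
      have "openin ?E ((f \<circ> g) ` W)"
        using W cont inj WE
        by (intro invariance_of_domain_Euclidean_space continuous_map_from_subtopology)
          (auto intro: inj_on_subset)
      then have "openin X {x \<in> topspace X. f x \<in> (f \<circ> g) ` W}"
        using f(1) by (rule openin_continuous_map_preimage[rotated])
      moreover have "g ` W = {x \<in> topspace X. f x \<in> (f \<circ> g) ` W} \<inter> ?S"
        using WE S f(2) by (auto dest!: inj_onD[OF f(2)])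
      ultimately show "openin (subtopology X ?S) (g ` W)"
        unfolding openin_subtopology by blast
    qed
  qed (rule g(2))
  then have "subtopology X ?S homeomorphic_space ?E"
    using homeomorphic_map_imp_homeomorphic_space homeomorphic_space_sym by blast
  then show "\<exists>S\<subseteq>topspace X. subtopology X S homeomorphic_space Euclidean_space d"
    using S by blast
next
  fix e assume "\<exists>S\<subseteq>topspace X. subtopology X S homeomorphic_space Euclidean_space e"
  then obtain S where S: "S \<subseteq> topspace X" "Euclidean_space e homeomorphic_space subtopology X S"
    using homeomorphic_space_sym by blast
  then obtain r where r: "homeomorphic_map (Euclidean_space e) (subtopology X S) r"
    unfolding homeomorphic_space by blast
  show "e \<le> d"
  proof (rule ccontr)
    assume "\<not> e \<le> d"
    then have de: "d < e" by simp
    let ?E = "Euclidean_space e" and ?h = "f \<circ> r"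
    have r': "continuous_map ?E X r" "inj_on r (topspace ?E)" "r ` topspace ?E \<subseteq> topspace X"
      using homeomorphic_imp_continuous_map[OF r] homeomorphic_imp_injective_map[OF r]
        homeomorphic_imp_surjective_map[OF r]
      by (auto simp: continuous_map_in_subtopology)
    have hd: "continuous_map ?E (Euclidean_space d) ?h"
      by (rule continuous_map_compose[OF r'(1) f(1)])
    then have range: "?h ` topspace ?E \<subseteq> topspace (Euclidean_space d)"
      by (rule continuous_map_image_subset_topspace)
    have "continuous_map ?E (powertop_real UNIV) ?h"
      using hd unfolding Euclidean_space_def[of d] by (simp add: continuous_map_in_subtopology)
    moreover have "?h \<in> topspace ?E \<rightarrow> {x. \<forall>i\<ge>e. x i = 0}"
    proof
      fix x assume "x \<in> topspace ?E"
      then have "?h x \<in> topspace (Euclidean_space d)" using range by blast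
      then show "?h x \<in> {x. \<forall>i\<ge>e. x i = 0}" using de by (simp add: topspace_Euclidean_space)
    qed
    ultimately have "continuous_map ?E (subtopology (powertop_real UNIV) {x. \<forall>i\<ge>e. x i = 0}) ?h"
      unfolding continuous_map_in_subtopology by blast
    then have "continuous_map ?E ?E ?h"
      unfolding Euclidean_space_def[symmetric] .
    moreover have "inj_on ?h (topspace ?E)"
      by (rule comp_inj_on[OF r'(2) inj_on_subset[OF f(2) r'(3)]])
    ultimately have op: "openin ?E (?h ` topspace ?E)"
      by (intro invariance_of_domain_Euclidean_space) auto
    have "(\<lambda>_. 0) \<in> topspace ?E" by (simp add: topspace_Euclidean_space)
    then obtain y where y: "y \<in> ?h ` topspace ?E" by blast
    \<comment> \<open>The line through \<open>y\<close> in the coordinate \<open>d\<close>. It meets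
      the image at parameter 0 only, although the image is open.\<close>
    let ?l = "\<lambda>t i. if i < e then (if i = d then t else y i) else (0::real)"
    have "continuous_map euclideanreal ?E ?l"
      unfolding continuous_map_componentwise_Euclidean_space by auto
    from openin_continuous_map_preimage[OF this op]
    have "open {t. ?l t \<in> ?h ` topspace ?E}" by simp
    moreover have "{t. ?l t \<in> ?h ` topspace ?E} = {0}"
    proof (intro equalityI subsetI)
      fix t assume "t \<in> {t. ?l t \<in> ?h ` topspace ?E}"
      then have "?l t \<in> topspace (Euclidean_space d)" using range by blast
      then have "?l t d = 0" unfolding topspace_Euclidean_space by blast
      then show "t \<in> {0}" using de by simp
    next
      fix t :: real assume "t \<in> {0}"
      moreover have "y \<in> topspace (Euclidean_space d)" using y range by blast
      ultimately have "?l t = y" using de by (auto simp: topspace_Euclidean_space fun_eq_iff)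
      then show "t \<in> {t. ?l t \<in> ?h ` topspace ?E}" using y by simp
    qed
    ultimately show False using not_open_singleton[of "0::real"] by simp
  qed
qed

section \<open>The topology of the spaces of homomorphisms\<close>

definition hom_space :: "nat \<Rightarrow> gam set \<Rightarrow> (gam \<Rightarrow> euc) topology" where
  "hom_space k H = subtopology (product_topology (\<lambda>_. euclidean) H) (extendable_homs k H)"

definition lat_hom :: "gam set \<Rightarrow> complex \<Rightarrow> complex \<Rightarrow> gam \<Rightarrow> euc" where
  "lat_hom H v1 v2 = (\<lambda>h\<in>H. (cv (lat v1 v2 (fst h)), mat 1))"

lemma topspace_hom_space: "topspace (hom_space k H) = extendable_homs k H"
  by (auto simp: hom_space_def extendable_homs_def PiE_def)

lemma translation_part_iff: "0 < k \<Longrightarrow> h \<in> translation_part k \<longleftrightarrow> snd h = 0"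
  by (auto simp: translation_part_def Gam_carrier)

lemma cx_lat_hom: "(t, r) \<in> H \<Longrightarrow> cx (fst (lat_hom H v1 v2 (t, r))) = lat v1 v2 t"
  by (simp add: lat_hom_def)

lemma extendable_form:
  assumes "gam_index k" "H \<subseteq> translation_part k" "f \<in> extendable_homs k H"
  obtains v1 v2 where "f = lat_hom H v1 v2" "v1 \<noteq> 0"
    "3 \<le> k \<Longrightarrow> v2 = zeta k * v1 \<or> v2 = cnj (zeta k) * v1"
proof -
  have k0: "0 < k" using assms by auto
  obtain P where P: "P \<in> Rep k" "\<forall>x\<in>H. P x = f x"
    using assms(3) by (auto simp: extendable_homs_def)
  obtain v1 v2 where v: "\<And>t. P (t, 0) = (cv (lat v1 v2 t), mat 1)" "v1 \<noteq> 0"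
    "3 \<le> k \<Longrightarrow> v2 = zeta k * v1 \<or> v2 = cnj (zeta k) * v1"
    using Rep_form[OF assms(1) P(1)] by blast
  have "f = lat_hom H v1 v2"
  proof (rule extensionalityI[of _ H])
    show "f \<in> extensional H" using assms(3) by (simp add: extendable_homs_def)
    show "lat_hom H v1 v2 \<in> extensional H" by (simp add: lat_hom_def)
    fix h assume h: "h \<in> H"
    then have "snd h = 0" using assms(2) translation_part_iff[OF k0] by blast
    then have "P h = (cv (lat v1 v2 (fst h)), mat 1)" using v(1)[of "fst h"] by (metis prod.collapse)
    then show "f h = lat_hom H v1 v2 h" using h P(2) by (simp add: lat_hom_def)
  qed
  then show ?thesis using that v by blast
qed

lemma extendable_lat_hom:
  assumes k: "gam_index k" and H: "subgroup H (Gam k)" "H \<subseteq> translation_part k"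
    and c: "compat k z (z * w)" "Im w \<noteq> 0" "z \<noteq> 0"
  shows "lat_hom H z (z * w) \<in> extendable_homs k H"
proof -
  have k0: "0 < k" using k by auto
  let ?P = "std_rep k z (z * w)"
  have P: "?P \<in> Rep k" by (rule std_rep_in_Rep[OF k c])
  have eq: "lat_hom H z (z * w) h = ?P h" if "h \<in> H" for h
    using that H(2) translation_part_iff[OF k0, of h] by (auto simp: lat_hom_def std_rep_def)
  have HG: "H \<subseteq> carrier (Gam k)" by (rule subgroup.subset[OF H(1)])
  have "lat_hom H z (z * w) \<in> hom ((Gam k)\<lparr>carrier := H\<rparr>) Euc2"
  proof (rule homI)
    fix g h assume gh: "g \<in> carrier ((Gam k)\<lparr>carrier := H\<rparr>)" "h \<in> carrier ((Gam k)\<lparr>carrier := H\<rparr>)"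
    then have gh': "g \<in> H" "h \<in> H" "g \<in> carrier (Gam k)" "h \<in> carrier (Gam k)" using HG by auto
    have hom: "?P \<in> hom (Gam k) Euc2" using P by (simp add: Rep_def)
    show "lat_hom H z (z * w) g \<in> carrier Euc2"
      using hom_in_carrier[OF hom gh'(3)] eq[OF gh'(1)] by simp
    show "lat_hom H z (z * w) (g \<otimes>\<^bsub>(Gam k)\<lparr>carrier := H\<rparr>\<^esub> h) = lat_hom H z (z * w) g \<otimes>\<^bsub>Euc2\<^esub> lat_hom H z (z * w) h"
      using hom_mult[OF hom gh'(3,4)] eq gh' subgroup.m_closed[OF H(1) gh'(1,2)] by simp
  qed
  then show ?thesis
    using P eq unfolding extendable_homs_def
    by (auto simp: lat_hom_def intro!: bexI[of _ ?P])
qed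

lemma continuous_map_hom_space:
  assumes "h \<in> H"
  shows "continuous_map (hom_space k H) euclideanreal (\<lambda>f. Re (cx (fst (f h))))"
    "continuous_map (hom_space k H) euclideanreal (\<lambda>f. Im (cx (fst (f h))))"
proof -
  have c: "continuous_map (hom_space k H) euclidean (\<lambda>f. f h)"
    unfolding hom_space_def
    by (intro continuous_map_from_subtopology continuous_map_product_projection assms)
  have "continuous_map euclidean euclideanreal (\<lambda>p :: euc. Re (cx (fst p)))"
    "continuous_map euclidean euclideanreal (\<lambda>p :: euc. Im (cx (fst p)))"
    unfolding cx_def continuous_map_iff_continuous2 complex.sel
    by (intro continuous_intros)+
  from this[THEN continuous_map_compose[OF c]] show
    "continuous_map (hom_space k H) euclideanreal (\<lambda>f. Re (cx (fst (f h))))"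
    "continuous_map (hom_space k H) euclideanreal (\<lambda>f. Im (cx (fst (f h))))"
    by (simp_all add: o_def)
qed

text \<open>A continuous injective parametrization of the right half-plane by two real coordinates;
  it avoids 0, as a faithful representation requires of its first lattice vector.\<close>

definition pnt :: "(nat \<Rightarrow> real) \<Rightarrow> complex" where
  "pnt x = of_real (exp (x 0)) + \<i> * of_real (x 1)"

lemma pnt_nonzero: "pnt x \<noteq> 0"
  by (simp add: pnt_def complex_eq_iff)

lemma pnt_inj: "pnt x = pnt y \<Longrightarrow> x 0 = y 0 \<and> x 1 = y 1"
  by (simp add: pnt_def complex_eq_iff)

lemma continuous_on_cv: "continuous_on S f \<Longrightarrow> continuous_on S (\<lambda>x. cv (f x))"
proof -
  have "cv z = Re z *\<^sub>R axis 1 1 + Im z *\<^sub>R axis 2 1" for z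
    by (simp add: cv_def vec_eq_iff forall_2 axis_def)
  then show "continuous_on S f \<Longrightarrow> continuous_on S (\<lambda>x. cv (f x))"
    by (auto intro!: continuous_intros)
qed

lemma continuous_on_coordinate: "continuous_on S (\<lambda>x :: nat \<Rightarrow> real. x i)"
  by (rule continuous_on_subset[OF continuous_on_product_coordinates]) simp

lemma continuous_map_lat_hom:
  assumes k: "gam_index k" and H: "subgroup H (Gam k)" "H \<subseteq> translation_part k"
    and c: "\<And>x. compat k (pnt x) (pnt x * w x)" "\<And>x. Im (w x) \<noteq> 0"
    and w: "\<And>S. continuous_on S w"
  shows "continuous_map (Euclidean_space d) (hom_space k H) (\<lambda>x. lat_hom H (pnt x) (pnt x * w x))"
  unfolding hom_space_def continuous_map_in_subtopology
proof
  show "continuous_map (Euclidean_space d) (product_topology (\<lambda>_. euclidean) H) (\<lambda>x. lat_hom H (pnt x) (pnt x * w x))"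
    unfolding continuous_map_componentwise
  proof (intro conjI ballI)
    fix h assume h: "h \<in> H"
    have "continuous_on (topspace (Euclidean_space d)) (\<lambda>x. (cv (lat (pnt x) (pnt x * w x) (fst h)), mat 1) :: euc)"
      unfolding lat_def pnt_def
      by (intro continuous_on_Pair continuous_on_cv continuous_intros continuous_on_coordinate w)
    then show "continuous_map (Euclidean_space d) euclidean (\<lambda>x. lat_hom H (pnt x) (pnt x * w x) h)"
      using h by (simp add: lat_hom_def continuous_map_Euclidean_space_iff)
  qed (auto simp: lat_hom_def)
  show "(\<lambda>x. lat_hom H (pnt x) (pnt x * w x)) \<in> topspace (Euclidean_space d) \<rightarrow> extendable_homs k H"
    using extendable_lat_hom[OF k H c pnt_nonzero] by blast
qed

text \<open>Cramer's rule, with the determinant of \<open>ta\<close> and \<open>tb\<close> kept as a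
  factor so that all coefficients stay integral.\<close>

lemma lat_determined:
  assumes D: "fst ta * snd tb \<noteq> snd ta * fst tb"
    and "lat v1 v2 ta = lat w1 w2 ta" "lat v1 v2 tb = lat w1 w2 tb"
  shows "lat v1 v2 t = lat w1 w2 t"
proof -
  have *: "of_int (fst ta * snd tb - snd ta * fst tb) * lat u1 u2 t =
      of_int (fst t * snd tb - snd t * fst tb) * lat u1 u2 ta +
      of_int (fst ta * snd t - snd ta * fst t) * lat u1 u2 tb" for u1 u2
    by (simp add: lat_def algebra_simps)
  have "of_int (fst ta * snd tb - snd ta * fst tb) * lat v1 v2 t =
      of_int (fst ta * snd tb - snd ta * fst tb) * lat w1 w2 t"
    unfolding * assms(2,3) ..
  moreover have "of_int (fst ta * snd tb - snd ta * fst tb) \<noteq> (0 :: complex)"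
    using D unfolding of_int_eq_0_iff by simp
  ultimately show ?thesis by (metis mult_left_cancel)
qed

lemma lat_determined_parallel:
  assumes "ta \<noteq> (0, 0)" "fst t * snd ta = snd t * fst ta" "lat v1 v2 ta = lat w1 w2 ta"
  shows "lat v1 v2 t = lat w1 w2 t"
proof -
  have par: "of_int (fst t) * of_int (snd ta) = (of_int (snd t) * of_int (fst ta) :: complex)"
    using assms(2) by (metis of_int_mult)
  have 1: "of_int (fst ta) * lat u1 u2 t = of_int (fst t) * lat u1 u2 ta" for u1 u2
  proof -
    have "of_int (fst ta) * lat u1 u2 t =
        of_int (fst t) * of_int (fst ta) * u1 + (of_int (snd t) * of_int (fst ta)) * u2"
      by (simp add: lat_def algebra_simps)
    then show ?thesis unfolding par[symmetric] by (simp add: lat_def algebra_simps)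
  qed
  have 2: "of_int (snd ta) * lat u1 u2 t = of_int (snd t) * lat u1 u2 ta" for u1 u2
  proof -
    have "of_int (snd ta) * lat u1 u2 t =
        (of_int (fst t) * of_int (snd ta)) * u1 + of_int (snd t) * of_int (snd ta) * u2"
      by (simp add: lat_def algebra_simps)
    then show ?thesis unfolding par by (simp add: lat_def algebra_simps)
  qed
  have "of_int (fst ta) \<noteq> (0 :: complex) \<or> of_int (snd ta) \<noteq> (0 :: complex)"
    using assms(1) by (auto simp: prod_eq_iff)
  then show ?thesis
    using 1[of v1 v2] 1[of w1 w2] 2[of v1 v2] 2[of w1 w2] assms(3) by (metis mult_left_cancel)
qed

lemma hom_space_eqI:
  assumes k: "gam_index k" and H: "H \<subseteq> translation_part k"
    and "\<And>t. (t, 0) \<in> H \<Longrightarrow> lat v1 v2 t = lat w1 w2 t"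
  shows "lat_hom H v1 v2 = lat_hom H w1 w2"
proof -
  have k0: "0 < k" using k by auto
  have "lat v1 v2 (fst h) = lat w1 w2 (fst h)" if "h \<in> H" for h
    using assms(3)[of "fst h"] that H translation_part_iff[OF k0, of h] by (metis prod.collapse subsetD)
  then show ?thesis by (auto simp: lat_hom_def restrict_def)
qed

text \<open>The space of homomorphisms is a single point.\<close>

lemma rep_trivial:
  assumes k: "gam_index k" and H: "H = {\<one>\<^bsub>Gam k\<^esub>}"
  shows "rep k H = 0"
proof -
  have k0: "0 < k" using k by auto
  have sub: "subgroup H (Gam k)" using group.triv_subgroup[OF group_Gam[OF k]] H by simp
  have tr: "H \<subseteq> translation_part k" using k0 H by (simp add: translation_part_iff Gam_one)
  have one: "f = lat_hom H 1 (xi k)" if f: "f \<in> extendable_homs k H" for f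
  proof -
    obtain v1 v2 where v: "f = lat_hom H v1 v2" "v1 \<noteq> 0"
      "3 \<le> k \<Longrightarrow> v2 = zeta k * v1 \<or> v2 = cnj (zeta k) * v1"
      using extendable_form[OF k tr f] by blast
    show ?thesis unfolding v(1)
      by (rule hom_space_eqI[OF k tr]) (auto simp: H Gam_one lat_def)
  qed
  have "top_dim (hom_space k H) = 0"
  proof (rule top_dim_eqI)
    show "continuous_map (hom_space k H) (Euclidean_space 0) (\<lambda>f i. if i < 0 then 0 else 0)"
      unfolding continuous_map_componentwise_Euclidean_space by simp
    show "inj_on (\<lambda>f i. if i < (0::nat) then 0 else (0::real)) (topspace (hom_space k H))"
      unfolding topspace_hom_space by (rule inj_onI) (metis one)
    show "continuous_map (Euclidean_space 0) (hom_space k H) (\<lambda>x. lat_hom H (pnt x) (pnt x * xi k))"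
      by (rule continuous_map_lat_hom[OF k sub tr]) (use Im_xi[OF k] in \<open>auto simp: compat_xi\<close>)
    show "inj_on (\<lambda>x. lat_hom H (pnt x) (pnt x * xi k)) (topspace (Euclidean_space 0))"
      by (auto simp: topspace_Euclidean_space inj_on_def fun_eq_iff)
  qed
  then show ?thesis by (simp add: rep_def hom_space_def)
qed

text \<open>The value at \<open>ta\<close> determines the homomorphism, on parallel translations
  completely and for \<open>k\<close> at least 3 up to the choice between \<open>zeta k\<close> and
  its conjugate. So two real parameters remain.\<close>

lemma rep_two:
  assumes k: "gam_index k" and H: "subgroup H (Gam k)" "H \<subseteq> translation_part k"
    and ta: "(ta, 0) \<in> H" "ta \<noteq> (0, 0)"
    and par: "3 \<le> k \<or> (\<forall>t. (t, 0) \<in> H \<longrightarrow> fst t * snd ta = snd t * fst ta)"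
  shows "rep k H = 2"
proof -
  \<comment> \<open>The factor \<open>s\<close> is 1 or a sign that separates the two senses of
    rotation. As the exponential is positive, the two families land in opposite half-planes, which
    gives a single injection into the plane.\<close>
  have F: "\<exists>s. continuous_map (hom_space k H) euclideanreal s \<and>
    inj_on (\<lambda>f. (s f * exp (Re (cx (fst (f (ta, 0))))), Im (cx (fst (f (ta, 0)))))) (topspace (hom_space k H))"
  proof (cases "\<forall>t. (t, 0) \<in> H \<longrightarrow> fst t * snd ta = snd t * fst ta")
    case True
    show ?thesis
    proof (intro exI[of _ "\<lambda>_. 1"] conjI inj_onI)
      fix f g assume fg: "f \<in> topspace (hom_space k H)" "g \<in> topspace (hom_space k H)"
        "(1 * exp (Re (cx (fst (f (ta, 0))))), Im (cx (fst (f (ta, 0))))) =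
         (1 * exp (Re (cx (fst (g (ta, 0))))), Im (cx (fst (g (ta, 0)))))"
      obtain v1 v2 w1 w2 where f: "f = lat_hom H v1 v2" and g: "g = lat_hom H w1 w2"
        using extendable_form[OF k H(2)] fg(1,2) unfolding topspace_hom_space by metis
      have e: "lat v1 v2 ta = lat w1 w2 ta"
        using fg(3) ta by (simp add: f g cx_lat_hom complex_eq_iff)
      show "f = g"
        unfolding f g
      proof (rule hom_space_eqI[OF k H(2)])
        fix t assume "(t, 0) \<in> H"
        then have "fst t * snd ta = snd t * fst ta" using True by blast
        from lat_determined_parallel[OF ta(2) this e] show "lat v1 v2 t = lat w1 w2 t" .
      qed
    qed simp
  next
    case False
    then have k3: "3 \<le> k" using par by blast
    then have Imz: "Im (zeta k) \<noteq> 0" using Im_xi[OF k] by (simp add: xi_def)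
    obtain tb where tb: "(tb, 0) \<in> H" "fst tb * snd ta \<noteq> snd tb * fst ta" using False by blast
    define D where "D = real_of_int (fst ta * snd tb - snd ta * fst tb)"
    have D: "D \<noteq> 0" using tb(2) unfolding D_def of_int_eq_0_iff by (simp add: mult.commute)
    \<comment> \<open>The oriented area spanned by the images of \<open>ta\<close> and
      \<open>tb\<close>. It never vanishes, and its sign tells \<open>zeta k\<close> from its
      conjugate.\<close>
    define s where "s f = Im (cx (fst (f (tb, 0))) * cnj (cx (fst (f (ta, 0)))))" for f :: "gam \<Rightarrow> euc"
    have form: "\<exists>v1 \<epsilon>. v1 \<noteq> 0 \<and> \<bar>\<epsilon>\<bar> = 1 \<and>
        f = lat_hom H v1 (Complex (Re (zeta k)) (\<epsilon> * Im (zeta k)) * v1) \<and>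
        s f = (norm v1)\<^sup>2 * Im (zeta k) * D * \<epsilon>"
      if f: "f \<in> topspace (hom_space k H)" for f
    proof -
      obtain v1 v2 where v: "f = lat_hom H v1 v2" "v1 \<noteq> 0"
        "3 \<le> k \<Longrightarrow> v2 = zeta k * v1 \<or> v2 = cnj (zeta k) * v1"
        using extendable_form[OF k H(2)] f unfolding topspace_hom_space by blast
      have "\<exists>\<epsilon>. \<bar>\<epsilon>\<bar> = 1 \<and> v2 = Complex (Re (zeta k)) (\<epsilon> * Im (zeta k)) * v1"
        using v(3)[OF k3]
      proof
        assume "v2 = zeta k * v1"
        then show ?thesis by (intro exI[of _ 1]) simp
      next
        assume "v2 = cnj (zeta k) * v1"
        then show ?thesis by (intro exI[of _ "-1"]) (simp add: complex_eq_iff)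
      qed
      then obtain \<epsilon> where e: "\<bar>\<epsilon>\<bar> = 1" "v2 = Complex (Re (zeta k)) (\<epsilon> * Im (zeta k)) * v1" by blast
      let ?o = "Complex (Re (zeta k)) (\<epsilon> * Im (zeta k))"
      have l: "lat v1 v2 t = v1 * (of_int (fst t) + of_int (snd t) * ?o)" for t
        by (simp add: lat_def e(2) algebra_simps)
      have "s f = Im ((v1 * cnj v1) * ((of_int (fst tb) + of_int (snd tb) * ?o) *
          cnj (of_int (fst ta) + of_int (snd ta) * ?o)))"
        using ta tb by (simp add: s_def v(1) cx_lat_hom l algebra_simps)
      also have "\<dots> = (norm v1)\<^sup>2 * Im ((of_int (fst tb) + of_int (snd tb) * ?o) *
          cnj (of_int (fst ta) + of_int (snd ta) * ?o))"
        unfolding complex_norm_square[symmetric] by simp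
      also have "\<dots> = (norm v1)\<^sup>2 * Im (zeta k) * D * \<epsilon>"
        by (simp add: D_def algebra_simps)
      finally have sf: "s f = (norm v1)\<^sup>2 * Im (zeta k) * D * \<epsilon>" .
      show ?thesis
      proof (intro exI conjI)
        show "f = lat_hom H v1 (?o * v1)" using v(1) e(2) by simp
      qed (rule v(2) e(1) sf)+
    qed
    have s0: "s f \<noteq> 0" if "f \<in> topspace (hom_space k H)" for f
      using form[OF that] Imz D by auto
    show ?thesis
    proof (intro exI[of _ "\<lambda>f. s f / \<bar>s f\<bar>"] conjI inj_onI)
      show "continuous_map (hom_space k H) euclideanreal (\<lambda>f. s f / \<bar>s f\<bar>)"
        using s0 unfolding s_def times_complex.sel
        by (auto intro!: continuous_intros continuous_map_hom_space ta(1) tb(1))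
      fix f g assume fg: "f \<in> topspace (hom_space k H)" "g \<in> topspace (hom_space k H)"
        "(s f / \<bar>s f\<bar> * exp (Re (cx (fst (f (ta, 0))))), Im (cx (fst (f (ta, 0))))) =
         (s g / \<bar>s g\<bar> * exp (Re (cx (fst (g (ta, 0))))), Im (cx (fst (g (ta, 0)))))"
      then have e1: "s f / \<bar>s f\<bar> * exp (Re (cx (fst (f (ta, 0))))) = s g / \<bar>s g\<bar> * exp (Re (cx (fst (g (ta, 0)))))"
        and e2: "Im (cx (fst (f (ta, 0)))) = Im (cx (fst (g (ta, 0))))"
        by simp_all
      have sgn: "s f / \<bar>s f\<bar> = sgn (s f)" "s g / \<bar>s g\<bar> = sgn (s g)"
        by (simp_all add: sgn_real_def)
      have "sgn (s f / \<bar>s f\<bar> * exp (Re (cx (fst (f (ta, 0)))))) = sgn (s g / \<bar>s g\<bar> * exp (Re (cx (fst (g (ta, 0))))))"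
        using e1 by simp
      then have sg: "sgn (s f) = sgn (s g)"
        unfolding sgn by (simp add: sgn_mult)
      then have "exp (Re (cx (fst (f (ta, 0))))) = exp (Re (cx (fst (g (ta, 0)))))"
        using e1 s0[OF fg(2)] unfolding sgn by (simp add: sgn_zero_iff)
      then have u: "cx (fst (f (ta, 0))) = cx (fst (g (ta, 0)))"
        using e2 by (simp add: complex_eq_iff)
      obtain v \<epsilon> where f: "v \<noteq> 0" "\<bar>\<epsilon>\<bar> = 1" "f = lat_hom H v (Complex (Re (zeta k)) (\<epsilon> * Im (zeta k)) * v)"
        "s f = (norm v)\<^sup>2 * Im (zeta k) * D * \<epsilon>"
        using form[OF fg(1)] by blast
      obtain w \<delta> where g: "w \<noteq> 0" "\<bar>\<delta>\<bar> = 1" "g = lat_hom H w (Complex (Re (zeta k)) (\<delta> * Im (zeta k)) * w)"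
        "s g = (norm w)\<^sup>2 * Im (zeta k) * D * \<delta>"
        using form[OF fg(2)] by blast
      have "sgn \<epsilon> = sgn \<delta>"
        using sg f(1) g(1) Imz D unfolding f(4) g(4) by (simp add: sgn_mult sgn_zero_iff)
      then have "\<epsilon> = \<delta>" using f(2) g(2) by (auto simp: abs_if split: if_splits)
      let ?o = "Complex (Re (zeta k)) (\<epsilon> * Im (zeta k))"
      have l: "lat z (?o * z) t = z * (of_int (fst t) + of_int (snd t) * ?o)" for t z
        by (simp add: lat_def algebra_simps)
      have "Im ?o \<noteq> 0" using f(2) Imz by auto
      then have "lat 1 (1 * ?o) ta \<noteq> 0"
        using lat_xi_eq_0[of ?o 1 ta] ta(2) by auto
      then have o: "of_int (fst ta) + of_int (snd ta) * ?o \<noteq> 0" by (simp add: lat_def)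
      have "lat v (?o * v) ta = lat w (?o * w) ta"
        using u ta(1) by (simp add: f(3) g(3) cx_lat_hom \<open>\<epsilon> = \<delta>\<close>)
      then have "v = w" unfolding l using o by simp
      then show "f = g" by (simp add: f(3) g(3) \<open>\<epsilon> = \<delta>\<close>)
    qed
  qed
  then obtain s where s: "continuous_map (hom_space k H) euclideanreal s"
    "inj_on (\<lambda>f. (s f * exp (Re (cx (fst (f (ta, 0))))), Im (cx (fst (f (ta, 0)))))) (topspace (hom_space k H))"
    by blast
  let ?F = "\<lambda>f i. if i < (2::nat) then (if i = 0 then s f * exp (Re (cx (fst (f (ta, 0)))))
    else Im (cx (fst (f (ta, 0))))) else (0::real)"
  have "top_dim (hom_space k H) = 2"
  proof (rule top_dim_eqI)
    have exp: "continuous_map (hom_space k H) euclideanreal (\<lambda>f. exp (Re (cx (fst (f (ta, 0))))))"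
      using continuous_map_compose[OF continuous_map_hom_space(1)[OF ta(1)], of euclideanreal exp]
      by (simp add: o_def continuous_on_exp)
    show "continuous_map (hom_space k H) (Euclidean_space 2) ?F"
      unfolding continuous_map_componentwise_Euclidean_space
    proof (intro allI impI)
      fix i :: nat assume "i < 2"
      show "continuous_map (hom_space k H) euclideanreal (\<lambda>f. if i = 0 then s f * exp (Re (cx (fst (f (ta, 0)))))
          else Im (cx (fst (f (ta, 0)))))"
        by (cases "i = 0")
          (simp_all add: continuous_map_real_mult[OF s(1) exp] continuous_map_hom_space(2)[OF ta(1)])
    qed
    show "inj_on ?F (topspace (hom_space k H))"
    proof (rule inj_onI)
      fix f g assume fg: "f \<in> topspace (hom_space k H)" "g \<in> topspace (hom_space k H)" "?F f = ?F g"
      show "f = g"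
        using fun_cong[OF fg(3), of 0] fun_cong[OF fg(3), of 1] by (intro inj_onD[OF s(2) _ fg(1,2)]) simp
    qed
    \<comment> \<open>For the lower bound a single lattice shape, with ratio \<open>xi k\<close>, is
      enough; only the first vector varies.\<close>
    show "continuous_map (Euclidean_space 2) (hom_space k H) (\<lambda>x. lat_hom H (pnt x) (pnt x * xi k))"
      by (rule continuous_map_lat_hom[OF k H]) (use Im_xi[OF k] in \<open>auto simp: compat_xi\<close>)
    show "inj_on (\<lambda>x. lat_hom H (pnt x) (pnt x * xi k)) (topspace (Euclidean_space 2))"
    proof (rule inj_onI)
      fix x y assume xy: "x \<in> topspace (Euclidean_space 2)" "y \<in> topspace (Euclidean_space 2)"
        "lat_hom H (pnt x) (pnt x * xi k) = lat_hom H (pnt y) (pnt y * xi k)"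
      have "lat (pnt x) (pnt x * xi k) ta = lat (pnt y) (pnt y * xi k) ta"
        using arg_cong[OF xy(3), of "\<lambda>f. cx (fst (f (ta, 0)))"] ta(1) by (simp add: cx_lat_hom)
      then have "pnt x * lat 1 (1 * xi k) ta = pnt y * lat 1 (1 * xi k) ta"
        by (simp add: lat_def algebra_simps)
      moreover have "lat 1 (1 * xi k) ta \<noteq> 0"
        using lat_xi_eq_0[OF Im_xi[OF k], of 1 ta] ta(2) by auto
      ultimately have "pnt x = pnt y" by simp
      then have "x 0 = y 0" "x 1 = y 1" using pnt_inj by blast+
      then have "x i = y i" for i
        using xy(1,2) by (cases "i = 0 \<or> i = 1") (auto simp: topspace_Euclidean_space)
      then show "x = y" by blast
    qed
  qed
  then show ?thesis by (simp add: rep_def hom_space_def)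
qed

lemma rep_four:
  assumes k: "gam_index k" and H: "subgroup H (Gam k)" "H \<subseteq> translation_part k" and k2: "k \<le> 2"
    and t: "(ta, 0) \<in> H" "(tb, 0) \<in> H" "fst ta * snd tb \<noteq> snd ta * fst tb"
  shows "rep k H = 4"
proof -
  let ?F = "\<lambda>f i. if i < (4::nat) then (if i = 0 then Re (cx (fst (f (ta, 0))))
    else if i = 1 then Im (cx (fst (f (ta, 0))))
    else if i = 2 then Re (cx (fst (f (tb, 0)))) else Im (cx (fst (f (tb, 0))))) else (0::real)"
  \<comment> \<open>The ratio of the lattice vectors runs through the upper half-plane, so together
    with \<open>pnt\<close> all values of the four real parameters give a nondegenerate
    lattice.\<close>
  let ?w = "\<lambda>x. of_real (x (2::nat)) + \<i> * of_real (exp (x 3))"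
  have "top_dim (hom_space k H) = 4"
  proof (rule top_dim_eqI)
    show "continuous_map (hom_space k H) (Euclidean_space 4) ?F"
      unfolding continuous_map_componentwise_Euclidean_space
      by (simp add: continuous_map_hom_space t(1,2))
    show "inj_on ?F (topspace (hom_space k H))"
    proof (rule inj_onI)
      fix f g assume fg: "f \<in> topspace (hom_space k H)" "g \<in> topspace (hom_space k H)" "?F f = ?F g"
      obtain v1 v2 w1 w2 where f: "f = lat_hom H v1 v2" and g: "g = lat_hom H w1 w2"
        using extendable_form[OF k H(2)] fg(1,2) unfolding topspace_hom_space by metis
      have e: "lat v1 v2 ta = lat w1 w2 ta" "lat v1 v2 tb = lat w1 w2 tb"
        using fun_cong[OF fg(3), of 0] fun_cong[OF fg(3), of 1] fun_cong[OF fg(3), of 2]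
          fun_cong[OF fg(3), of 3] t(1,2)
        by (simp_all add: f g cx_lat_hom complex_eq_iff)
      show "f = g"
        unfolding f g by (rule hom_space_eqI[OF k H(2) lat_determined[OF t(3) e]])
    qed
    show "continuous_map (Euclidean_space 4) (hom_space k H) (\<lambda>x. lat_hom H (pnt x) (pnt x * ?w x))"
    proof (rule continuous_map_lat_hom[OF k H])
      show "compat k (pnt x) (pnt x * ?w x)" for x using k2 by (simp add: compat_def)
      show "Im (?w x) \<noteq> 0" for x by simp
      show "continuous_on S ?w" for S by (intro continuous_intros continuous_on_coordinate)
    qed
    show "inj_on (\<lambda>x. lat_hom H (pnt x) (pnt x * ?w x)) (topspace (Euclidean_space 4))"
    proof (rule inj_onI)
      fix x y assume xy: "x \<in> topspace (Euclidean_space 4)" "y \<in> topspace (Euclidean_space 4)"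
        "lat_hom H (pnt x) (pnt x * ?w x) = lat_hom H (pnt y) (pnt y * ?w y)"
      have e: "lat (pnt x) (pnt x * ?w x) t = lat (pnt y) (pnt y * ?w y) t" for t
      proof (rule lat_determined[OF t(3)])
        show "lat (pnt x) (pnt x * ?w x) ta = lat (pnt y) (pnt y * ?w y) ta"
          using arg_cong[OF xy(3), of "\<lambda>f. cx (fst (f (ta, 0)))"] unfolding cx_lat_hom[OF t(1)] .
        show "lat (pnt x) (pnt x * ?w x) tb = lat (pnt y) (pnt y * ?w y) tb"
          using arg_cong[OF xy(3), of "\<lambda>f. cx (fst (f (tb, 0)))"] unfolding cx_lat_hom[OF t(2)] .
      qed
      have pe: "pnt x = pnt y" using e[of "(1, 0)"] by (simp add: lat_def)
      moreover have "pnt x * ?w x = pnt y * ?w y" using e[of "(0, 1)"] by (simp add: lat_def)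
      ultimately have "?w x = ?w y" using pnt_nonzero[of y] by simp
      then have "x 2 = y 2" "x 3 = y 3" by (simp_all add: complex_eq_iff)
      moreover have "x 0 = y 0" "x 1 = y 1" using pnt_inj[OF pe] by blast+
      moreover have "x i = y i" if "4 \<le> i" for i
        using xy(1,2) that by (simp add: topspace_Euclidean_space)
      moreover have "i = 0 \<or> i = 1 \<or> i = 2 \<or> i = 3 \<or> 4 \<le> i" for i :: nat by linarith
      ultimately have "x i = y i" for i by metis
      then show "x = y" by blast
    qed
  qed
  then show ?thesis by (simp add: rep_def hom_space_def)
qed

section \<open>Representations that kill a group of translations\<close>

definition vec_index :: "nat \<Rightarrow> bool set" where
  "vec_index k = (if k \<le> 2 then UNIV else {False})"

text \<open>\<open>False\<close> stands for the first lattice vector and \<open>True\<close> for the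
  second. For \<open>k\<close> at least 3 the second is determined by the first, so only
  \<open>False\<close> remains in \<open>vec_index\<close>.\<close>

definition vec2 :: "nat \<Rightarrow> (bool \<Rightarrow> complex) \<Rightarrow> complex" where
  "vec2 k v = (if k \<le> 2 then v True else zeta k * v False)"

lemma compat_vec2: "compat k (v False) (vec2 k v)"
  by (simp add: compat_def vec2_def)

text \<open>\<open>B\<close> indexes coordinates on the space of representations killing \<open>H\<close>.\<close>

lemma rep_complement:
  assumes k: "gam_index k" and H: "subgroup H (Gam k)" "H \<subseteq> translation_part k"
  shows "\<exists>B \<subseteq> vec_index k. 2 * card B + rep k H = 2 * card (vec_index k) \<and>
    (\<forall>v. (\<forall>t. (t, 0) \<in> H \<longrightarrow> lat (v False) (vec2 k v) t = 0) \<longrightarrow> (\<forall>j\<in>B. v j = 0) \<longrightarrow>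
       (\<forall>j\<in>vec_index k. v j = 0)) \<and>
    (\<forall>y. \<exists>v. (\<forall>j\<in>B. v j = y j) \<and> (\<forall>t. (t, 0) \<in> H \<longrightarrow> lat (v False) (vec2 k v) t = 0))"
proof (cases "\<exists>t. (t, 0) \<in> H \<and> t \<noteq> (0, 0)")
  case False
  have k0: "0 < k" using k by auto
  have "h = \<one>\<^bsub>Gam k\<^esub>" if "h \<in> H" for h
    using False that H(2) translation_part_iff[OF k0] by (cases h) (auto simp: Gam_one)
  then have "H = {\<one>\<^bsub>Gam k\<^esub>}" using subgroup.one_closed[OF H(1)] by blast
  then have "rep k H = 0" by (rule rep_trivial[OF k])
  then show ?thesis
    using False by (intro exI[of _ "vec_index k"]) (fastforce simp: lat_def)
next
  case True
  then obtain ta where ta: "(ta, 0) \<in> H" "ta \<noteq> (0, 0)" by blast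
  show ?thesis
  proof (cases "3 \<le> k")
    case k3: True
    \<comment> \<open>A single killed nonzero translation already forces \<open>v False = 0\<close>,
      so no coordinate stays free.\<close>
    have "rep k H = 2" using rep_two[OF k H ta] k3 by blast
    moreover have "v False = 0" if "\<forall>t. (t, 0) \<in> H \<longrightarrow> lat (v False) (vec2 k v) t = 0" for v
    proof (rule ccontr)
      assume v: "v False \<noteq> 0"
      have "lat (v False) (v False * zeta k) ta = 0"
        using that[rule_format, OF ta(1)] k3 by (simp add: vec2_def mult.commute)
      moreover have "Im (zeta k) \<noteq> 0" using Im_xi[OF k] k3 by (simp add: xi_def)
      ultimately show False using lat_xi_eq_0[of "zeta k" "v False" ta] v ta(2) by blast
    qed
    moreover have "\<exists>v. \<forall>t. (t, 0) \<in> H \<longrightarrow> lat (v False) (vec2 k v) t = 0"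
      by (intro exI[of _ "\<lambda>_. 0"]) (simp add: lat_def vec2_def)
    ultimately show ?thesis
      using k3 by (intro exI[of _ "{}"]) (simp add: vec_index_def del: split_paired_All)
  next
    case False
    then have k2: "k \<le> 2" by simp
    have card: "card (vec_index k) = 2" using k2 by (simp add: vec_index_def)
    show ?thesis
    proof (cases "\<forall>t. (t, 0) \<in> H \<longrightarrow> fst t * snd ta = snd t * fst ta")
      case True
      have r: "rep k H = 2" using rep_two[OF k H ta] True by blast
      have iff: "(\<forall>t. (t, 0) \<in> H \<longrightarrow> lat v1 v2 t = 0) \<longleftrightarrow> lat v1 v2 ta = 0" for v1 v2
        using ta(1) lat_determined_parallel[OF ta(2), of _ v1 v2 0 0] True by (auto simp: lat_def simp del: split_paired_All)
      have v2: "vec2 k v = v True" for v using k2 by (simp add: vec2_def)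
      show ?thesis
      \<comment> \<open>One relation between the two vectors is left; the free coordinate is one
        whose partner has a nonzero coefficient and can be solved for.\<close>
      proof (cases "snd ta = 0")
        case True
        then have "fst ta \<noteq> 0" using ta(2) by (simp add: prod_eq_iff)
        have "\<exists>v. v True = y True \<and> lat (v False) (v True) ta = 0" for y :: "bool \<Rightarrow> complex"
          using True by (intro exI[of _ "\<lambda>b. if b then y True else 0"]) (simp add: lat_def)
        then have surj: "\<exists>v. (\<forall>j\<in>{True}. v j = y j) \<and> lat (v False) (v True) ta = 0" for y :: "bool \<Rightarrow> complex"
          by simp
        have ker: "\<forall>j\<in>vec_index k. v j = 0"
          if "lat (v False) (v True) ta = 0" "\<forall>j\<in>{True}. v j = 0" for v
          using that \<open>fst ta \<noteq> 0\<close> k2 by (simp add: lat_def vec_index_def UNIV_bool)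
        show ?thesis
          unfolding v2 iff
          by (intro exI[of _ "{True}"] conjI allI impI ker surj)
            (simp_all add: r card, simp add: k2 vec_index_def)
      next
        case False
        have "\<exists>v. v False = y False \<and> lat (v False) (v True) ta = 0" for y :: "bool \<Rightarrow> complex"
          using False
          by (intro exI[of _ "\<lambda>b. if b then - of_int (fst ta) / of_int (snd ta) * y False else y False"])
            (simp add: lat_def)
        then have surj: "\<exists>v. (\<forall>j\<in>{False}. v j = y j) \<and> lat (v False) (v True) ta = 0" for y :: "bool \<Rightarrow> complex"
          by simp
        have ker: "\<forall>j\<in>vec_index k. v j = 0"
          if "lat (v False) (v True) ta = 0" "\<forall>j\<in>{False}. v j = 0" for v
          using that False k2 by (simp add: lat_def vec_index_def UNIV_bool)
        show ?thesis
          unfolding v2 iff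
          by (intro exI[of _ "{False}"] conjI allI impI ker surj)
            (simp_all add: r card, simp add: k2 vec_index_def)
      qed
    next
      case False
      then obtain tb where tb: "(tb, 0) \<in> H" "fst ta * snd tb \<noteq> snd ta * fst tb"
        by (metis mult.commute)
      have r: "rep k H = 4" by (rule rep_four[OF k H k2 ta(1) tb])
      have "v1 = 0 \<and> v2 = 0" if "\<forall>t. (t, 0) \<in> H \<longrightarrow> lat v1 v2 t = 0" for v1 v2
      proof -
        have "lat v1 v2 t = lat 0 0 t" for t
        proof (rule lat_determined[OF tb(2)])
          show "lat v1 v2 ta = lat 0 0 ta" using that[rule_format, OF ta(1)] by (simp add: lat_def)
          show "lat v1 v2 tb = lat 0 0 tb" using that[rule_format, OF tb(1)] by (simp add: lat_def)
        qed
        from this[of "(1, 0)"] this[of "(0, 1)"] show ?thesis by (simp add: lat_def)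
      qed
      then have ker: "\<forall>j\<in>vec_index k. v j = 0"
        if "\<forall>t. (t, 0) \<in> H \<longrightarrow> lat (v False) (vec2 k v) t = 0" for v
        using that k2 by (metis (full_types) vec2_def)
      have surj: "\<exists>v. (\<forall>j\<in>{}. v j = y j) \<and> (\<forall>t. (t, 0) \<in> H \<longrightarrow> lat (v False) (vec2 k v) t = 0)"
        for y :: "bool \<Rightarrow> complex"
        by (intro exI[of _ "\<lambda>_. 0"]) (simp add: lat_def vec2_def)
      show ?thesis
        by (intro exI[of _ "{}"] conjI allI impI ker surj) (simp_all add: r card del: split_paired_All)
    qed
  qed
qed

lemma inv_translation:
  assumes k: "gam_index k"
  shows "inv\<^bsub>Gam k\<^esub> (t, 0) = ((- fst t, - snd t), 0)"
proof -
  interpret group "Gam k" by (rule group_Gam[OF k])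
  have k0: "0 < k" using k by auto
  show ?thesis
    using k0 by (intro inv_equality) (auto simp: Gam_mult Gam_one Gam_carrier)
qed

lemma subgroup_translation_part:
  assumes k: "gam_index k"
  shows "subgroup (translation_part k) (Gam k)"
proof -
  interpret group "Gam k" by (rule group_Gam[OF k])
  have k0: "0 < k" using k by auto
  show ?thesis
  proof (rule subgroupI)
    show "translation_part k \<subseteq> carrier (Gam k)" by (auto simp: translation_part_def)
    show "translation_part k \<noteq> {}" using one_closed by (auto simp: translation_part_def Gam_one)
    fix a b assume a: "a \<in> translation_part k" and b: "b \<in> translation_part k"
    then show "a \<otimes>\<^bsub>Gam k\<^esub> b \<in> translation_part k"
      using k0 by (simp add: translation_part_iff Gam_mult)
    obtain t where "a = (t, 0)" using a k0 by (cases a) (simp add: translation_part_iff)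
    then show "inv\<^bsub>Gam k\<^esub> a \<in> translation_part k"
      using k0 by (simp add: translation_part_iff inv_translation[OF k])
  qed
qed

lemma rep_translation_part:
  assumes k: "gam_index k"
  shows "rep k (translation_part k) = 2 * card (vec_index k)"
proof -
  have k0: "0 < k" using k by auto
  note H = subgroup_translation_part[OF k]
  have t: "((1, 0), 0) \<in> translation_part k" "((0, 1), 0) \<in> translation_part k"
    using k0 by (simp_all add: translation_part_iff)
  show ?thesis
  proof (cases "k \<le> 2")
    case True
    then show ?thesis using rep_four[OF k H _ _ t] by (simp add: vec_index_def)
  next
    case False
    then show ?thesis using rep_two[OF k H _ t(1)] by (simp add: vec_index_def)
  qed
qed

section \<open>Paths\<close>

definition rev_path :: "('b \<times> bool) list \<Rightarrow> ('b \<times> bool) list" where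
  "rev_path P = rev (map (\<lambda>(e, fwd). (e, \<not> fwd)) P)"

locale colored_digraph = fin_digraph G for G :: "('a, 'b) pre_digraph" +
  fixes k :: nat and col :: "'b \<Rightarrow> gam"
  assumes index: "gam_index k"
    and col_carrier: "e \<in> arcs G \<Longrightarrow> col e \<in> carrier (Gam k)"

lemma colored_digraph_iff: "colored_digraph G k col \<longleftrightarrow> gam_index k \<and> colored_graph k G col"
  by (auto simp: colored_digraph_def colored_digraph_axioms_def colored_graph_def)

sublocale colored_digraph \<subseteq> gam: group "Gam k"
  by (rule group_Gam[OF index])

context colored_digraph
begin

lemma k_pos: "0 < k"
  using index by auto

lemma is_path_append: "is_path G u P v \<Longrightarrow> is_path G v Q w \<Longrightarrow> is_path G u (P @ Q) w"
  by (induction P arbitrary: u) (auto split: if_splits)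

lemma is_path_verts: "is_path G u P v \<Longrightarrow> u \<in> verts G \<and> v \<in> verts G"
proof (induction P arbitrary: u)
  case Nil
  then show ?case unfolding is_path.simps by blast
next
  case (Cons ef P)
  then show ?case by (cases ef) (auto split: if_splits)
qed

lemma is_path_arc:
  assumes "e \<in> arcs G"
  shows "is_path G (tail G e) [(e, True)] (head G e)" "is_path G (head G e) [(e, False)] (tail G e)"
  using assms by auto

lemma is_path_rev: "is_path G u P v \<Longrightarrow> is_path G v (rev_path P) u"
proof (induction P arbitrary: u)
  case Nil
  then have "u = v" "v \<in> verts G" unfolding is_path.simps by blast+
  then show ?case by (simp add: rev_path_def)
next
  case (Cons ef P)
  obtain e fwd where ef: "ef = (e, fwd)" by fastforce
  have "rev_path (ef # P) = rev_path P @ [(e, \<not> fwd)]"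
    by (simp add: rev_path_def ef)
  then show ?case
    using Cons is_path_arc[of e] by (cases fwd) (auto simp: ef intro!: is_path_append)
qed

lemma rho_carrier: "is_path G u P v \<Longrightarrow> rho k col P \<in> carrier (Gam k)"
  by (induction P arbitrary: u) (auto split: if_splits simp: col_carrier)

lemma rho_append:
  assumes "is_path G u P v" "is_path G v Q w"
  shows "rho k col (P @ Q) = rho k col P \<otimes>\<^bsub>Gam k\<^esub> rho k col Q"
  using assms(1)
proof (induction P arbitrary: u)
  case Nil
  then show ?case using rho_carrier[OF assms(2)] by simp
next
  case (Cons ef P)
  obtain e fwd where ef: "ef = (e, fwd)" by fastforce
  obtain u' where e: "e \<in> arcs G" "is_path G u' P v"
    using Cons(2) by (auto simp: ef split: if_splits)
  show ?case
    using Cons.IH[OF e(2)] rho_carrier[OF e(2)] rho_carrier[OF assms(2)] col_carrier[OF e(1)]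
    by (simp add: ef gam.m_assoc)
qed

lemma rho_rev: "is_path G u P v \<Longrightarrow> rho k col (rev_path P) = inv\<^bsub>Gam k\<^esub> rho k col P"
proof (induction P arbitrary: u)
  case Nil
  then show ?case by (simp add: rev_path_def)
next
  case (Cons ef P)
  obtain e fwd where ef: "ef = (e, fwd)" by fastforce
  obtain u' where e: "e \<in> arcs G" "is_path G u' P v" "is_path G u' [(e, \<not> fwd)] u"
    using Cons(2) is_path_arc[of e] by (auto simp: ef split: if_splits)
  have "rho k col (rev_path (ef # P)) = rho k col (rev_path P @ [(e, \<not> fwd)])"
    by (simp add: rev_path_def ef)
  also have "\<dots> = inv\<^bsub>Gam k\<^esub> rho k col P \<otimes>\<^bsub>Gam k\<^esub> rho k col [(e, \<not> fwd)]"
    using rho_append[OF is_path_rev[OF e(2)] e(3)] Cons.IH[OF e(2)] by simp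
  also have "\<dots> = inv\<^bsub>Gam k\<^esub> rho k col (ef # P)"
    using col_carrier[OF e(1)] rho_carrier[OF e(2)] by (simp add: ef gam.inv_mult_group)
  finally show ?case .
qed

abbreviation "\<Delta> \<equiv> rho_pi1 k G col"

lemma rho_pi1_carrier: "g \<in> \<Delta> b \<Longrightarrow> g \<in> carrier (Gam k)"
  using rho_carrier by (auto simp: rho_pi1_def)

lemma rho_pi1_mult:
  assumes "g \<in> \<Delta> b" "h \<in> \<Delta> b"
  shows "g \<otimes>\<^bsub>Gam k\<^esub> h \<in> \<Delta> b"
proof -
  obtain P Q where PQ: "is_path G b P b" "g = rho k col P" "is_path G b Q b" "h = rho k col Q"
    using assms unfolding rho_pi1_def by blast
  have "g \<otimes>\<^bsub>Gam k\<^esub> h = rho k col (P @ Q)"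
    unfolding PQ(2,4) rho_append[OF PQ(1,3)] ..
  then show ?thesis unfolding rho_pi1_def using is_path_append[OF PQ(1,3)] by blast
qed

lemma rho_pi1_inv:
  assumes "g \<in> \<Delta> b"
  shows "inv\<^bsub>Gam k\<^esub> g \<in> \<Delta> b"
proof -
  obtain P where P: "is_path G b P b" "g = rho k col P"
    using assms unfolding rho_pi1_def by blast
  have "inv\<^bsub>Gam k\<^esub> g = rho k col (rev_path P)"
    unfolding P(2) rho_rev[OF P(1)] ..
  then show ?thesis unfolding rho_pi1_def using is_path_rev[OF P(1)] by blast
qed

definition comp_of :: "'a \<Rightarrow> 'a set" where
  "comp_of u = {v. \<exists>P. is_path G u P v}"

lemma conn_components_eq: "conn_components G = comp_of ` verts G"
  by (auto simp: conn_components_def comp_of_def)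

lemma comp_of_eq:
  assumes "is_path G u P v"
  shows "comp_of u = comp_of v"
  using is_path_append[OF assms] is_path_append[OF is_path_rev[OF assms]] unfolding comp_of_def by blast

lemma base_vertex_comp_of:
  assumes "u \<in> verts G"
  obtains P where "is_path G u P (base_vertex (comp_of u))"
proof -
  have "u \<in> comp_of u" using assms unfolding comp_of_def by (auto intro: exI[of _ "[]"])
  then have "base_vertex (comp_of u) \<in> comp_of u"
    unfolding base_vertex_def by (rule someI)
  then show ?thesis using that by (auto simp: comp_of_def)
qed

lemma comp_of_base_vertex: "u \<in> verts G \<Longrightarrow> comp_of (base_vertex (comp_of u)) = comp_of u"
  using base_vertex_comp_of comp_of_eq by metis

lemma base_vertex_in_verts: "u \<in> verts G \<Longrightarrow> base_vertex (comp_of u) \<in> verts G"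
  using base_vertex_comp_of is_path_verts by metis

lemma inj_on_base_vertex: "inj_on base_vertex (conn_components G)"
  unfolding conn_components_eq by (rule inj_onI) (metis comp_of_base_vertex imageE)

lemma finite_conn_components: "finite (conn_components G)"
  by (simp add: conn_components_eq)

abbreviation "\<Lambda> \<equiv> Lambda k G col"

lemma Lambda_generators:
  "(\<Union>C\<in>conn_components G. \<Delta> (base_vertex C) \<inter> translation_part k) \<subseteq> carrier (Gam k)"
  by (auto simp: translation_part_def)

lemma subgroup_Lambda: "subgroup \<Lambda> (Gam k)"
  unfolding Lambda_def by (rule gam.generate_is_subgroup[OF Lambda_generators])

lemma Lambda_translation: "\<Lambda> \<subseteq> translation_part k"
  unfolding Lambda_def
  by (rule gam.generate_subgroup_incl[OF _ subgroup_translation_part[OF index]]) auto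

lemma Lambda_incl: "u \<in> verts G \<Longrightarrow> g \<in> \<Delta> (base_vertex (comp_of u)) \<Longrightarrow> snd g = 0 \<Longrightarrow> g \<in> \<Lambda>"
  unfolding Lambda_def
  by (rule generate.incl) (auto simp: conn_components_eq translation_part_iff[OF k_pos])

lemma lat_Lambda:
  assumes "\<And>u t. u \<in> verts G \<Longrightarrow> (t, 0) \<in> \<Delta> (base_vertex (comp_of u)) \<Longrightarrow> lat v1 v2 t = 0"
    and "(t, 0) \<in> \<Lambda>"
  shows "lat v1 v2 t = 0"
proof -
  have "snd h = 0 \<and> lat v1 v2 (fst h) = 0" if "h \<in> \<Lambda>" for h
    using that unfolding Lambda_def
  proof (induction rule: generate.induct)
    case one
    then show ?case by (simp add: Gam_one lat_def)
  next
    case (incl h)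
    then show ?case using assms(1) by (cases h) (auto simp: conn_components_eq translation_part_iff[OF k_pos])
  next
    case (inv h)
    then have h: "snd h = 0" "lat v1 v2 (fst h) = 0"
      using assms(1) by (cases h, auto simp: conn_components_eq translation_part_iff[OF k_pos])+
    have "inv\<^bsub>Gam k\<^esub> h = ((- fst (fst h), - snd (fst h)), 0)"
      using inv_translation[OF index, of "fst h"] h(1) by (metis prod.collapse)
    moreover have "lat v1 v2 (- fst (fst h), - snd (fst h)) = - lat v1 v2 (fst h)"
      by (simp add: lat_def)
    ultimately show ?case using h by simp
  next
    case (eng g h)
    then have "g \<otimes>\<^bsub>Gam k\<^esub> h = ((fst (fst g) + fst (fst h), snd (fst g) + snd (fst h)), 0)"
      by (simp add: Gam_mult)
    then show ?case using eng by (simp add: lat_add)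
  qed
  from this[OF assms(2)] show ?thesis by simp
qed

end

section \<open>The rank of the direction functionals\<close>

text \<open>Unknowns are kept real because a direction is only a real-linear condition. The index
  \<open>j\<close> is a vertex (\<open>Inl\<close>) or a lattice vector (\<open>Inr\<close>), and
  the flag selects the real or the imaginary part.\<close>

definition unk :: "(('a + bool) \<times> bool \<Rightarrow> real) \<Rightarrow> 'a + bool \<Rightarrow> complex" where
  "unk x j = Complex (x (j, False)) (x (j, True))"

definition point :: "(('a + bool) \<times> bool \<Rightarrow> real) \<Rightarrow> 'a \<Rightarrow> complex" where
  "point x i = unk x (Inl i)"

definition lvec :: "(('a + bool) \<times> bool \<Rightarrow> real) \<Rightarrow> bool \<Rightarrow> complex" where
  "lvec x b = unk x (Inr b)"

definition unk_index :: "nat \<Rightarrow> 'a set \<Rightarrow> (('a + bool) \<times> bool) set" where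
  "unk_index k V = (Inl ` V \<union> Inr ` vec_index k) \<times> UNIV"

definition cact :: "nat \<Rightarrow> (('a + bool) \<times> bool \<Rightarrow> real) \<Rightarrow> gam \<Rightarrow> complex \<Rightarrow> complex" where
  "cact k x = act k (lvec x False) (vec2 k (lvec x))"

definition gap :: "nat \<Rightarrow> ('a, 'b) pre_digraph \<Rightarrow> ('b \<Rightarrow> gam) \<Rightarrow> 'b \<Rightarrow> (('a + bool) \<times> bool \<Rightarrow> real) \<Rightarrow> complex" where
  "gap k G col e x = point x (tail G e) - cact k x (col e) (point x (head G e))"

text \<open>A direction \<open>d\<close> imposes \<open>d\<^sub>1 Im z - d\<^sub>2 Re z = 0\<close> on the gap \<open>z\<close>.\<close>

definition gap1 :: "nat \<Rightarrow> ('a, 'b) pre_digraph \<Rightarrow> ('b \<Rightarrow> gam) \<Rightarrow> 'b \<Rightarrow> (('a + bool) \<times> bool \<Rightarrow> real) \<Rightarrow> real" where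
  "gap1 k G col e x = Im (gap k G col e x)"

definition gap2 :: "nat \<Rightarrow> ('a, 'b) pre_digraph \<Rightarrow> ('b \<Rightarrow> gam) \<Rightarrow> 'b \<Rightarrow> (('a + bool) \<times> bool \<Rightarrow> real) \<Rightarrow> real" where
  "gap2 k G col e x = - Re (gap k G col e x)"

lemma gap_eq_0: "gap k G col e x = 0 \<longleftrightarrow> gap1 k G col e x = 0 \<and> gap2 k G col e x = 0"
  by (auto simp: gap1_def gap2_def complex_eq_iff)

lemma complex_all_eq: "(\<forall>s. x (j, s) = y (j, s)) \<longleftrightarrow> unk x j = unk y j"
  by (auto simp: unk_def complex_eq_iff) (metis (full_types))

definition coord_fun :: "'i set \<Rightarrow> (('i \<Rightarrow> real) \<Rightarrow> complex) \<Rightarrow> bool" where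
  "coord_fun I f \<longleftrightarrow> (\<lambda>x. Re (f x)) \<in> fn.span (coords I) \<and> (\<lambda>x. Im (f x)) \<in> fn.span (coords I)"

lemma span_coords_combination:
  assumes "f \<in> fn.span S" "g \<in> fn.span S"
  shows "(\<lambda>x. a * f x + b * g x) \<in> fn.span S"
proof -
  have "(\<lambda>x. a * f x) + (\<lambda>x. b * g x) \<in> fn.span S"
    by (intro fn.span_add fn.span_scale assms)
  then show ?thesis by (simp add: plus_fun_def)
qed

lemma coord_fun_add: "coord_fun I f \<Longrightarrow> coord_fun I g \<Longrightarrow> coord_fun I (\<lambda>x. f x + g x)"
  using span_coords_combination[of "\<lambda>x. Re (f x)" "coords I" "\<lambda>x. Re (g x)" 1 1]
    span_coords_combination[of "\<lambda>x. Im (f x)" "coords I" "\<lambda>x. Im (g x)" 1 1]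
  by (simp add: coord_fun_def)

lemma coord_fun_diff: "coord_fun I f \<Longrightarrow> coord_fun I g \<Longrightarrow> coord_fun I (\<lambda>x. f x - g x)"
  using span_coords_combination[of "\<lambda>x. Re (f x)" "coords I" "\<lambda>x. Re (g x)" 1 "-1"]
    span_coords_combination[of "\<lambda>x. Im (f x)" "coords I" "\<lambda>x. Im (g x)" 1 "-1"]
  by (simp add: coord_fun_def)

lemma coord_fun_mult:
  assumes "coord_fun I f"
  shows "coord_fun I (\<lambda>x. c * f x)"
  using span_coords_combination[of "\<lambda>x. Re (f x)" "coords I" "\<lambda>x. Im (f x)" "Re c" "- Im c"]
    span_coords_combination[of "\<lambda>x. Re (f x)" "coords I" "\<lambda>x. Im (f x)" "Im c" "Re c"] assms
  by (simp add: coord_fun_def add.commute)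

lemma coord_fun_unk:
  "(j, False) \<in> I \<Longrightarrow> (j, True) \<in> I \<Longrightarrow> coord_fun I (\<lambda>x. unk x j)"
  by (simp add: coord_fun_def unk_def coord_in_span)

lemma coord_fun_vec:
  shows "coord_fun (unk_index k V) (\<lambda>x. lvec x False)"
    "coord_fun (unk_index k V) (\<lambda>x. vec2 k (lvec x))"
proof -
  show F: "coord_fun (unk_index k V) (\<lambda>x. lvec x False)"
    unfolding lvec_def by (rule coord_fun_unk) (auto simp: unk_index_def vec_index_def)
  show "coord_fun (unk_index k V) (\<lambda>x. vec2 k (lvec x))"
  proof (cases "k \<le> 2")
    case True
    have "coord_fun (unk_index k V) (\<lambda>x. lvec x True)"
      unfolding lvec_def using True by (intro coord_fun_unk) (auto simp: unk_index_def vec_index_def)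
    then show ?thesis using True by (simp add: vec2_def)
  next
    case False
    then show ?thesis using coord_fun_mult[OF F] by (simp add: vec2_def)
  qed
qed

lemma coord_fun_gap:
  assumes "tail G e \<in> V" "head G e \<in> V"
  shows "coord_fun (unk_index k V) (gap k G col e)"
proof -
  have p: "coord_fun (unk_index k V) (\<lambda>x. point x i)" if "i \<in> V" for i
    unfolding point_def using that by (intro coord_fun_unk) (auto simp: unk_index_def)
  have "coord_fun (unk_index k V) (\<lambda>x. gap k G col e x)"
    unfolding gap_def cact_def act_def lat_def
    by (intro coord_fun_diff coord_fun_add coord_fun_mult p assms coord_fun_vec)
  then show ?thesis .
qed

lemma gap_in_span:
  assumes "tail G e \<in> V" "head G e \<in> V"
  shows "gap1 k G col e \<in> fn.span (coords (unk_index k V))"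
    "gap2 k G col e \<in> fn.span (coords (unk_index k V))"
  using coord_fun_gap[OF assms, of k col] span_coords_combination[of "\<lambda>x. Re (gap k G col e x)" _ _ "-1" 0]
  unfolding coord_fun_def gap1_def[abs_def] gap2_def[abs_def] by auto

lemma finite_vec_index [simp]: "finite (vec_index k)"
  by (simp add: vec_index_def)

lemma card_unk_index:
  assumes "finite V"
  shows "card (unk_index k V) = 2 * (card V + card (vec_index k))"
proof -
  have "unk_index k V = (V <+> vec_index k) \<times> UNIV"
    unfolding unk_index_def Plus_def ..
  then show ?thesis
    using card_Plus[OF assms finite_vec_index] by (simp add: card_cartesian_product)
qed

lemma finite_unk_index: "finite V \<Longrightarrow> finite (unk_index k V)"
  by (simp add: unk_index_def vec_index_def)

lemma T_val_eq: "gam_index k \<Longrightarrow> T_val k H = (if \<exists>h\<in>H. snd h \<noteq> 0 then 0 else 2)"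
  by (subst T_val_def, subst translation_part_iff) auto

context colored_digraph
begin

lemma compat_vec: "compat k (lvec x False) (vec2 k (lvec x))"
  by (rule compat_vec2)

lemma path_act:
  assumes "\<forall>e\<in>arcs G. gap k G col e x = 0" "is_path G u P v"
  shows "point x u = cact k x (rho k col P) (point x v)"
  using assms(2)
proof (induction P arbitrary: u)
  case Nil
  then show ?case by (simp add: Gam_one cact_def)
next
  case (Cons ef P)
  obtain e fwd where ef: "ef = (e, fwd)" by fastforce
  have e: "e \<in> arcs G" using Cons(2) by (simp add: ef)
  then have g: "point x (tail G e) = cact k x (col e) (point x (head G e))"
    using assms(1) by (simp add: gap_def)
  show ?case
  proof (cases fwd)
    case True
    then have "u = tail G e" "is_path G (head G e) P v" using Cons(2) by (auto simp: ef)
    then show ?thesis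
      using Cons.IH True g by (simp add: ef cact_def act_mult[OF index compat_vec])
  next
    case False
    then have u: "u = head G e" "is_path G (tail G e) P v" using Cons(2) by (auto simp: ef)
    have "cact k x (inv\<^bsub>Gam k\<^esub> col e) (point x (tail G e)) = point x (head G e)"
      unfolding g unfolding cact_def by (rule act_inv[OF index compat_vec col_carrier[OF e]])
    then show ?thesis
      using Cons.IH[OF u(2)] u(1) False by (simp add: ef cact_def act_mult[OF index compat_vec])
  qed
qed

lemma rho_pi1_act:
  assumes "\<forall>e\<in>arcs G. gap k G col e x = 0" "g \<in> \<Delta> b"
  shows "cact k x g (point x b) = point x b"
proof -
  obtain P where P: "is_path G b P b" "g = rho k col P"
    using assms(2) unfolding rho_pi1_def by blast
  show ?thesis unfolding P(2) by (rule path_act[OF assms(1) P(1), symmetric])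
qed

text \<open>A commutator has rotation exponent 0, so it lies in \<open>\<Lambda>\<close> and acts
  trivially. Hence every \<open>h\<close> commutes with the action of the rotation \<open>g\<close>
  and maps its only fixed point to itself.\<close>

lemma fixed_point:
  assumes u: "u \<in> verts G" and c: "compat k v1 v2"
    and v: "\<And>t. (t, 0) \<in> \<Lambda> \<Longrightarrow> lat v1 v2 t = 0"
    and g: "g \<in> \<Delta> (base_vertex (comp_of u))" "snd g \<noteq> 0"
  shows "\<exists>z. \<forall>h \<in> \<Delta> (base_vertex (comp_of u)). act k v1 v2 h z = z"
proof -
  let ?b = "base_vertex (comp_of u)"
  have gk: "snd g < k" using rho_pi1_carrier[OF g(1)] by (simp add: Gam_carrier)
  have z1: "1 - zeta k ^ snd g \<noteq> 0"
    using zeta_power_inj[of "snd g" k 0] gk g(2) k_pos by auto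
  define z where "z = lat v1 v2 (fst g) / (1 - zeta k ^ snd g)"
  have fix_iff: "act k v1 v2 g y = y \<longleftrightarrow> y = z" for y
    using z1 by (auto simp: z_def act_def field_simps)
  have "act k v1 v2 h z = z" if h: "h \<in> \<Delta> ?b" for h
  proof -
    let ?c = "g \<otimes>\<^bsub>Gam k\<^esub> h \<otimes>\<^bsub>Gam k\<^esub> (inv\<^bsub>Gam k\<^esub> (h \<otimes>\<^bsub>Gam k\<^esub> g))"
    have carr: "g \<in> carrier (Gam k)" "h \<in> carrier (Gam k)"
      using rho_pi1_carrier g(1) h by auto
    have c_in: "?c \<in> \<Delta> ?b" using g(1) h by (intro rho_pi1_mult rho_pi1_inv)
    have prod: "g \<otimes>\<^bsub>Gam k\<^esub> h = ?c \<otimes>\<^bsub>Gam k\<^esub> (h \<otimes>\<^bsub>Gam k\<^esub> g)"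
      using carr by (simp add: gam.m_assoc)
    have "zeta k ^ snd (g \<otimes>\<^bsub>Gam k\<^esub> h) = zeta k ^ snd ?c * zeta k ^ snd (h \<otimes>\<^bsub>Gam k\<^esub> g)"
      using arg_cong[OF prod, of "\<lambda>g. zeta k ^ snd g"] k_pos
      by (simp add: Gam_mult[where g = ?c] zeta_power_mod power_add)
    moreover have "zeta k ^ snd (g \<otimes>\<^bsub>Gam k\<^esub> h) = zeta k ^ snd (h \<otimes>\<^bsub>Gam k\<^esub> g)"
      by (simp add: Gam_mult add.commute)
    ultimately have "zeta k ^ snd ?c = zeta k ^ 0" by simp
    then have c0: "snd ?c = 0"
      using rho_pi1_carrier[OF c_in] k_pos by (intro zeta_power_inj) (auto simp: Gam_carrier)
    then have "(fst ?c, 0) \<in> \<Lambda>" using Lambda_incl[OF u c_in] by (metis prod.collapse)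
    then have "act k v1 v2 ?c y = y" for y
      using v c0 by (simp add: act_def)
    then have "act k v1 v2 g (act k v1 v2 h z) = act k v1 v2 h (act k v1 v2 g z)"
      using arg_cong[OF prod, of "\<lambda>g. act k v1 v2 g z"] by (simp add: act_mult[OF index c])
    then show ?thesis using fix_iff by metis
  qed
  then show ?thesis by blast
qed

text \<open>The coordinates \<open>Q\<close> on the kernel are the base points of the components
  without rotations and the lattice coordinates \<open>B\<close>. Taking these
  \<open>2 * (card ?N + card B)\<close> from the real unknowns and inserting
  \<open>2 * card B = 2 * card (vec_index k) - rep k \<Lambda>\<close> leaves
  \<open>h + 1\<close>.\<close>

lemma dim_gaps:
  "int (fn.dim (\<Union>e\<in>arcs G. {gap1 k G col e, gap2 k G col e})) = h_count k G col + 1"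
proof -
  let ?I = "unk_index k (verts G)"
  let ?S = "\<Union>e\<in>arcs G. {gap1 k G col e, gap2 k G col e}"
  let ?N = "{C \<in> conn_components G. T_val k (\<Delta> (base_vertex C)) = 2}"
  obtain B where B: "B \<subseteq> vec_index k" "2 * card B + rep k \<Lambda> = 2 * card (vec_index k)"
    and B_ker: "\<And>v. \<forall>t. (t, 0) \<in> \<Lambda> \<longrightarrow> lat (v False) (vec2 k v) t = 0 \<Longrightarrow> \<forall>j\<in>B. v j = 0 \<Longrightarrow>
       \<forall>j\<in>vec_index k. v j = 0"
    and B_surj: "\<And>y. \<exists>v. (\<forall>j\<in>B. v j = y j) \<and> (\<forall>t. (t, 0) \<in> \<Lambda> \<longrightarrow> lat (v False) (vec2 k v) t = 0)"
    using rep_complement[OF index subgroup_Lambda Lambda_translation] by blast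
  have S0: "(\<forall>s\<in>?S. s x = 0) \<longleftrightarrow> (\<forall>e\<in>arcs G. gap k G col e x = 0)" for x
    by (auto simp: gap_eq_0)
  define Q where "Q = (Inl ` base_vertex ` ?N \<union> Inr ` B) \<times> (UNIV :: bool set)"
  have Q_iff: "(\<forall>q\<in>Q. x q = y q) \<longleftrightarrow>
      (\<forall>C\<in>?N. point x (base_vertex C) = point y (base_vertex C)) \<and> (\<forall>j\<in>B. lvec x j = lvec y j)" for x y
    unfolding Q_def point_def lvec_def complex_all_eq[symmetric] by blast
  have finN: "finite ?N" using finite_conn_components by simp
  have finB: "finite B" using B(1) finite_subset[of B UNIV] by simp
  have cardQ: "card Q = 2 * (card ?N + card B)"
  proof -
    have "card (base_vertex ` ?N) = card ?N"
      by (rule card_image[OF inj_on_subset[OF inj_on_base_vertex]]) auto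
    moreover have "card (Inl ` base_vertex ` ?N \<union> Inr ` B) = card (base_vertex ` ?N) + card B"
      using finN finB by (subst card_Un_disjoint) (auto simp: card_image)
    ultimately show ?thesis by (simp add: Q_def card_cartesian_product)
  qed
  have rank: "fn.dim ?S + card Q = card ?I"
  proof (rule dim_plus_kernel)
    show "finite ?I" by (simp add: finite_unk_index)
    show "finite ?S" by simp
    show "?S \<subseteq> fn.span (coords ?I)"
    proof (rule UN_least)
      fix e assume "e \<in> arcs G"
      then show "{gap1 k G col e, gap2 k G col e} \<subseteq> fn.span (coords ?I)"
        using gap_in_span[of G e "verts G" k col] by simp
    qed
    show "Q \<subseteq> ?I"
      using B(1) base_vertex_in_verts by (auto simp: Q_def unk_index_def conn_components_eq)
  next
    fix x assume x: "\<forall>s\<in>?S. s x = 0" and xQ: "\<forall>q\<in>Q. x q = 0"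
    then have gaps: "\<forall>e\<in>arcs G. gap k G col e x = 0" using S0 by blast
    have xB: "\<forall>j\<in>B. lvec x j = 0" and xN: "\<forall>C\<in>?N. point x (base_vertex C) = 0"
      using xQ Q_iff[of x "\<lambda>_. 0"] by (simp_all add: point_def lvec_def unk_def zero_complex.code)
    have "\<forall>t. (t, 0) \<in> \<Lambda> \<longrightarrow> lat (lvec x False) (vec2 k (lvec x)) t = 0"
    proof (intro allI impI)
      fix t assume t: "(t, 0) \<in> \<Lambda>"
      show "lat (lvec x False) (vec2 k (lvec x)) t = 0"
      proof (rule lat_Lambda[OF _ t])
        fix u t assume "(t, 0) \<in> \<Delta> (base_vertex (comp_of u))"
        from rho_pi1_act[OF gaps this] show "lat (lvec x False) (vec2 k (lvec x)) t = 0"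
          by (simp add: cact_def act_def)
      qed
    qed
    then have v0: "\<forall>j\<in>vec_index k. lvec x j = 0" using xB by (rule B_ker)
    then have "lvec x False = 0" "vec2 k (lvec x) = 0"
      by (auto simp: vec_index_def vec2_def split: if_splits)
    then have act0: "cact k x g z = zeta k ^ snd g * z" for g z
      by (simp add: cact_def act_def lat_def)
    \<comment> \<open>With all lattice vectors zero, a component with a rotation is pinned to the
      fixed point 0 of that rotation; the other base points vanish by the choice of
      \<open>Q\<close>.\<close>
    have pb: "point x (base_vertex (comp_of u)) = 0" if u: "u \<in> verts G" for u
    proof (cases "comp_of u \<in> ?N")
      case True
      then show ?thesis using xN by blast
    next
      case False
      let ?b = "base_vertex (comp_of u)"
      have "T_val k (\<Delta> ?b) \<noteq> 2" using False u by (simp add: conn_components_eq)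
      then obtain g where g: "g \<in> \<Delta> ?b" "snd g \<noteq> 0"
        unfolding T_val_eq[OF index] by (auto split: if_splits)
      have "zeta k ^ snd g \<noteq> 1"
        using zeta_power_inj[of "snd g" k 0] rho_pi1_carrier[OF g(1)] g(2) k_pos by (auto simp: Gam_carrier)
      then show ?thesis using rho_pi1_act[OF gaps g(1)] by (simp add: act0)
    qed
    have "point x u = 0" if u: "u \<in> verts G" for u
    proof -
      obtain P where "is_path G u P (base_vertex (comp_of u))" using base_vertex_comp_of[OF u] .
      from path_act[OF gaps this] show ?thesis by (simp add: pb[OF u] act0)
    qed
    then show "\<forall>i\<in>?I. x i = 0"
      using v0 complex_all_eq[of x _ "\<lambda>_. 0"]
      by (auto simp: unk_index_def point_def lvec_def unk_def zero_complex.code)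
  next
    fix y :: "('a + bool) \<times> bool \<Rightarrow> real"
    obtain v where v: "\<forall>j\<in>B. v j = lvec y j" "\<forall>t. (t, 0) \<in> \<Lambda> \<longrightarrow> lat (v False) (vec2 k v) t = 0"
      using B_surj by blast
    let ?act = "act k (v False) (vec2 k v)"
    have c: "compat k (v False) (vec2 k v)" by (rule compat_vec2)
    \<comment> \<open>A common fixed point of the group of the component: the prescribed point if
      the group consists of killed translations, the centre of a rotation otherwise.\<close>
    have "\<exists>z. (\<forall>h\<in>\<Delta> (base_vertex C). ?act h z = z) \<and> (C \<in> ?N \<longrightarrow> z = point y (base_vertex C))"
      if C: "C \<in> conn_components G" for C
    proof -
      obtain u where u: "u \<in> verts G" "C = comp_of u" using C by (auto simp: conn_components_eq)
      show ?thesis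
      proof (cases "C \<in> ?N")
        case True
        have "?act h (point y (base_vertex C)) = point y (base_vertex C)" if h: "h \<in> \<Delta> (base_vertex C)" for h
        proof -
          have h0: "snd h = 0" using True h unfolding T_val_eq[OF index] by (auto split: if_splits)
          then have "(fst h, 0) \<in> \<Lambda>" using Lambda_incl[OF u(1)] h u(2) by (metis prod.collapse)
          from v(2)[rule_format, OF this] show ?thesis using h0 by (simp add: act_def)
        qed
        then show ?thesis by blast
      next
        case False
        then have "T_val k (\<Delta> (base_vertex C)) \<noteq> 2" using C by simp
        then obtain g where "g \<in> \<Delta> (base_vertex C)" "snd g \<noteq> 0"
          unfolding T_val_eq[OF index] by (auto split: if_splits)
        then show ?thesis using fixed_point[OF u(1) c, of g] v(2) False u(2) by blast
      qed
    qed
    then obtain cen where cen: "\<And>C h. C \<in> conn_components G \<Longrightarrow> h \<in> \<Delta> (base_vertex C) \<Longrightarrow> ?act h (cen C) = cen C"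
      and cenN: "\<And>C. C \<in> ?N \<Longrightarrow> cen C = point y (base_vertex C)"
      by (metis (no_types, lifting) mem_Collect_eq)
    define Pt where "Pt u = (SOME P. is_path G u P (base_vertex (comp_of u)))" for u
    have Pt: "is_path G u (Pt u) (base_vertex (comp_of u))" if "u \<in> verts G" for u
      unfolding Pt_def using base_vertex_comp_of[OF that] by (metis someI)
    \<comment> \<open>Positions are propagated from the base vertex along a chosen path; another
      path differs by a loop, which fixes \<open>cen\<close>.\<close>
    define q where "q u = ?act (rho k col (Pt u)) (cen (comp_of u))" for u
    define x where "x p = (case p of (j, s) \<Rightarrow>
      (let z = (case j of Inl u \<Rightarrow> q u | Inr b \<Rightarrow> v b) in if s then Im z else Re z))" for p
    have pos_x: "point x u = q u" and vec_x: "lvec x = v" for u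
      by (simp_all add: x_def point_def lvec_def unk_def fun_eq_iff)
    have "gap k G col e x = 0" if e: "e \<in> arcs G" for e
    proof -
      let ?i = "tail G e" and ?j = "head G e"
      have ij: "?i \<in> verts G" "?j \<in> verts G" using e by auto
      have cij: "comp_of ?i = comp_of ?j" using comp_of_eq[OF is_path_arc(1)[OF e]] .
      let ?b = "base_vertex (comp_of ?i)"
      \<comment> \<open>The loop from the base vertex to the tail of \<open>e\<close>, across
        \<open>e\<close>, and back from its head.\<close>
      let ?R = "rev_path (Pt ?i)" and ?E = "[(e, True)] @ Pt ?j"
      have P1: "is_path G ?b ?R ?i" by (rule is_path_rev[OF Pt[OF ij(1)]])
      have P2: "is_path G ?i ?E ?b"
        using is_path_append[OF is_path_arc(1)[OF e] Pt[OF ij(2)]] by (simp add: cij)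
      have "rho k col (?R @ ?E) \<in> \<Delta> ?b"
        using is_path_append[OF P1 P2] by (auto simp: rho_pi1_def)
      then have "?act (rho k col (?R @ ?E)) (cen (comp_of ?i)) = cen (comp_of ?i)"
        using cen ij by (simp add: conn_components_eq)
      moreover have "rho k col (?R @ ?E) =
          inv\<^bsub>Gam k\<^esub> (rho k col (Pt ?i)) \<otimes>\<^bsub>Gam k\<^esub> (col e \<otimes>\<^bsub>Gam k\<^esub> rho k col (Pt ?j))"
        using rho_append[OF P1 P2] rho_rev[OF Pt[OF ij(1)]] by simp
      ultimately have "?act (inv\<^bsub>Gam k\<^esub> (rho k col (Pt ?i))) (?act (col e) (q ?j)) = cen (comp_of ?i)"
        by (simp add: act_mult[OF index c] q_def cij)
      then have "?act (rho k col (Pt ?i)) (?act (inv\<^bsub>Gam k\<^esub> (rho k col (Pt ?i))) (?act (col e) (q ?j))) = q ?i"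
        by (simp add: q_def)
      then show ?thesis
        unfolding act_inv'[OF index c rho_carrier[OF Pt[OF ij(1)]]]
        by (simp add: gap_def cact_def pos_x vec_x)
    qed
    moreover have "point x (base_vertex C) = point y (base_vertex C)" if C: "C \<in> ?N" for C
    proof -
      obtain u where u: "u \<in> verts G" "C = comp_of u" using C by (auto simp: conn_components_eq)
      let ?b = "base_vertex C"
      have b: "comp_of ?b = C" "?b \<in> verts G"
        using comp_of_base_vertex[OF u(1)] base_vertex_in_verts[OF u(1)] u(2) by simp_all
      \<comment> \<open>At the base vertex the chosen path is itself a loop, so it leaves
        \<open>cen C\<close> in place.\<close>
      have "rho k col (Pt ?b) \<in> \<Delta> ?b"
        using Pt[OF b(2)] by (auto simp: b(1) rho_pi1_def)
      then have "q ?b = cen C" using cen C by (simp add: q_def b(1))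
      then show ?thesis using cenN[OF C] by (simp add: pos_x)
    qed
    ultimately show "\<exists>x. (\<forall>s\<in>?S. s x = 0) \<and> (\<forall>q\<in>Q. x q = y q)"
      unfolding S0 Q_iff using v(1) by (intro exI[of _ x]) (simp add: vec_x)
  qed
  have "(\<Sum>C\<in>conn_components G. int (T_val k (\<Delta> (base_vertex C)))) = 2 * int (card ?N)"
  proof -
    have "(\<Sum>C\<in>conn_components G. int (T_val k (\<Delta> (base_vertex C))))
        = (\<Sum>C\<in>conn_components G. if T_val k (\<Delta> (base_vertex C)) = 2 then 2 else 0)"
      by (rule sum.cong) (auto simp: T_val_def)
    also have "\<dots> = (\<Sum>C\<in>?N. 2)" using finite_conn_components by (simp add: sum.If_cases Int_def)
    finally show ?thesis by simp
  qed
  then show ?thesis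
    using arg_cong[OF rank, of int] arg_cong[OF B(2), of int]
    by (simp add: h_count_def cardQ card_unk_index)
qed

end

section \<open>Generic directions\<close>

context colored_digraph
begin

abbreviation "I \<equiv> unk_index k (verts G)"
abbreviation "grow \<equiv> edge_row (gap1 k G col) (gap2 k G col)"
abbreviation "gfam \<equiv> row_family (gap1 k G col) (gap2 k G col)"

definition gap_rank :: "'b set \<Rightarrow> nat" where
  "gap_rank F = fn.dim (\<Union>e\<in>F. {gap1 k G col e, gap2 k G col e})"

lemma finite_I: "finite I"
  by (simp add: finite_unk_index)

lemma gap_span: "e \<in> arcs G \<Longrightarrow> gap1 k G col e \<in> fn.span (coords I)"
  "e \<in> arcs G \<Longrightarrow> gap2 k G col e \<in> fn.span (coords I)"
  by (rule gap_in_span; simp)+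

lemma grow_span: "e \<in> arcs G \<Longrightarrow> grow d e \<in> fn.span (coords I)"
  by (intro row_in_span gap_span)

lemma gap_rank_subgraph:
  assumes "subgraph G' G"
  shows "int (gap_rank (arcs G')) = h_count k G' col + 1"
proof -
  have th: "tail G' = tail G" "head G' = head G" and sub: "verts G' \<subseteq> verts G" "arcs G' \<subseteq> arcs G"
    and wf: "wf_digraph G'"
    using assms by (auto simp: subgraph_def compatible_def)
  have "fin_digraph G'"
    by (rule fin_digraph.intro[OF wf fin_digraph_axioms.intro[OF
          finite_subset[OF sub(1) finite_verts] finite_subset[OF sub(2) finite_arcs]]])
  moreover have "col \<in> arcs G' \<rightarrow> carrier (Gam k)" using sub(2) col_carrier by blast
  ultimately have "colored_digraph G' k col"
    using index by (simp add: colored_digraph_iff colored_graph_def)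
  then interpret G': colored_digraph G' k col .
  have "gap1 k G' col = gap1 k G col" "gap2 k G' col = gap2 k G col"
    by (simp_all add: gap1_def gap2_def gap_def th fun_eq_iff)
  then show ?thesis using G'.dim_gaps by (simp add: gap_rank_def)
qed

text \<open>\<open>gap_rank\<close> sees the arcs alone, so the vertex set of a subgraph makes no
  difference, and every set of arcs occurs as a subgraph on all vertices.\<close>

lemma colored_laman_iff:
  "colored_laman k G col \<longleftrightarrow> int (card (arcs G)) = laman_count k G \<and>
     (\<forall>F \<subseteq> arcs G. F \<noteq> {} \<longrightarrow> card F + 1 \<le> gap_rank F)"
proof -
  have sub: "subgraph (G\<lparr>arcs := F\<rparr>) G" if "F \<subseteq> arcs G" for F
    using that wf_digraph by (auto simp: subgraph_def compatible_def wf_digraph_def)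
  have le: "int (card (arcs G')) \<le> h_count k G' col \<longleftrightarrow> card (arcs G') + 1 \<le> gap_rank (arcs G')"
    if "subgraph G' G" for G'
    using gap_rank_subgraph[OF that] by linarith
  have "(\<forall>G'. subgraph G' G \<and> arcs G' \<noteq> {} \<longrightarrow> int (card (arcs G')) \<le> h_count k G' col) \<longleftrightarrow>
      (\<forall>F \<subseteq> arcs G. F \<noteq> {} \<longrightarrow> card F + 1 \<le> gap_rank F)" (is "?L \<longleftrightarrow> ?R")
  proof
    assume L: ?L
    show ?R
    proof (intro allI impI)
      fix F assume F: "F \<subseteq> arcs G" "F \<noteq> {}"
      then have "int (card (arcs (G\<lparr>arcs := F\<rparr>))) \<le> h_count k (G\<lparr>arcs := F\<rparr>) col"
        using L sub[OF F(1)] by (metis pre_digraph.select_convs(2) pre_digraph.surjective pre_digraph.update_convs(2))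
      then show "card F + 1 \<le> gap_rank F"
        using le[OF sub[OF F(1)]] by simp
    qed
  next
    assume R: ?R
    show ?L
    proof (intro allI impI)
      fix G' :: "('a, 'b) pre_digraph" assume G': "subgraph G' G \<and> arcs G' \<noteq> {}"
      then have "arcs G' \<subseteq> arcs G" by (simp add: subgraph_def)
      then show "int (card (arcs G')) \<le> h_count k G' col"
        using R G' le[of G'] by blast
    qed
  qed
  then show ?thesis unfolding colored_laman_def by blast
qed

text \<open>Fixing one point removes the translations of \<open>\<Gamma>\<^sub>1\<close>; for \<open>k \<ge> 2\<close> they are removed by
  placing the centre of \<open>\<Phi> r\<^sub>k\<close> at the origin.\<close>

definition pins :: "'a \<Rightarrow> (('a + bool) \<times> bool) set" where
  "pins v = (if k = 1 then {Inl v} \<times> UNIV else {})"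

lemma finite_pins: "finite (pins v)"
  by (simp add: pins_def)

lemma pins_subset: "v \<in> verts G \<Longrightarrow> pins v \<subseteq> I"
  by (auto simp: pins_def unk_index_def)

text \<open>\<open>T\<close> of the whole group is 2 for \<open>k = 1\<close> and 0 otherwise,
  exactly the number of pinned coordinates; the remaining 1 is the scaling.\<close>

lemma card_I: "int (card I) = laman_count k G + 1 + int (card (pins v))"
proof -
  have "T_val k (carrier (Gam k)) = card (pins v)"
  proof (cases "k = 1")
    case True
    then show ?thesis unfolding T_val_eq[OF index] pins_def by (auto simp: Gam_carrier card_cartesian_product)
  next
    case False
    then have "1 < k" using k_pos by simp
    then have "\<exists>h\<in>carrier (Gam k). snd h \<noteq> 0"
      by (intro bexI[of _ "((0, 0), 1)"]) (auto simp: Gam_carrier)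
    then show ?thesis unfolding T_val_eq[OF index] using False by (simp add: pins_def)
  qed
  then show ?thesis
    by (simp add: laman_count_def card_unk_index rep_translation_part[OF index])
qed

text \<open>The candidates for an additional functional: gaps, whose nonvanishing keeps edges from
  collapsing, and the two coordinates of the first lattice vector, for nontriviality.\<close>

definition ext :: "((('a + bool) \<times> bool \<Rightarrow> real) \<Rightarrow> real) set" where
  "ext = (\<Union>e\<in>arcs G. {gap1 k G col e, gap2 k G col e}) \<union> coords ({Inr False} \<times> UNIV)"

lemma finite_ext: "finite ext"
  by (simp add: ext_def coords_def)

lemma ext_span: "ext \<subseteq> fn.span (coords I)"
proof -
  have "coords ({Inr False} \<times> UNIV) \<subseteq> fn.span (coords I)"
    by (force simp: coords_def unk_index_def vec_index_def intro!: coord_in_span[unfolded coords_def])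
  then show ?thesis using gap_span by (auto simp: ext_def)
qed

text \<open>For \<open>k = 1\<close> all functionals are invariant under a common translation of the points.\<close>

lemma pins_dual:
  assumes "q \<in> pins v"
  shows "\<exists>x. (\<forall>y\<in>ext. y x = 0) \<and> x q = 1 \<and> (\<forall>p\<in>pins v. p \<noteq> q \<longrightarrow> x p = 0)"
proof -
  obtain s where q: "k = 1" "q = (Inl v, s)" using assms by (auto simp: pins_def split: if_splits)
  define x :: "('a + bool) \<times> bool \<Rightarrow> real" where
    "x p = (case p of (Inl u, s') \<Rightarrow> if s' = s then 1 else 0 | (Inr b, s') \<Rightarrow> 0)" for p
  have vec0: "lvec x b = 0" for b by (simp add: lvec_def unk_def x_def zero_complex.code)
  then have "vec2 k (lvec x) = 0" by (simp add: vec2_def)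
  moreover have "point x u = point x v" for u by (simp add: point_def unk_def x_def)
  moreover have "zeta k = 1" using q(1) zeta_simps(1) by simp
  ultimately have "gap k G col e x = 0" for e
    using vec0 by (simp add: gap_def cact_def act_def lat_def) metis
  then have "\<forall>y\<in>ext. y x = 0" by (auto simp: ext_def gap_eq_0 coords_def x_def)
  moreover have "pins v = {Inl v} \<times> UNIV" unfolding pins_def using q(1) by simp
  then have "x q = 1" "\<forall>p\<in>pins v. p \<noteq> q \<longrightarrow> x p = 0" using q(2) by (auto simp: x_def)
  ultimately show ?thesis by blast
qed

text \<open>By \<open>pins_dual\<close> the pinned coordinates are independent of all gap
  functionals and take up \<open>card (pins v)\<close> of the \<open>card I\<close> dimensions.
  Together with the counts this bounds the number of edges from above.\<close>

lemma gap_rank_le: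
  assumes "v \<in> verts G"
  shows "int (gap_rank (arcs G)) \<le> laman_count k G + 1"
proof -
  let ?S = "\<Union>e\<in>arcs G. {gap1 k G col e, gap2 k G col e}"
  obtain B where B: "B \<subseteq> ?S" "fn.independent B" "?S \<subseteq> fn.span B" "card B = fn.dim ?S"
    using fn.basis_exists by blast
  have fin: "finite B" using B(1) finite_subset[of B ?S] by simp
  have Bext: "B \<subseteq> ext" using B(1) by (auto simp: ext_def)
  have "indep_fam B (\<lambda>b. b)" using indep_fam_iff[OF fin, of "\<lambda>b. b"] B(2) by (simp add: inj_on_def)
  moreover have "\<exists>x. (\<forall>s\<in>B. s x = 0) \<and> x q = 1 \<and> (\<forall>p\<in>pins v. p \<noteq> q \<longrightarrow> x p = 0)"
    if "q \<in> pins v" for q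
    using pins_dual[OF that] Bext by blast
  ultimately have ind: "indep_fam (B <+> pins v) (case_sum (\<lambda>b. b) (\<lambda>q x. x q))"
    by (intro indep_fam_coords fin finite_pins)
  have "case_sum (\<lambda>b. b) (\<lambda>q x. x q) ` (B <+> pins v) \<subseteq> fn.span (coords I)"
    using Bext ext_span pins_subset[OF assms] coord_in_span[of _ I] by auto
  then have "fn.dim (case_sum (\<lambda>b. b) (\<lambda>q x. x q) ` (B <+> pins v)) \<le> card I"
    by (rule dim_le_coords[OF finite_I])
  moreover have "inj_on (case_sum (\<lambda>b. b) (\<lambda>q x. x q)) (B <+> pins v)"
    "fn.independent (case_sum (\<lambda>b. b) (\<lambda>q x. x q) ` (B <+> pins v))"
    using iffD1[OF indep_fam_iff ind] fin finite_pins by auto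
  then have "fn.dim (case_sum (\<lambda>b. b) (\<lambda>q x. x q) ` (B <+> pins v)) = card (B <+> pins v)"
    by (intro trans[OF fn.dim_eq_card_independent card_image])
  ultimately have "card B + card (pins v) \<le> card I"
    using card_Plus[OF fin finite_pins, of v] by simp
  then show ?thesis using card_I[of v] B(4) by (simp add: gap_rank_def)
qed

definition generic :: "('b \<Rightarrow> real^2) \<Rightarrow> bool" where
  "generic d \<longleftrightarrow> (\<forall>F Y. F \<subseteq> arcs G \<longrightarrow> Y \<subseteq> ext \<longrightarrow> (\<exists>d0. indep_fam (F <+> Y) (gfam d0)) \<longrightarrow>
    indep_fam (F <+> Y) (gfam d))"

lemma generic_exists:
  "\<exists>Z. proper_algebraic_subset (arcs G) Z \<and> (\<forall>d \<in> arcs G \<rightarrow>\<^sub>E UNIV. d \<notin> Z \<longrightarrow> generic d)"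
  unfolding generic_def by (rule generic_rows) (auto simp: finite_ext)

definition solution :: "('b \<Rightarrow> real^2) \<Rightarrow> (('a + bool) \<times> bool \<Rightarrow> real) \<Rightarrow> bool" where
  "solution d x \<longleftrightarrow> (\<forall>e\<in>arcs G. grow d e x = 0)"

lemma solution_counts:
  assumes gen: "generic d" and x: "solution d x" "\<And>e. e \<in> arcs G \<Longrightarrow> gap k G col e x \<noteq> 0"
  shows "\<forall>F \<subseteq> arcs G. F \<noteq> {} \<longrightarrow> card F + 1 \<le> gap_rank F"
proof (rule ccontr)
  let ?bad = "\<lambda>F. F \<subseteq> arcs G \<and> F \<noteq> {} \<and> gap_rank F \<le> card F"
  assume "\<not> ?thesis"
  then have "\<exists>F. ?bad F" unfolding not_all not_imp not_le Suc_eq_plus1[symmetric] less_Suc_eq_le by blast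
  then obtain F1 where "?bad F1" by blast
  then obtain F where F: "?bad F" and least: "\<forall>F'. ?bad F' \<longrightarrow> card F \<le> card F'"
    using ex_has_least_nat[of ?bad F1 card] by blast
  have minF: "\<not> ?bad F'" if "card F' < card F" for F'
    using least[rule_format, of F'] that by linarith
  have finF: "finite F" using F finite_subset[OF _ finite_arcs] by blast
  \<comment> \<open>By minimality every proper nonempty subset of \<open>F\<close> satisfies the
    strict count, so any \<open>gap_rank F\<close> edges of \<open>F\<close> are generically
    independent.\<close>
  obtain F0 where F0: "F0 \<subseteq> F" "card F0 = gap_rank F" "finite F0"
    using obtain_subset_with_card_n[of "gap_rank F" F] F by blast
  have cond: "card F' + card T' \<le>
      fn.dim ((\<Union>e\<in>F'. {gap1 k G col e, gap2 k G col e}) \<union> (\<Union>t\<in>T'. {}))"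
    if F': "F' \<subseteq> F0" and T': "T' \<subseteq> ({} :: unit set)" for F' T'
  proof -
    have "card F' \<le> gap_rank F'"
    \<comment> \<open>\<open>F' = F\<close> arises only if \<open>F0\<close> is all of
      \<open>F\<close>, and then cardinality and rank agree.\<close>
    proof (cases "F' = {} \<or> F' = F")
      case True
      then show ?thesis using F0 F' by (auto simp: card_mono)
    next
      case False
      then have "card F' < card F" using F' F0(1) finF by (intro psubset_card_mono) auto
      then show ?thesis using minF[of F'] False F' F0(1) F by force
    qed
    then show ?thesis using T' by (simp add: gap_rank_def)
  qed
  obtain y :: "unit \<Rightarrow> (('a + bool) \<times> bool \<Rightarrow> real) \<Rightarrow> real" and d0
    where "indep_fam (F0 <+> y ` {}) (gfam d0)"
    using row_transversal[OF F0(3), of "{}" "\<lambda>_. {}" "gap1 k G col" "gap2 k G col", OF _ _ cond] by auto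
  then have ex: "\<exists>d0. indep_fam (F0 <+> {}) (gfam d0)" unfolding image_empty by blast
  have "F0 \<subseteq> arcs G" using F0(1) F by blast
  then have ind: "indep_fam (F0 <+> {}) (gfam d)"
    by (rule gen[unfolded generic_def, rule_format, OF _ empty_subsetI ex])
  let ?R = "gfam d ` (F0 <+> {})" and ?W = "\<Union>e\<in>F. {gap1 k G col e, gap2 k G col e}"
  have R: "inj_on (gfam d) (F0 <+> {})" "fn.independent ?R"
    using ind indep_fam_iff[of "F0 <+> {}"] F0(3) by auto
  have cardR: "card ?R = fn.dim ?W"
    using card_image[OF R(1)] F0(2) card_Plus[OF F0(3), of "{}"] by (simp add: gap_rank_def)
  have subR: "?R \<subseteq> fn.span ?W"
  proof
    fix r assume "r \<in> ?R"
    then obtain e where e: "e \<in> F" "r = grow d e" using F0(1) by (auto simp: row_family_def)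
    show "r \<in> fn.span ?W"
      unfolding e(2) using e(1) by (intro row_in_span fn.span_base) auto
  qed
  have sp: "?W \<subseteq> fn.span ?R"
    by (rule fn.independent_card_dim_spans[OF _ subR R(2) cardR]) (use finF in simp)
  have Rx: "\<forall>r\<in>?R. r x = 0"
    using x(1) F0(1) F by (auto simp: row_family_def solution_def)
  obtain e where e: "e \<in> F" using F by blast
  then have "gap1 k G col e \<in> fn.span ?R" "gap2 k G col e \<in> fn.span ?R" using sp by auto
  from this[THEN span_vanish, OF Rx] have "gap k G col e x = 0"
    unfolding gap_eq_0 by blast
  then show False using x(2) e F by blast
qed

text \<open>The rows, \<open>y\<close> and the pinned coordinates are independent and as many as the
  unknowns, hence a basis of the linear forms on \<open>I\<close>; a common zero kills every
  coordinate.\<close>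

lemma indep_kernel_trivial:
  assumes v: "v \<in> verts G" and y: "y \<in> ext" and ind: "indep_fam (arcs G <+> {y}) (gfam d)"
    and card: "int (card (arcs G)) = laman_count k G"
    and x: "solution d x" "y x = 0" "\<forall>q\<in>pins v. x q = 0"
  shows "\<forall>i\<in>I. x i = 0"
proof -
  let ?S = "arcs G <+> {y}"
  let ?r = "case_sum (gfam d) (\<lambda>q x. x q)"
  have finS: "finite ?S" by simp
  have vanish: "gfam d s x = 0" if "s \<in> ?S" "\<forall>z\<in>ext. z x = 0" for s x
    using that(1)
  proof (rule PlusE)
    fix e assume "e \<in> arcs G" "s = Inl e"
    moreover from this have "gap1 k G col e x = 0" "gap2 k G col e x = 0"
      using that(2) by (auto simp: ext_def)
    ultimately show ?thesis by (simp add: row_family_def edge_row_def)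
  next
    fix z assume "z \<in> {y}" "s = Inr z"
    then show ?thesis using that(2) y by (simp add: row_family_def)
  qed
  have "\<exists>x. (\<forall>s\<in>?S. gfam d s x = 0) \<and> x q = 1 \<and> (\<forall>p\<in>pins v. p \<noteq> q \<longrightarrow> x p = 0)"
    if "q \<in> pins v" for q
    using pins_dual[OF that] vanish by blast
  then have "indep_fam (?S <+> pins v) ?r"
    by (intro indep_fam_coords finS finite_pins ind)
  then have inj: "inj_on ?r (?S <+> pins v)" and indR: "fn.independent (?r ` (?S <+> pins v))"
    using indep_fam_iff[of "?S <+> pins v" ?r] finite_pins by auto
  have sub: "?r ` (?S <+> pins v) \<subseteq> fn.span (coords I)"
    using y ext_span pins_subset[OF v] coord_in_span[of _ I] grow_span
    by (auto simp: row_family_def)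
  have cardR: "int (card (?r ` (?S <+> pins v))) = int (card I)"
    using card_image[OF inj] card_Plus[OF finS finite_pins, of v] card_Plus[of "arcs G" "{y}"] card card_I[of v]
    by simp
  have sp: "coords I \<subseteq> fn.span (?r ` (?S <+> pins v))"
  proof (rule fn.independent_card_dim_spans[OF _ sub indR])
    show "finite (coords I)" using finite_I by (simp add: coords_def)
    show "card (?r ` (?S <+> pins v)) = fn.dim (coords I)"
      using cardR dim_coords[OF finite_I] by simp
  qed
  have van: "\<forall>f \<in> ?r ` (?S <+> pins v). f x = 0"
    using x by (auto simp: row_family_def solution_def)
  show ?thesis
  proof
    fix i assume "i \<in> I"
    then have "(\<lambda>x. x i) \<in> fn.span (?r ` (?S <+> pins v))" using sp by (auto simp: coords_def)
    from span_vanish[OF this van] show "x i = 0" .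
  qed
qed

text \<open>The slack 1 in the counts absorbs one more functional. A set \<open>A\<close> is offered
  rather than a single functional, since a complex gap is nonzero as soon as one of its two parts
  is.\<close>

lemma generic_extension:
  assumes gen: "generic d" and counts: "\<forall>F \<subseteq> arcs G. F \<noteq> {} \<longrightarrow> card F + 1 \<le> gap_rank F"
    and A: "A \<subseteq> ext" "1 \<le> fn.dim A"
  shows "\<exists>y\<in>A. indep_fam (arcs G <+> {y}) (gfam d)"
proof -
  have finA: "finite A" using A(1) finite_ext finite_subset by blast
  have cond: "card F' + card T' \<le>
      fn.dim ((\<Union>e\<in>F'. {gap1 k G col e, gap2 k G col e}) \<union> (\<Union>t\<in>T'. A))"
    if F': "F' \<subseteq> arcs G" and T': "T' \<subseteq> {()}" for F' T'
  proof (cases "F' = {}")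
    case True
    have "T' = {} \<or> T' = {()}" using T' by blast
    then show ?thesis using True A(2) by (elim disjE) simp_all
  next
    case False
    have fin: "finite F'" using F' finite_subset[OF _ finite_arcs] by blast
    have "card T' \<le> 1" using T' card_mono[of "{()}" T'] by simp
    then have "card F' + card T' \<le> gap_rank F'" using counts F' False by (metis add_left_mono order_trans)
    also have "\<dots> \<le> fn.dim ((\<Union>e\<in>F'. {gap1 k G col e, gap2 k G col e}) \<union> (\<Union>t\<in>T'. A))"
      unfolding gap_rank_def using fin finA T'
      by (intro fn.dim_mono_finite) (auto intro: fn.span_base finite_subset)
    finally show ?thesis .
  qed
  obtain y d0 where y: "y () \<in> A" "indep_fam (arcs G <+> y ` {()}) (gfam d0)"
    using row_transversal[of "arcs G" "{()}" "\<lambda>_. A" "gap1 k G col" "gap2 k G col", OF _ _ _ cond] finA by auto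
  then have ex: "\<exists>d0. indep_fam (arcs G <+> {y ()}) (gfam d0)" by auto
  have "{y ()} \<subseteq> ext" using y(1) A(1) by blast
  then have "indep_fam (arcs G <+> {y ()}) (gfam d)"
    by (rule gen[unfolded generic_def, rule_format, OF subset_refl _ ex])
  then show ?thesis using y(1) by blast
qed

lemma solution_exists_unique:
  assumes gen: "generic d" and laman: "colored_laman k G col" and v: "v \<in> verts G"
  shows "\<exists>x. solution d x \<and> (\<forall>q\<in>pins v. x q = 0) \<and> (\<forall>e\<in>arcs G. gap k G col e x \<noteq> 0) \<and> lvec x False \<noteq> 0 \<and>
    (\<forall>x'. solution d x' \<longrightarrow> (\<forall>q\<in>pins v. x' q = 0) \<longrightarrow> (\<exists>c. \<forall>i\<in>I. x' i = c * x i))"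
proof -
  have card: "int (card (arcs G)) = laman_count k G"
    and counts: "\<forall>F \<subseteq> arcs G. F \<noteq> {} \<longrightarrow> card F + 1 \<le> gap_rank F"
    using laman colored_laman_iff by auto
  let ?S = "grow d ` arcs G \<union> coords (pins v)"
  have "card ?S \<le> card (arcs G) + card (pins v)"
    using card_Un_le[of "grow d ` arcs G" "coords (pins v)"] card_image_le[of "arcs G" "grow d"]
      card_coords[of "pins v"] by simp
  \<comment> \<open>The equations and pins fall short of the unknowns by one, the scaling.\<close>
  then have "card ?S < card I" using card card_I[of v] by linarith
  moreover have "?S \<subseteq> fn.span (coords I)"
    using grow_span pins_subset[OF v] coord_in_span[of _ I] by (auto simp: coords_def[of "pins v"])
  ultimately obtain x where x: "\<exists>i\<in>I. x i \<noteq> 0" "\<forall>s\<in>?S. s x = 0"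
    using homogeneous_system[OF finite_I, of ?S] finite_pins by (auto simp: coords_def[of "pins v"])
  have sol: "solution d x" and pin: "\<forall>q\<in>pins v. x q = 0"
    using x(2) by (auto simp: solution_def coords_def)
  have nz: "y x \<noteq> 0" if "y \<in> ext" "indep_fam (arcs G <+> {y}) (gfam d)" for y
    using indep_kernel_trivial[OF v that card sol _ pin] x(1) by blast
  have gaps: "gap k G col e x \<noteq> 0" if e: "e \<in> arcs G" for e
  proof -
    have "1 \<le> fn.dim {gap1 k G col e, gap2 k G col e}"
      using counts[rule_format, of "{e}"] e by (simp add: gap_rank_def)
    then obtain y where "y \<in> {gap1 k G col e, gap2 k G col e}" "indep_fam (arcs G <+> {y}) (gfam d)"
      using generic_extension[OF gen counts, of "{gap1 k G col e, gap2 k G col e}"] e by (auto simp: ext_def)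
    then show ?thesis using nz[of y] e by (auto simp: gap_eq_0 ext_def)
  qed
  let ?V = "{Inr False :: 'a + bool} \<times> (UNIV :: bool set)"
  have "1 \<le> fn.dim (coords ?V)"
    by (subst dim_coords) (auto simp: card_cartesian_product)
  then obtain y where y: "y \<in> coords ?V" "indep_fam (arcs G <+> {y}) (gfam d)"
    using generic_extension[OF gen counts, of "coords ?V"] by (auto simp: ext_def)
  then have yext: "y \<in> ext" by (simp add: ext_def)
  have yx: "y x \<noteq> 0" by (rule nz[OF yext y(2)])
  then have lvec: "lvec x False \<noteq> 0"
    using y(1) by (auto simp: coords_def lvec_def unk_def complex_eq_iff) (metis (full_types))+
  have "\<exists>c. \<forall>i\<in>I. x' i = c * x i" if x': "solution d x'" "\<forall>q\<in>pins v. x' q = 0" for x'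
  proof -
    \<comment> \<open>The combination of the two solutions on which \<open>y\<close> vanishes; it
      must be zero, which yields the factor \<open>y x' / y x\<close>.\<close>
    let ?z = "\<lambda>i. y x * x' i + (- y x') * x i"
    have lin: "s ?z = y x * s x' + (- y x') * s x" if "s \<in> fn.span (coords I)" for s
      by (rule span_coords_linear[OF that])
    have "\<forall>i\<in>I. ?z i = 0"
    proof (rule indep_kernel_trivial[OF v yext y(2) card])
      show "solution d ?z"
        unfolding solution_def using lin[OF grow_span] sol x'(1) by (simp add: solution_def)
      show "y ?z = 0" using lin[of y] ext_span yext by auto
      show "\<forall>q\<in>pins v. ?z q = 0" using pin x'(2) by simp
    qed
    then have "x' i = (y x' / y x) * x i" if "i \<in> I" for i
      using that yx by (auto simp: field_simps)
    then show ?thesis by blast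
  qed
  then show ?thesis using sol pin gaps lvec by blast
qed

text \<open>Even with the coordinate \<open>i\<close> held fixed there are more unknowns than
  equations, so \<open>x\<close> can be moved along a nonzero solution \<open>z\<close> with
  \<open>z i = 0\<close>. Keeping a nonzero coordinate rules out a mere rescaling.\<close>

lemma solution_not_unique:
  assumes v: "v \<in> verts G" and few: "int (card (arcs G)) < laman_count k G"
    and x: "solution d x" "\<forall>q\<in>pins v. x q = 0" "\<And>e. e \<in> arcs G \<Longrightarrow> gap k G col e x \<noteq> 0"
    and i: "i \<in> I" "x i \<noteq> 0"
  shows "\<exists>x'. solution d x' \<and> (\<forall>q\<in>pins v. x' q = 0) \<and> (\<forall>e\<in>arcs G. gap k G col e x' \<noteq> 0) \<and>
    x' i = x i \<and> (\<exists>j\<in>I. x' j \<noteq> x j)"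
proof -
  let ?S = "grow d ` arcs G \<union> coords (insert i (pins v))"
  have "card ?S \<le> card (arcs G) + card (pins v) + 1"
    using card_Un_le[of "grow d ` arcs G" "coords (insert i (pins v))"] card_image_le[of "arcs G" "grow d"]
      card_coords[of "insert i (pins v)"] card_insert_le_m1[of "card (pins v) + 1" "pins v" i] by simp
  then have "card ?S < card I" using few card_I[of v] by linarith
  moreover have "?S \<subseteq> fn.span (coords I)"
    using grow_span pins_subset[OF v] coord_in_span[of _ I] i(1) by (auto simp: coords_def[of "insert i (pins v)"])
  ultimately obtain z where z: "\<exists>i\<in>I. z i \<noteq> 0" "\<forall>s\<in>?S. s z = 0"
    using homogeneous_system[OF finite_I, of ?S] finite_pins by (auto simp: coords_def[of "insert i (pins v)"])
  have zs: "solution d z" "\<forall>q\<in>pins v. z q = 0" "z i = 0"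
    using z(2) by (auto simp: solution_def coords_def)
  have lin: "s (\<lambda>j. 1 * x j + \<epsilon> * z j) = 1 * s x + \<epsilon> * s z" if "s \<in> fn.span (coords I)" for s \<epsilon>
    by (rule span_coords_linear[OF that])
  have gap_lin: "gap k G col e (\<lambda>j. 1 * x j + \<epsilon> * z j) = gap k G col e x + of_real \<epsilon> * gap k G col e z"
    if "e \<in> arcs G" for e \<epsilon>
    using lin[OF gap_span(1)[OF that], of \<epsilon>] lin[OF gap_span(2)[OF that], of \<epsilon>]
    by (simp add: gap1_def gap2_def complex_eq_iff)
  \<comment> \<open>Each edge forbids at most one real parameter; 0 is forbidden so that the
    solution really moves.\<close>
  let ?bad = "insert 0 ((\<lambda>e. Re (- gap k G col e x / gap k G col e z)) ` arcs G)"
  have "finite ?bad" by simp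
  from ex_new_if_finite[OF infinite_UNIV_char_0 this]
  obtain \<epsilon> where e: "\<epsilon> \<notin> ?bad" by blast
  let ?x = "\<lambda>j. 1 * x j + \<epsilon> * z j"
  have "gap k G col e ?x \<noteq> 0" if ea: "e \<in> arcs G" for e
  proof
    assume "gap k G col e ?x = 0"
    then have *: "gap k G col e x + of_real \<epsilon> * gap k G col e z = 0" using gap_lin[OF ea] by simp
    then have "gap k G col e z \<noteq> 0" using x(3)[OF ea] by auto
    then have "of_real \<epsilon> = - gap k G col e x / gap k G col e z"
      using * by (simp add: field_simps add_eq_0_iff)
    then have "\<epsilon> = Re (- gap k G col e x / gap k G col e z)" by (metis Re_complex_of_real)
    then show False using e ea by blast
  qed
  moreover have "solution d ?x"
    using x(1) zs(1) lin[OF grow_span] by (simp add: solution_def)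
  moreover have "\<forall>q\<in>pins v. ?x q = 0" using x(2) zs(2) by simp
  moreover have "?x i = x i" using zs(3) by simp
  moreover have "\<exists>j\<in>I. ?x j \<noteq> x j" using z(1) e by auto
  ultimately show ?thesis by blast
qed

end

section \<open>Realizations\<close>

lemma euc_apply_eq: "euc_apply p y = fst p + snd p *v y"
  by (cases p) simp

lemma hom_euc_apply:
  assumes "\<Phi> \<in> hom (Gam k) Euc2" "g \<in> carrier (Gam k)" "h \<in> carrier (Gam k)"
  shows "euc_apply (\<Phi> (g \<otimes>\<^bsub>Gam k\<^esub> h)) y = euc_apply (\<Phi> g) (euc_apply (\<Phi> h) y)"
  unfolding euc_apply_eq hom_mult[OF assms] Euc2_mult
  by (simp add: matrix_vector_right_distrib matrix_vector_mul_assoc add.assoc)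

lemma euc_eqI:
  assumes "\<And>y. cx (euc_apply p y) = cx (euc_apply q y)"
  shows "p = q"
proof -
  have 1: "fst p = fst q" using assms[of 0] by (simp add: euc_apply_eq)
  have "snd p = snd q"
    by (rule matrix_eq_cx) (use assms 1 in \<open>simp add: euc_apply_eq\<close>)
  with 1 show ?thesis by (rule prod_eqI)
qed

text \<open>\<open>s\<close> is the centre of the rotation \<open>\<Phi> r\<^sub>k\<close>; for \<open>k = 1\<close> it is arbitrary.\<close>

lemma allowed_rep_form:
  assumes k: "gam_index k" and \<Phi>: "allowed_rep k \<Phi>"
  obtains v1 v2 s where "compat k v1 v2" "k = 1 \<Longrightarrow> s = s0"
    "\<And>g y. g \<in> carrier (Gam k) \<Longrightarrow> cx (euc_apply (\<Phi> g) y) = act k v1 v2 g (cx y - s) + s"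
proof -
  have k0: "0 < k" using k by auto
  have hom: "\<Phi> \<in> hom (Gam k) Euc2" using \<Phi> by (simp add: allowed_rep_def)
  note comp = hom_euc_apply[OF hom]
  obtain u1 u2 w where \<Phi>1: "\<Phi> t1 = (u1, mat 1)" and \<Phi>2: "\<Phi> t2 = (u2, mat 1)"
    and \<Phi>r: "2 \<le> k \<Longrightarrow> \<Phi> rgen = (w, Rot k)" and u2: "3 \<le> k \<Longrightarrow> u2 = Rot k *v u1"
    using \<Phi> by (auto simp: allowed_rep_def)
  define v1 v2 where v_def: "v1 = cx u1" "v2 = cx u2"
  have c: "compat k v1 v2" using u2 by (simp add: compat_def v_def cx_Rot)
  have tc: "(t, 0) \<in> carrier (Gam k)" for t using k0 by (simp add: Gam_carrier)
  define Q where "Q t \<longleftrightarrow> (\<forall>y. cx (euc_apply (\<Phi> (t, 0)) y) = lat v1 v2 t + cx y)" for t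
  \<comment> \<open>An equivalence, so that induction over the integers can step down as well as
    up.\<close>
  have add: "Q (s + t) \<longleftrightarrow> Q s" if "Q t" for s t
  proof -
    have step: "cx (euc_apply (\<Phi> (s + t, 0)) (cv (cx y - lat v1 v2 t))) = cx (euc_apply (\<Phi> (s, 0)) y)" for y
    proof -
      have "cx (euc_apply (\<Phi> (t, 0)) (cv (cx y - lat v1 v2 t))) = cx y"
        using that by (simp add: Q_def)
      then have "euc_apply (\<Phi> (t, 0)) (cv (cx y - lat v1 v2 t)) = y" by (simp only: cx_inject)
      then show ?thesis
        using comp[OF tc[of s] tc[of t]] by (simp add: Gam_mult_translation)
    qed
    have lat: "lat v1 v2 (s + t) = lat v1 v2 s + lat v1 v2 t"
      by (simp add: lat_def plus_prod_def algebra_simps)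
    show ?thesis
    proof
      assume Q: "Q (s + t)"
      show "Q s" unfolding Q_def using Q[unfolded Q_def] lat by (simp flip: step)
    next
      assume Q: "Q s"
      show "Q (s + t)"
        unfolding Q_def
      proof
        fix y
        have "cx (euc_apply (\<Phi> (s + t, 0)) (cv (cx (cv (cx y + lat v1 v2 t)) - lat v1 v2 t))) =
            lat v1 v2 s + (cx y + lat v1 v2 t)"
          unfolding step using Q[unfolded Q_def] by simp
        then show "cx (euc_apply (\<Phi> (s + t, 0)) y) = lat v1 v2 (s + t) + cx y"
          by (simp add: lat)
      qed
    qed
  qed
  have Q1: "Q (1, 0)" and Q2: "Q (0, 1)"
    using \<Phi>1 \<Phi>2 by (simp_all add: Q_def lat_def v_def t1_def t2_def)
  have Q0: "Q (0, 0)" using add[OF Q1, of "(0, 0)"] Q1 by simp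
  have Qa: "Q (a, 0)" for a
  proof (induction a rule: int_induct[where k = 0])
    case (step1 i)
    then show ?case using add[OF Q1, of "(i, 0)"] by simp
  next
    case (step2 i)
    then show ?case using add[OF Q1, of "(i - 1, 0)"] by simp
  qed (rule Q0)
  have Q: "Q (a, b)" for a b
  proof (induction b rule: int_induct[where k = 0])
    case (step1 i)
    then show ?case using add[OF Q2, of "(a, i)"] by simp
  next
    case (step2 i)
    then show ?case using add[OF Q2, of "(a, i - 1)"] by simp
  qed (rule Qa)
  \<comment> \<open>The fixed point of the map that sends \<open>y\<close> to
    \<open>cx w + zeta k * y\<close>; for \<open>k = 1\<close> the denominator would vanish and the
    freely chosen \<open>s0\<close> is taken.\<close>
  define s where "s = (if k = 1 then s0 else cx w / (1 - zeta k))"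
  have rot: "cx (euc_apply (\<Phi> ((0, 0), r)) y) = zeta k ^ r * (cx y - s) + s" if "r < k" for r y
    using that
  proof (induction r)
    case 0
    then show ?case using Q0 by (simp add: Q_def lat_def)
  next
    case (Suc r)
    then have k2: "2 \<le> k" by simp
    have z1: "1 - zeta k \<noteq> 0" using zeta_power_inj[of 1 k 0] k2 by auto
    have w: "cx w = (1 - zeta k) * s" using k2 z1 by (simp add: s_def)
    have carr: "rgen \<in> carrier (Gam k)" "((0, 0), r) \<in> carrier (Gam k)"
      using k2 Suc.prems by (simp_all add: rgen_def Gam_carrier)
    have "lattice_rot k (0, 0) = (0, 0)" by (simp add: lattice_rot_def)
    then have "((0, 0), Suc r) = rgen \<otimes>\<^bsub>Gam k\<^esub> ((0, 0), r)"
      using Suc.prems by (simp add: Gam_mult rgen_def)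
    then have "cx (euc_apply (\<Phi> ((0, 0), Suc r)) y) = cx w + zeta k * cx (euc_apply (\<Phi> ((0, 0), r)) y)"
      using comp[OF carr] \<Phi>r[OF k2] by (simp add: cx_Rot)
    then show ?case using Suc by (simp add: w algebra_simps)
  qed
  have form: "cx (euc_apply (\<Phi> g) y) = act k v1 v2 g (cx y - s) + s" if g: "g \<in> carrier (Gam k)" for g y
  proof -
    obtain a b r where gt: "g = ((a, b), r)" by (metis prod.collapse)
    have r: "r < k" using g by (simp add: gt Gam_carrier)
    then have rc: "((0, 0), r) \<in> carrier (Gam k)" by (simp add: Gam_carrier)
    have "g = ((a, b), 0) \<otimes>\<^bsub>Gam k\<^esub> ((0, 0), r)" using r by (simp add: gt Gam_mult)
    then have "cx (euc_apply (\<Phi> g) y) = cx (euc_apply (\<Phi> ((a, b), 0)) (euc_apply (\<Phi> ((0, 0), r)) y))"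
      using comp[OF tc rc] by simp
    also have "\<dots> = lat v1 v2 (a, b) + (zeta k ^ r * (cx y - s) + s)"
      using Q[of a b] rot[OF r] by (simp add: Q_def)
    finally show ?thesis by (simp add: gt act_def)
  qed
  have "k = 1 \<Longrightarrow> s = s0" by (simp add: s_def)
  from that[OF c this form] show ?thesis .
qed

definition mk_unk :: "('a \<Rightarrow> complex) \<Rightarrow> (bool \<Rightarrow> complex) \<Rightarrow> ('a + bool) \<times> bool \<Rightarrow> real" where
  "mk_unk q v = (\<lambda>(j, s). let z = (case j of Inl u \<Rightarrow> q u | Inr b \<Rightarrow> v b) in if s then Im z else Re z)"

lemma pos_mk_unk: "point (mk_unk q v) u = q u" and vec_mk_unk: "lvec (mk_unk q v) = v"
  by (simp_all add: mk_unk_def point_def lvec_def unk_def fun_eq_iff)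

lemma (in group_action) orbit_representative:
  assumes "(\<lambda>a. orbit G \<phi> (r a)) ` A = orbits G E \<phi>" "x \<in> E"
  obtains a g where "a \<in> A" "g \<in> carrier G" "x = \<phi> g (r a)"
proof -
  have "orbit G \<phi> x \<in> orbits G E \<phi>" using assms(2) by (auto simp: orbits_def)
  then obtain a where a: "a \<in> A" "orbit G \<phi> x = orbit G \<phi> (r a)" using assms(1) by blast
  then have "x \<in> orbit G \<phi> (r a)" using orbit_refl[OF assms(2)] by simp
  then show ?thesis using that[OF a(1)] by (auto simp: orbit_def)
qed

section \<open>Direction networks over a coloured quotient\<close>

locale colored_network = colored_digraph G k col
  for G :: "('a, 'b) pre_digraph" and k :: nat and col :: "'b \<Rightarrow> gam" +
  fixes N :: "('v, 'e) gam_graph" and d :: "'e \<Rightarrow> real^2" and vr :: "'a \<Rightarrow> 'v" and er :: "'b \<Rightarrow> 'e"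
  assumes net: "direction_network k N d" and quot: "colored_quotient k N G col vr er"
begin

definition dirs :: "'b \<Rightarrow> real^2" where
  "dirs = (\<lambda>e\<in>arcs G. d (er e))"

lemma free: "free_gam_graph k N"
  using net by (simp add: direction_network_def)

sublocale na: group_action "Gam k" "nodes N" "nact N"
  using free by (simp add: free_gam_graph_def)

sublocale ea: group_action "Gam k" "edges N" "eact N"
  using free by (simp add: free_gam_graph_def)

lemma vr_node: "u \<in> verts G \<Longrightarrow> vr u \<in> nodes N"
  and er_edge: "a \<in> arcs G \<Longrightarrow> er a \<in> edges N"
  using quot by (auto simp: colored_quotient_def)

lemma ends_er: "a \<in> arcs G \<Longrightarrow> ends N (er a) = {vr (tail G a), nact N (col a) (vr (head G a))}"
  using quot by (auto simp: colored_quotient_def)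

lemma node_cases:
  assumes "i \<in> nodes N"
  obtains u g where "u \<in> verts G" "g \<in> carrier (Gam k)" "i = nact N g (vr u)"
proof -
  have "(\<lambda>u. orbit (Gam k) (nact N) (vr u)) ` verts G = orbits (Gam k) (nodes N) (nact N)"
    using quot by (simp add: colored_quotient_def bij_betw_def)
  from na.orbit_representative[OF this assms] show ?thesis using that .
qed

lemma edge_cases:
  assumes "e \<in> edges N"
  obtains a g where "a \<in> arcs G" "g \<in> carrier (Gam k)" "e = eact N g (er a)"
proof -
  have "(\<lambda>a. orbit (Gam k) (eact N) (er a)) ` arcs G = orbits (Gam k) (edges N) (eact N)"
    using quot by (simp add: colored_quotient_def bij_betw_def)
  from ea.orbit_representative[OF this assms] show ?thesis using that .
qed

text \<open>Freeness of the action and one representative per orbit make the coordinates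
  \<open>(u, g)\<close> of a node unique; placing all nodes from the positions of the
  representatives relies on this.\<close>

lemma node_unique:
  assumes u: "u \<in> verts G" "u' \<in> verts G" and g: "g \<in> carrier (Gam k)" "g' \<in> carrier (Gam k)"
    and eq: "nact N g (vr u) = nact N g' (vr u')"
  shows "u = u' \<and> g = g'"
proof -
  let ?h = "inv\<^bsub>Gam k\<^esub> g' \<otimes>\<^bsub>Gam k\<^esub> g"
  have hc: "?h \<in> carrier (Gam k)" using g by simp
  have h: "nact N ?h (vr u) = vr u'"
    using na.composition_rule[OF vr_node[OF u(1)], of "inv\<^bsub>Gam k\<^esub> g'" g] g
      na.orbit_sym_aux[OF g(2) vr_node[OF u(2)] eq[symmetric]] by simp
  have sub: "orbit (Gam k) (nact N) y \<subseteq> orbit (Gam k) (nact N) x"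
    if "x \<in> nodes N" "l \<in> carrier (Gam k)" "nact N l x = y" for x y l
  proof
    fix z assume "z \<in> orbit (Gam k) (nact N) y"
    then obtain m where m: "m \<in> carrier (Gam k)" "z = nact N m y" by (auto simp: orbit_def)
    then have "z = nact N (m \<otimes>\<^bsub>Gam k\<^esub> l) x"
      using na.composition_rule[OF that(1) m(1) that(2)] that(3) by simp
    then show "z \<in> orbit (Gam k) (nact N) x"
      unfolding orbit_def using gam.m_closed[OF m(1) that(2)] by blast
  qed
  have "orbit (Gam k) (nact N) (vr u) = orbit (Gam k) (nact N) (vr u')"
    using sub[OF vr_node[OF u(1)] hc h]
      sub[OF vr_node[OF u(2)] gam.inv_closed[OF hc] na.orbit_sym_aux[OF hc vr_node[OF u(1)] h]] by blast
  moreover have "inj_on (\<lambda>u. orbit (Gam k) (nact N) (vr u)) (verts G)"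
    using quot by (simp add: colored_quotient_def bij_betw_def)
  ultimately have uu: "u = u'" using u by (auto dest: inj_onD)
  then have "?h \<in> stabilizer (Gam k) (nact N) (vr u)"
    using h hc by (simp add: stabilizer_def)
  moreover have "stabilizer (Gam k) (nact N) (vr u) = {\<one>\<^bsub>Gam k\<^esub>}"
    using free vr_node[OF u(1)] by (simp add: free_gam_graph_def)
  ultimately have "?h = \<one>\<^bsub>Gam k\<^esub>" by simp
  then have "g = g'" using g by (metis gam.inv_closed gam.inv_equality gam.inv_inv gam.inv_comm)
  then show ?thesis using uu by simp
qed

lemma ends_edge:
  assumes "a \<in> arcs G" "g \<in> carrier (Gam k)"
  shows "ends N (eact N g (er a)) =
    {nact N g (vr (tail G a)), nact N (g \<otimes>\<^bsub>Gam k\<^esub> col a) (vr (head G a))}"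
proof -
  have "ends N (eact N g (er a)) = nact N g ` ends N (er a)"
    using free er_edge[OF assms(1)] assms(2) by (simp add: free_gam_graph_def)
  moreover have "nact N (g \<otimes>\<^bsub>Gam k\<^esub> col a) (vr (head G a)) = nact N g (nact N (col a) (vr (head G a)))"
    using assms col_carrier by (intro na.composition_rule vr_node) auto
  ultimately show ?thesis by (simp add: ends_er[OF assms(1)])
qed

lemma cx_dir:
  assumes "a \<in> arcs G" "g \<in> carrier (Gam k)"
  shows "cx (d (eact N g (er a))) = zeta k ^ snd g * cx (d (er a))"
proof -
  have "d (eact N g (er a)) = (((*v) (Rot k)) ^^ snd g) (d (er a))"
    using net er_edge[OF assms(1)] assms(2) by (simp add: direction_network_def)
  then show ?thesis by (simp add: cx_Rot_funpow)
qed

lemma grow_dirs: "a \<in> arcs G \<Longrightarrow> grow dirs a x = Im (cnj (cx (d (er a))) * gap k G col a x)"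
  by (simp add: edge_row_def gap1_def gap2_def dirs_def cx_def)

lemma verts_nonempty: "verts G \<noteq> {}"
proof -
  have "infinite (nodes N)" using free by (simp add: free_gam_graph_def)
  then obtain i where "i \<in> nodes N" by fastforce
  then show ?thesis using node_cases by blast
qed

lemma cact_mult: "cact k x (g \<otimes>\<^bsub>Gam k\<^esub> h) z = cact k x g (cact k x h z)"
  unfolding cact_def by (rule act_mult[OF index compat_vec])

text \<open>\<open>(p, \<Phi>)\<close> is the solution \<open>x\<close>, translated by \<open>s\<close>.\<close>

definition represents ::
  "(('a + bool) \<times> bool \<Rightarrow> real) \<Rightarrow> complex \<Rightarrow> ('v \<Rightarrow> real^2) \<Rightarrow> (gam \<Rightarrow> euc) \<Rightarrow> bool" where
  "represents x s p \<Phi> \<longleftrightarrow>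
     (\<forall>g\<in>carrier (Gam k). \<forall>y. cx (euc_apply (\<Phi> g) y) = cact k x g (cx y - s) + s) \<and>
     (\<forall>u\<in>verts G. \<forall>g\<in>carrier (Gam k). cx (p (nact N g (vr u))) = cact k x g (point x u) + s)"

text \<open>Within an edge orbit the gap changes only by a rotation, so directions and collapse can
  be tested on one representative.\<close>

lemma represents_edge:
  assumes r: "represents x s p \<Phi>" and a: "a \<in> arcs G" "g \<in> carrier (Gam k)"
  shows "cx (p (nact N g (vr (tail G a)))) - cx (p (nact N (g \<otimes>\<^bsub>Gam k\<^esub> col a) (vr (head G a)))) =
    zeta k ^ snd g * gap k G col a x"
proof -
  have "g \<otimes>\<^bsub>Gam k\<^esub> col a \<in> carrier (Gam k)" using a col_carrier by simp
  then have "cx (p (nact N g (vr (tail G a)))) - cx (p (nact N (g \<otimes>\<^bsub>Gam k\<^esub> col a) (vr (head G a)))) =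
      cact k x g (point x (tail G a)) - cact k x g (cact k x (col a) (point x (head G a)))"
    using r a by (simp add: represents_def cact_mult)
  also have "\<dots> = zeta k ^ snd g * gap k G col a x"
    by (simp add: gap_def cact_def act_def algebra_simps)
  finally show ?thesis .
qed

lemma one_act:
  assumes "u \<in> verts G"
  shows "nact N \<one>\<^bsub>Gam k\<^esub> (vr u) = vr u"
  using na.id_eq_one vr_node[OF assms] by (metis restrict_apply')

lemma realization_represents:
  assumes "realization k N d p \<Phi>" "v \<in> verts G"
  obtains x s where "represents x s p \<Phi>" "\<forall>q\<in>pins v. x q = 0"
proof -
  have al: "allowed_rep k \<Phi>" and eqv: "\<And>g i. g \<in> carrier (Gam k) \<Longrightarrow> i \<in> nodes N \<Longrightarrow>
      euc_apply (\<Phi> g) (p i) = p (nact N g i)"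
    using assms(1) by (auto simp: realization_def)
  \<comment> \<open>For \<open>k = 1\<close> there is no rotation centre; the origin is moved to the
    pinned vertex instead.\<close>
  obtain v1 v2 s where v: "compat k v1 v2" "k = 1 \<Longrightarrow> s = cx (p (vr v))"
    "\<And>g y. g \<in> carrier (Gam k) \<Longrightarrow> cx (euc_apply (\<Phi> g) y) = act k v1 v2 g (cx y - s) + s"
    using allowed_rep_form[OF index al, of "cx (p (vr v))"] by blast
  define x where "x = mk_unk (\<lambda>u. cx (p (vr u)) - s) (\<lambda>b. if b then v2 else v1)"
  have px: "point x u = cx (p (vr u)) - s" for u by (simp add: x_def pos_mk_unk)
  have "cact k x = act k v1 v2"
    using v(1) by (auto simp: cact_def x_def vec_mk_unk vec2_def compat_def fun_eq_iff)
  then have "represents x s p \<Phi>"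
    unfolding represents_def using v(3) by (auto simp: px vr_node simp flip: eqv)
  moreover have "\<forall>q\<in>pins v. x q = 0"
  proof (cases "k = 1")
    case True
    then have "point x v = 0" using v(2) by (simp add: px)
    then have "x (Inl v, s') = 0" for s'
      by (cases s') (simp_all add: point_def unk_def complex_eq_iff)
    then show ?thesis by (auto simp: pins_def)
  next
    case False
    then show ?thesis by (simp add: pins_def)
  qed
  ultimately show ?thesis by (rule that)
qed

lemma represents_solution:
  assumes "represents x s p \<Phi>" "realization k N d p \<Phi>"
  shows "solution dirs x"
  unfolding solution_def
proof
  fix a assume a: "a \<in> arcs G"
  let ?i = "vr (tail G a)" and ?j = "nact N (col a) (vr (head G a))"
  have "cx (p ?i) - cx (p ?j) = gap k G col a x"
    using represents_edge[OF assms(1) a, of "\<one>\<^bsub>Gam k\<^esub>"] col_carrier[OF a] a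
    by (simp add: one_act Gam_one[symmetric]) (simp add: Gam_one)
  moreover have "(p ?i - p ?j) \<bullet> perp (d (er a)) = 0"
    using assms(2) er_edge[OF a] ends_er[OF a] by (auto simp: realization_def)
  ultimately show "grow dirs a x = 0"
    unfolding grow_dirs[OF a] inner_perp by simp
qed

lemma represents_collapsed:
  assumes r: "represents x s p \<Phi>"
  shows "(\<forall>e\<in>edges N. \<not> collapsed N p e) \<longleftrightarrow> (\<forall>a\<in>arcs G. gap k G col a x \<noteq> 0)"
proof -
  have iff: "collapsed N p (eact N g (er a)) \<longleftrightarrow> gap k G col a x = 0"
    if a: "a \<in> arcs G" "g \<in> carrier (Gam k)" for a g
  proof -
    have "collapsed N p (eact N g (er a)) \<longleftrightarrow>
        p (nact N g (vr (tail G a))) = p (nact N (g \<otimes>\<^bsub>Gam k\<^esub> col a) (vr (head G a)))"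
      unfolding collapsed_def ends_edge[OF a] by (auto simp: doubleton_eq_iff)
    also have "\<dots> \<longleftrightarrow> cx (p (nact N g (vr (tail G a)))) -
        cx (p (nact N (g \<otimes>\<^bsub>Gam k\<^esub> col a) (vr (head G a)))) = 0" by simp
    finally show ?thesis unfolding represents_edge[OF r a] by simp
  qed
  show ?thesis
  proof
    assume L: "\<forall>e\<in>edges N. \<not> collapsed N p e"
    show "\<forall>a\<in>arcs G. gap k G col a x \<noteq> 0"
    proof
      fix a assume a: "a \<in> arcs G"
      have "eact N \<one>\<^bsub>Gam k\<^esub> (er a) \<in> edges N"
        using ea.element_image[OF gam.one_closed er_edge[OF a] refl] .
      then show "gap k G col a x \<noteq> 0" using L iff[OF a gam.one_closed] by blast
    qed
  next
    assume R: "\<forall>a\<in>arcs G. gap k G col a x \<noteq> 0"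
    show "\<forall>e\<in>edges N. \<not> collapsed N p e"
    proof
      fix e assume "e \<in> edges N"
      then obtain a g where "a \<in> arcs G" "g \<in> carrier (Gam k)" "e = eact N g (er a)" by (rule edge_cases)
      then show "\<not> collapsed N p e" using R iff by simp
    qed
  qed
qed

lemma represents_trivial:
  assumes r: "represents x s p \<Phi>"
  shows "trivial_rep k \<Phi> \<longleftrightarrow> lvec x False = 0 \<and> vec2 k (lvec x) = 0"
proof
  assume T: "trivial_rep k \<Phi>"
  have "lat (lvec x False) (vec2 k (lvec x)) t = 0" for t
  proof -
    have tc: "(t, 0) \<in> carrier (Gam k)" using k_pos by (simp add: Gam_carrier)
    have "\<Phi> (t, 0) = (0, mat 1)"
      using T by (simp add: trivial_rep_def translation_part_iff[OF k_pos])
    then have "cact k x (t, 0) (0 - s) + s = 0"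
      using r tc unfolding represents_def by (metis cx_simps(3) euc_apply.simps matrix_vector_mul_lid add.left_neutral)
    then show ?thesis by (simp add: cact_def act_def)
  qed
  from this[of "(1, 0)"] this[of "(0, 1)"] show "lvec x False = 0 \<and> vec2 k (lvec x) = 0"
    by (simp add: lat_def)
next
  assume v: "lvec x False = 0 \<and> vec2 k (lvec x) = 0"
  show "trivial_rep k \<Phi>"
    unfolding trivial_rep_def
  proof
    fix h assume h: "h \<in> translation_part k"
    then have hc: "h \<in> carrier (Gam k)" by (simp add: translation_part_def)
    have h0: "snd h = 0" using h translation_part_iff[OF k_pos] by blast
    have "cx (euc_apply (\<Phi> h) y) = cx y" for y
      using r hc h0 v by (simp add: represents_def cact_def act_def lat_def)
    then show "\<Phi> h = (0, mat 1)" by (intro euc_eqI) simp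
  qed
qed

section \<open>Realizations constructed from solutions\<close>

definition node_place :: "(('a + bool) \<times> bool \<Rightarrow> real) \<Rightarrow> 'v \<Rightarrow> real^2" where
  "node_place x i = (let (u, g) = (SOME (u, g). u \<in> verts G \<and> g \<in> carrier (Gam k) \<and> i = nact N g (vr u))
     in cv (cact k x g (point x u)))"

text \<open>\<open>node_unique\<close> leaves only one pair to choose.\<close>

lemma node_place_eq:
  assumes "u \<in> verts G" "g \<in> carrier (Gam k)"
  shows "node_place x (nact N g (vr u)) = cv (cact k x g (point x u))"
proof -
  have "(SOME (u', g'). u' \<in> verts G \<and> g' \<in> carrier (Gam k) \<and> nact N g (vr u) = nact N g' (vr u')) = (u, g)"
    using assms node_unique[OF assms(1) _ assms(2)] by (intro some_equality) auto
  then show ?thesis by (simp add: node_place_def)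
qed

definition std_at :: "(('a + bool) \<times> bool \<Rightarrow> real) \<Rightarrow> gam \<Rightarrow> euc" where
  "std_at x = std_rep k (lvec x False) (vec2 k (lvec x))"

lemma represents_node_place: "represents x 0 (node_place x) (std_at x)"
  by (simp add: represents_def std_at_def std_rep_apply node_place_eq flip: cact_def)

lemma realization_node_place:
  assumes "solution dirs x"
  shows "realization k N d (node_place x) (std_at x)"
  unfolding realization_def
proof (intro conjI ballI allI impI)
  note r = represents_node_place[of x]
  have hom: "std_at x \<in> hom (Gam k) Euc2"
    unfolding std_at_def by (rule std_rep_hom[OF index compat_vec])
  show "allowed_rep k (std_at x)"
    unfolding allowed_rep_def
  proof (intro conjI exI)
    show "std_at x t1 = (cv (lvec x False), mat 1)" "std_at x t2 = (cv (vec2 k (lvec x)), mat 1)"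
      by (simp_all add: std_at_def std_rep_def lat_def t1_def t2_def)
    show "2 \<le> k \<longrightarrow> std_at x rgen = (0, Rot k)"
      by (simp add: std_at_def std_rep_def lat_def rgen_def rotm_zeta cv_simps)
    show "3 \<le> k \<longrightarrow> cv (vec2 k (lvec x)) = Rot k *v cv (lvec x False)"
    proof
      assume "3 \<le> k"
      then have "cx (cv (vec2 k (lvec x))) = cx (Rot k *v cv (lvec x False))"
        by (simp add: cx_Rot vec2_def)
      then show "cv (vec2 k (lvec x)) = Rot k *v cv (lvec x False)"
        by (simp only: cx_inject)
    qed
  qed (rule hom)
next
  fix e i j assume e: "e \<in> edges N" and ij: "ends N e = {i, j}"
  obtain a g where ag: "a \<in> arcs G" "g \<in> carrier (Gam k)" "e = eact N g (er a)"
    using edge_cases[OF e] .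
  let ?i = "nact N g (vr (tail G a))" and ?j = "nact N (g \<otimes>\<^bsub>Gam k\<^esub> col a) (vr (head G a))"
  let ?p = "node_place x"
  \<comment> \<open>Edge and direction turn by the same \<open>zeta k ^ snd g\<close>, which cancels
    against its conjugate.\<close>
  have "cnj (zeta k ^ snd g) * zeta k ^ snd g = 1"
    using complex_norm_square[of "zeta k ^ snd g"] unfolding norm_zeta_power by (simp add: mult.commute)
  then have e1: "cnj (cx (d e)) * (zeta k ^ snd g * gap k G col a x) = cnj (cx (d (er a))) * gap k G col a x"
    unfolding ag(3) cx_dir[OF ag(1,2)] by (simp add: mult.assoc mult.left_commute mult.commute)
  have e2: "Im (cnj (cx (d (er a))) * gap k G col a x) = 0"
    using assms ag(1) by (simp add: solution_def grow_dirs)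
  have e3: "cx (?p ?i - ?p ?j) = zeta k ^ snd g * gap k G col a x"
    using represents_edge[OF represents_node_place ag(1,2)] by simp
  have 0: "(?p ?i - ?p ?j) \<bullet> perp (d e) = 0"
    unfolding inner_perp e3 e1 by (rule e2)
  have "(i = ?i \<and> j = ?j) \<or> (i = ?j \<and> j = ?i)"
    using ij unfolding ag(3) ends_edge[OF ag(1,2)] by (auto simp: doubleton_eq_iff)
  then show "(?p i - ?p j) \<bullet> perp (d e) = 0"
    using 0 by (auto simp: inner_diff_left)
next
  fix h i assume h: "h \<in> carrier (Gam k)" and i: "i \<in> nodes N"
  obtain u g where ug: "u \<in> verts G" "g \<in> carrier (Gam k)" "i = nact N g (vr u)"
    using node_cases[OF i] .
  have "nact N h i = nact N (h \<otimes>\<^bsub>Gam k\<^esub> g) (vr u)"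
    using na.composition_rule[OF vr_node[OF ug(1)] h ug(2)] ug(3) by simp
  moreover have "cx (euc_apply (std_at x h) (node_place x i)) = cact k x h (cact k x g (point x u))"
    using represents_node_place[of x] h unfolding ug(3) node_place_eq[OF ug(1,2)]
    by (simp add: represents_def)
  ultimately have "cx (euc_apply (std_at x h) (node_place x i)) = cx (node_place x (nact N h i))"
    using node_place_eq[OF ug(1), of "h \<otimes>\<^bsub>Gam k\<^esub> g" x] h ug(2) by (simp add: cact_mult)
  then show "euc_apply (std_at x h) (node_place x i) = node_place x (nact N h i)"
    by (simp only: cx_inject)
qed

lemma faithful_node_place:
  assumes "solution dirs x" "\<forall>a\<in>arcs G. gap k G col a x \<noteq> 0" "lvec x False \<noteq> 0 \<or> vec2 k (lvec x) \<noteq> 0"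
  shows "faithful_realization k N d (node_place x) (std_at x)"
  using realization_node_place[OF assms(1)] represents_collapsed[OF represents_node_place]
    represents_trivial[OF represents_node_place] assms(2,3)
  by (simp add: faithful_realization_def)

section \<open>Scaling of solutions and similarity of realizations\<close>

lemma scaled_iff:
  "(\<forall>i\<in>I. x' i = c * x i) \<longleftrightarrow> (\<forall>u\<in>verts G. point x' u = of_real c * point x u) \<and>
     lvec x' False = of_real c * lvec x False \<and> vec2 k (lvec x') = of_real c * vec2 k (lvec x)"
proof -
  have unk: "(\<forall>s. x' (j, s) = c * x (j, s)) \<longleftrightarrow> unk x' j = of_real c * unk x j" for j
    by (auto simp: unk_def complex_eq_iff) (metis (full_types))
  have "(\<forall>i\<in>I. x' i = c * x i) \<longleftrightarrow> (\<forall>j\<in>Inl ` verts G \<union> Inr ` vec_index k. unk x' j = of_real c * unk x j)"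
    unfolding unk_index_def unk[symmetric] by auto
  also have "\<dots> \<longleftrightarrow> (\<forall>u\<in>verts G. point x' u = of_real c * point x u) \<and>
      (\<forall>j\<in>vec_index k. lvec x' j = of_real c * lvec x j)"
    by (auto simp: point_def lvec_def)
  also have "(\<forall>j\<in>vec_index k. lvec x' j = of_real c * lvec x j) \<longleftrightarrow>
      lvec x' False = of_real c * lvec x False \<and> vec2 k (lvec x') = of_real c * vec2 k (lvec x)"
    by (auto simp: vec_index_def vec2_def UNIV_bool)
  finally show ?thesis .
qed

lemma cact_scaled:
  assumes "\<forall>i\<in>I. x' i = c * x i"
  shows "cact k x' g (of_real c * z) = of_real c * cact k x g z"
  using assms unfolding scaled_iff by (simp add: cact_def act_def lat_def algebra_simps)

lemma same_up_to_scaled: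
  assumes r: "represents x s p \<Phi>" and r': "represents x' s' p' \<Phi>'"
    and c: "c \<noteq> 0" "\<forall>i\<in>I. x' i = c * x i"
  shows "same_up_to_translation_scaling k N p \<Phi> p' \<Phi>'"
  unfolding same_up_to_translation_scaling_def
\<comment> \<open>The translation carries the scaled centre \<open>of_real c * s\<close> to the
  centre \<open>s'\<close>.\<close>
proof (intro exI[of _ c] exI[of _ "cv (s' - of_real c * s)"] conjI ballI allI)
  let ?t = "cv (s' - of_real c * s)"
  fix i assume "i \<in> nodes N"
  then obtain u g where ug: "u \<in> verts G" "g \<in> carrier (Gam k)" "i = nact N g (vr u)"
    by (rule node_cases)
  have "point x' u = of_real c * point x u" using c(2) ug(1) unfolding scaled_iff by blast
  then have "cx (p' i) = of_real c * cact k x g (point x u) + s'"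
    using r' ug cact_scaled[OF c(2)] by (simp add: represents_def)
  also have "\<dots> = cx (c *\<^sub>R p i + ?t)"
    using r ug by (simp add: represents_def algebra_simps)
  finally show "p' i = c *\<^sub>R p i + ?t" by (simp only: cx_inject)
next
  let ?t = "cv (s' - of_real c * s)"
  fix g y assume g: "g \<in> carrier (Gam k)"
  have "cx (euc_apply (\<Phi>' g) (c *\<^sub>R y + ?t)) = cact k x' g (cx (c *\<^sub>R y + ?t) - s') + s'"
    using r' g unfolding represents_def by blast
  also have "cx (c *\<^sub>R y + ?t) - s' = of_real c * (cx y - s)" by (simp add: algebra_simps)
  also have "cact k x' g (of_real c * (cx y - s)) + s' = of_real c * cact k x g (cx y - s) + s'"
    by (simp only: cact_scaled[OF c(2)])
  also have "\<dots> = of_real c * (cact k x g (cx y - s) + s) + (s' - of_real c * s)"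
    by (simp add: algebra_simps)
  also have "cact k x g (cx y - s) + s = cx (euc_apply (\<Phi> g) y)"
    using r g unfolding represents_def by simp
  also have "of_real c * cx (euc_apply (\<Phi> g) y) + (s' - of_real c * s) = cx (c *\<^sub>R euc_apply (\<Phi> g) y + ?t)"
    by simp
  finally show "euc_apply (\<Phi>' g) (c *\<^sub>R y + ?t) = c *\<^sub>R euc_apply (\<Phi> g) y + ?t"
    by (simp only: cx_inject)
qed (rule c(1))

text \<open>Both realizations are normalized, with the pinned vertex at 0 for \<open>k = 1\<close>
  and the rotation centre at 0 otherwise. The translation in the similarity therefore vanishes and
  only the scaling is left.\<close>

lemma scaled_node_place:
  assumes v: "v \<in> verts G" and x: "\<forall>q\<in>pins v. x q = 0" and x': "\<forall>q\<in>pins v. x' q = 0"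
    and same: "same_up_to_translation_scaling k N (node_place x) (std_at x) (node_place x') (std_at x')"
  shows "\<exists>c. \<forall>i\<in>I. x' i = c * x i"
proof -
  obtain c t where nodes: "\<And>i. i \<in> nodes N \<Longrightarrow> node_place x' i = c *\<^sub>R node_place x i + t"
    and maps: "\<And>g y. g \<in> carrier (Gam k) \<Longrightarrow>
       euc_apply (std_at x' g) (c *\<^sub>R y + t) = c *\<^sub>R euc_apply (std_at x g) y + t"
    using same unfolding same_up_to_translation_scaling_def by blast
  have place: "node_place z (vr u) = cv (point z u)" if "u \<in> verts G" for z u
    using node_place_eq[OF that gam.one_closed, of z] unfolding one_act[OF that] by (simp add: Gam_one cact_def)
  have t0: "cx t = 0"
  proof (cases "k = 1")
    case True
    have "point x v = 0" "point x' v = 0"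
      using x x' True unfolding pins_def by (auto simp: point_def unk_def complex_eq_iff)
    then show ?thesis using nodes[OF vr_node[OF v]] by (simp add: place[OF v] cv_simps)
  next
    case False
    then have k2: "2 \<le> k" using k_pos by simp
    have rg: "rgen \<in> carrier (Gam k)" using k2 by (simp add: rgen_def Gam_carrier)
    have fix0: "cx (euc_apply (std_at z rgen) y) = zeta k * cx y" for z y
      by (simp add: std_at_def std_rep_apply act_def rgen_def lat_def)
    have "cx (euc_apply (std_at x' rgen) (c *\<^sub>R 0 + t)) = cx (c *\<^sub>R euc_apply (std_at x rgen) 0 + t)"
      using maps[OF rg, of 0] by simp
    then have "zeta k * cx t = cx t" by (simp add: fix0)
    moreover have "zeta k \<noteq> 1" using zeta_power_inj[of 1 k 0] k2 by auto
    ultimately show ?thesis by simp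
  qed
  have tr: "cx (euc_apply (std_at z (l, 0)) y) = lat (lvec z False) (vec2 k (lvec z)) l + cx y" for z l y
    by (simp add: std_at_def std_rep_apply act_def)
  have lat: "lat (lvec x' False) (vec2 k (lvec x')) l = of_real c * lat (lvec x False) (vec2 k (lvec x)) l" for l
  proof -
    have "cx (euc_apply (std_at x' (l, 0)) (c *\<^sub>R 0 + t)) = cx (c *\<^sub>R euc_apply (std_at x (l, 0)) 0 + t)"
      using maps[of "(l, 0)" 0] k_pos by (simp add: Gam_carrier)
    then show ?thesis by (simp add: tr t0)
  qed
  have "point x' u = of_real c * point x u" if u: "u \<in> verts G" for u
    using arg_cong[OF nodes[OF vr_node[OF u]], of cx] by (simp add: place[OF u] t0)
  then have "\<forall>i\<in>I. x' i = c * x i"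
    unfolding scaled_iff using lat[of "(1, 0)"] lat[of "(0, 1)"] by (simp add: lat_def)
  then show ?thesis by blast
qed

section \<open>The two directions of the equivalence\<close>

lemma faithful_represents:
  assumes f: "faithful_realization k N d p \<Phi>" and v: "v \<in> verts G"
  obtains x s where "represents x s p \<Phi>" "\<forall>q\<in>pins v. x q = 0" "solution dirs x"
    "\<forall>a\<in>arcs G. gap k G col a x \<noteq> 0" "lvec x False \<noteq> 0 \<or> vec2 k (lvec x) \<noteq> 0"
proof -
  have re: "realization k N d p \<Phi>" using f by (simp add: faithful_realization_def)
  obtain x s where x: "represents x s p \<Phi>" "\<forall>q\<in>pins v. x q = 0"
    using realization_represents[OF re v] .
  show ?thesis
    using that[OF x represents_solution[OF x(1) re]] represents_collapsed[OF x(1)]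
      represents_trivial[OF x(1)] f by (simp add: faithful_realization_def)
qed

lemma faithful_counts:
  assumes "generic dirs" "has_faithful_realization k N d"
  shows "\<forall>F \<subseteq> arcs G. F \<noteq> {} \<longrightarrow> card F + 1 \<le> gap_rank F"
proof -
  obtain v where v: "v \<in> verts G" using verts_nonempty by blast
  obtain p \<Phi> where f: "faithful_realization k N d p \<Phi>"
    using assms(2) by (auto simp: has_faithful_realization_def)
  obtain x s where "represents x s p \<Phi>" "\<forall>q\<in>pins v. x q = 0" "solution dirs x"
    "\<forall>a\<in>arcs G. gap k G col a x \<noteq> 0" "lvec x False \<noteq> 0 \<or> vec2 k (lvec x) \<noteq> 0"
    using faithful_represents[OF f v] .
  then show ?thesis using solution_counts[OF assms(1), of x] by blast
qed

text \<open>The count for the full edge set and the bound \<open>gap_rank_le\<close> on its rank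
  give the opposite inequality, so the number of edges is exact.\<close>

lemma laman_if_enough_edges:
  assumes "generic dirs" "has_faithful_realization k N d" "laman_count k G \<le> int (card (arcs G))"
  shows "colored_laman k G col"
proof -
  note counts = faithful_counts[OF assms(1,2)]
  obtain v where v: "v \<in> verts G" using verts_nonempty by blast
  \<comment> \<open>Positivity guarantees an edge; the counts speak about the full edge set only if
    it is nonempty.\<close>
  have "0 < laman_count k G"
  proof -
    have "1 \<le> card (vec_index k)" by (simp add: vec_index_def)
    moreover have "T_val k (carrier (Gam k)) \<le> 2" by (simp add: T_val_def)
    moreover have "1 \<le> card (verts G)" using v by (simp add: Suc_le_eq card_gt_0_iff) blast
    ultimately show ?thesis
      unfolding laman_count_def rep_translation_part[OF index] by linarith
  qed
  then have "arcs G \<noteq> {}" using assms(3) by auto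
  then have "card (arcs G) + 1 \<le> gap_rank (arcs G)" using counts by blast
  then have "int (card (arcs G)) \<le> laman_count k G" using gap_rank_le[OF v] by linarith
  then show ?thesis using counts assms(3) by (simp add: colored_laman_iff)
qed

text \<open>With too few edges a faithful realization can be perturbed to one that is not a scaled
  copy. A nonzero lattice coordinate is held fixed, so the representation stays nontrivial and the
  only possible factor is 1.\<close>

lemma enough_edges_if_unique:
  assumes "has_faithful_realization k N d" "faithful_realizations_unique k N d"
  shows "laman_count k G \<le> int (card (arcs G))"
proof (rule ccontr)
  assume "\<not> ?thesis"
  then have few: "int (card (arcs G)) < laman_count k G" by simp
  obtain v where v: "v \<in> verts G" using verts_nonempty by blast
  obtain p \<Phi> where f: "faithful_realization k N d p \<Phi>"
    using assms(1) by (auto simp: has_faithful_realization_def)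
  obtain x s where x: "represents x s p \<Phi>" "\<forall>q\<in>pins v. x q = 0" "solution dirs x"
    "\<forall>a\<in>arcs G. gap k G col a x \<noteq> 0" "lvec x False \<noteq> 0 \<or> vec2 k (lvec x) \<noteq> 0"
    using faithful_represents[OF f v] .
  have "\<exists>j\<in>vec_index k. lvec x j \<noteq> 0"
    using x(5) by (auto simp: vec_index_def vec2_def UNIV_bool split: if_splits)
  then obtain j where j: "j \<in> vec_index k" "lvec x j \<noteq> 0" by blast
  then obtain b where b: "x (Inr j, b) \<noteq> 0"
    by (auto simp: lvec_def unk_def complex_eq_iff)
  have i: "(Inr j, b) \<in> I" using j(1) by (simp add: unk_index_def)
  obtain x' where x': "solution dirs x'" "\<forall>q\<in>pins v. x' q = 0" "\<forall>a\<in>arcs G. gap k G col a x' \<noteq> 0"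
    "x' (Inr j, b) = x (Inr j, b)" "\<exists>l\<in>I. x' l \<noteq> x l"
    using solution_not_unique[OF v few x(3,2) _ i b] x(4) by blast
  have "lvec x' j \<noteq> 0" using b x'(4) by (cases b) (auto simp: lvec_def unk_def complex_eq_iff)
  then have "lvec x' False \<noteq> 0 \<or> vec2 k (lvec x') \<noteq> 0"
    using j(1) by (cases j) (auto simp: vec_index_def vec2_def split: if_splits)
  then have "faithful_realization k N d (node_place x') (std_at x')"
    by (rule faithful_node_place[OF x'(1,3)])
  moreover have "faithful_realization k N d (node_place x) (std_at x)"
    by (rule faithful_node_place[OF x(3,4,5)])
  ultimately have "same_up_to_translation_scaling k N (node_place x) (std_at x) (node_place x') (std_at x')"
    using assms(2) by (simp add: faithful_realizations_unique_def)
  then obtain c where c: "\<forall>i\<in>I. x' i = c * x i"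
    using scaled_node_place[OF v x(2) x'(2)] by blast
  then have "c = 1" using i b x'(4) by force
  then show False using c x'(5) by simp
qed

lemma laman_imp:
  assumes gen: "generic dirs" and laman: "colored_laman k G col"
  shows "has_faithful_realization k N d" "faithful_realizations_unique k N d"
proof -
  obtain v where v: "v \<in> verts G" using verts_nonempty by blast
  obtain x where x: "solution dirs x" "\<forall>e\<in>arcs G. gap k G col e x \<noteq> 0" "lvec x False \<noteq> 0"
    and uniq: "\<And>x'. solution dirs x' \<Longrightarrow> \<forall>q\<in>pins v. x' q = 0 \<Longrightarrow> \<exists>c. \<forall>i\<in>I. x' i = c * x i"
    using solution_exists_unique[OF gen laman v] by blast
  show "has_faithful_realization k N d"
    using faithful_node_place[OF x(1,2)] x(3) by (auto simp: has_faithful_realization_def)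
  show "faithful_realizations_unique k N d"
    unfolding faithful_realizations_unique_def
  proof (intro allI impI, elim conjE)
    fix p \<Phi> p' \<Phi>'
    assume f: "faithful_realization k N d p \<Phi>" and f': "faithful_realization k N d p' \<Phi>'"
    obtain y s where y: "represents y s p \<Phi>" "\<forall>q\<in>pins v. y q = 0" "solution dirs y"
      "\<forall>a\<in>arcs G. gap k G col a y \<noteq> 0" "lvec y False \<noteq> 0 \<or> vec2 k (lvec y) \<noteq> 0"
      using faithful_represents[OF f v] .
    obtain y' s' where y': "represents y' s' p' \<Phi>'" "\<forall>q\<in>pins v. y' q = 0" "solution dirs y'"
      "\<forall>a\<in>arcs G. gap k G col a y' \<noteq> 0" "lvec y' False \<noteq> 0 \<or> vec2 k (lvec y') \<noteq> 0"
      using faithful_represents[OF f' v] .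
    obtain c where c: "\<forall>i\<in>I. y i = c * x i" using uniq[OF y(3,2)] by blast
    obtain c' where c': "\<forall>i\<in>I. y' i = c' * x i" using uniq[OF y'(3,2)] by blast
    \<comment> \<open>A factor 0 would make all translations trivial, against faithfulness.\<close>
    have "c \<noteq> 0" using c y(5) unfolding scaled_iff by auto
    have "c' \<noteq> 0" using c' y'(5) unfolding scaled_iff by auto
    have "\<forall>i\<in>I. y' i = (c' / c) * y i" using c c' \<open>c \<noteq> 0\<close> by simp
    then show "same_up_to_translation_scaling k N p \<Phi> p' \<Phi>'"
      using \<open>c \<noteq> 0\<close> \<open>c' \<noteq> 0\<close> by (intro same_up_to_scaled[OF y(1) y'(1), of "c' / c"]) auto
  qed
qed

end

theorem theorem3:
  fixes k :: nat
    and G :: "('a, 'b) pre_digraph"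
    and col :: "'b \<Rightarrow> gam"
  assumes "k \<in> {1, 2, 3, 4, 6}"
    and "colored_graph k G col"
  shows "\<exists>Z. proper_algebraic_subset (arcs G) Z \<and>
    (\<forall>(N :: ('v, 'e) gam_graph) d vr er.
       direction_network k N d \<and> colored_quotient k N G col vr er \<and>
       (\<lambda>e \<in> arcs G. d (er e)) \<notin> Z \<longrightarrow>
       (has_faithful_realization k N d \<and> faithful_realizations_unique k N d
          \<longleftrightarrow> colored_laman k G col) \<and>
       (int (card (arcs G)) \<ge> laman_count k G \<longrightarrow>
          (has_faithful_realization k N d \<longleftrightarrow> colored_laman k G col)))"
proof -
  interpret colored_digraph G k col
    using assms by (simp add: colored_digraph_iff)
  \<comment> \<open>\<open>Z\<close> is fixed before the network and its representatives, since
    \<open>generic\<close> refers to the coloured graph alone.\<close>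
  obtain Z where Z: "proper_algebraic_subset (arcs G) Z"
    and gen: "\<And>d. d \<in> arcs G \<rightarrow>\<^sub>E UNIV \<Longrightarrow> d \<notin> Z \<Longrightarrow> generic d"
    using generic_exists by blast
  have main: "(has_faithful_realization k N d \<and> faithful_realizations_unique k N d
          \<longleftrightarrow> colored_laman k G col) \<and>
       (int (card (arcs G)) \<ge> laman_count k G \<longrightarrow>
          (has_faithful_realization k N d \<longleftrightarrow> colored_laman k G col))"
    if net: "direction_network k N d" and quot: "colored_quotient k N G col vr er"
      and nZ: "(\<lambda>e \<in> arcs G. d (er e)) \<notin> Z"
    for N :: "('v, 'e) gam_graph" and d vr er
  proof -
    interpret colored_network G k col N d vr er
      by unfold_locales (rule net, rule quot)
    have g: "generic dirs"
      unfolding dirs_def by (rule gen[OF _ nZ]) auto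
    show ?thesis
      using laman_imp[OF g] laman_if_enough_edges[OF g] enough_edges_if_unique by blast
  qed
  show ?thesis
    by (intro exI[of _ Z] conjI allI impI Z; elim conjE; use main in blast)
qed

end
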